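(* For each $n \in \{2,3,4,5,6,8\}$ there exists a primitive substitution $\sigma$ in $\mathbb{R}^2$ whose hull contains a tiling $\mathcal{T}$ such that $\mathcal{T}$ has dense tile orientations (DTO) and $\mathcal{T}$ is invariant under the rotation by $\frac{2\pi}{n}$ about some point of $\mathbb{R}^2$. Moreover, these tilings are not mirror symmetric (i.e. $\mathcal{T}$ is not invariant under the reflection in any line), hence they occur in pairs for each such $n$: the mirror image of $\mathcal{T}$ in a line through the centre of rotation is a tiling different from $\mathcal{T}$ that also belongs to the hull of $\sigma$ and is also invariant under the rotation by $\frac{2\pi}{n}$ about that centre.
   Context: A tile is a nonempty compact set $T \subset \mathbb{R}^2$ which is the closure of its interior. Tiles may carry a marking or colour (which is moved along with the tile by isometries and may also be used to fix a chirality or orientation of a symmetric tile); two tiles are equivalent if they are congruent (mirror images allowed) and have the same marking or colour. A tiling is a collection $\mathcal{T}=\{T_i \mid i\in\mathbb{N}\}$ of tiles with $\bigcup_i T_i=\mathbb{R}^2$ such that distinct tiles have disjoint interiors. A patch is a finite set of tiles with pairwise disjoint interiors; in particular a finite subset of a tiling $\mathcal{T}$ is a patch of $\mathcal{T}$. A substitution (rule) $\sigma$ in $\mathbb{R}^2$ consists of finitely many prototiles $T_1,\dots,T_m$ (tiles, possibly marked), an inflation factor $\lambda>1$, and for each $i$ a dissection of $\lambda T_i$ into congruent copies of some of the prototiles. The patch resulting from the dissection is denoted $\sigma(T_i)$. The rule extends to congruent copies of prototiles: if $\varphi(x)=Ax+b$ is an isometry ($A$ orthogonal, $b\in\mathbb{R}^2$),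 then $\sigma(\varphi(T_i)) = A\,\sigma(T_i)+\lambda b$. It extends to patches by applying it to every tile, so the iterates $\sigma^k(T_i)$ are defined; $\sigma^k(T_i)$ is called a $k$-th order supertile. The substitution is primitive if there is $k\in\mathbb{N}$ such that each $k$-th order supertile contains tiles equivalent to all prototiles. Equivalently, the matrix $(a_{ij})_{1\le i,j\le m}$, where $a_{ij}$ is the number of tiles in $\sigma(T_j)$ equivalent to $T_i$, has some power with only positive entries. A tiling is generated by $\sigma$ if each of its patches is contained in a congruent copy of some supertile $\sigma^k(T_i)$. The hull of a tiling $\mathcal{T}$ is the closure of the set $\{\mathcal{T}+x \mid x\in\mathbb{R}^2\}$ of its translates in the local topology, in which two tilings are $\varepsilon$-close if they agree on a ball of radius $\frac1\varepsilon$ around the origin, possibly after a small rigid motion (of size less than $\varepsilon$) of one of them. (For the tilings considered here, using all rigid motions instead of translations yields the same hull.) For a primitive substitution $\sigma$, all tilings generated by $\sigma$ define the same hull, called the hull of $\sigma$; its elements are the (primitive) substitution tilings of $\sigma$. A tiling has dense tile orientations (DTO) if the orientations of its tiles are dense in the circle: for some prototile $T_i$, the set of angles $\theta \in [0,2\pi)$ such that the tiling contains a tile of the form $R_\theta T_i + x$ with $x \in \mathbb{R}^2$ (carrying the correspondingly moved marking of $T_i$) is dense in $[0,2\pi)$, where $R_\theta$ is the rotation by $\theta$ about the origin. *)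

theory Defs
  imports "HOL-Analysis.Analysis"
begin

(* The Euclidean plane is the type complex, so that the rotation by an angle t about 0 is
   multiplication by cis t. *)

(* A marking consists of a decoration, i.e. a subset of the tile that is carried along by
   isometries and can single out a chirality or an orientation of a symmetric tile, and of a
   colour, which isometries do not change. *)

datatype tile = Tile (supp: "complex set") (decor: "complex set") (colour: nat)

definition is_tile :: "tile \<Rightarrow> bool" where
  "is_tile t \<longleftrightarrow> supp t \<noteq> {} \<and> compact (supp t) \<and> closure (interior (supp t)) = supp t
     \<and> decor t \<subseteq> supp t"

definition move :: "(complex \<Rightarrow> complex) \<Rightarrow> tile \<Rightarrow> tile" where
  "move f t = Tile (f ` supp t) (f ` decor t) (colour t)"

definition isom :: "(complex \<Rightarrow> complex) \<Rightarrow> complex \<Rightarrow> complex \<Rightarrow> complex" where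
  "isom A b = (\<lambda>z. A z + b)"

definition tile_equiv :: "tile \<Rightarrow> tile \<Rightarrow> bool" where
  "tile_equiv s t \<longleftrightarrow> (\<exists>A b. orthogonal_transformation A \<and> t = move (isom A b) s)"

definition disjoint_interiors :: "tile set \<Rightarrow> bool" where
  "disjoint_interiors P \<longleftrightarrow>
     (\<forall>s\<in>P. \<forall>t\<in>P. s \<noteq> t \<longrightarrow> interior (supp s) \<inter> interior (supp t) = {})"

definition is_tiling :: "tile set \<Rightarrow> bool" where
  "is_tiling T \<longleftrightarrow> countable T \<and> (\<forall>t\<in>T. is_tile t) \<and> (\<Union>t\<in>T. supp t) = UNIV
     \<and> disjoint_interiors T"

definition is_patch :: "tile set \<Rightarrow> bool" where
  "is_patch P \<longleftrightarrow> finite P \<and> (\<forall>t\<in>P. is_tile t) \<and> disjoint_interiors P"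

record substitution =
  protos :: "tile set"
  factor :: real
  dissect :: "tile \<Rightarrow> tile set"

(* The last conjunct says that the extension of the rule to congruent copies of prototiles is
   well defined: a (marked) tile may be a copy of prototiles in several ways, e.g. if a
   prototile has symmetries. *)

definition is_substitution :: "substitution \<Rightarrow> bool" where
  "is_substitution \<sigma> \<longleftrightarrow>
     finite (protos \<sigma>) \<and> protos \<sigma> \<noteq> {} \<and> (\<forall>p\<in>protos \<sigma>. is_tile p) \<and> factor \<sigma> > 1 \<and>
     (\<forall>p\<in>protos \<sigma>. is_patch (dissect \<sigma> p)
        \<and> (\<Union>t\<in>dissect \<sigma> p. supp t) = (\<lambda>z. factor \<sigma> *\<^sub>R z) ` supp p
        \<and> (\<forall>t\<in>dissect \<sigma> p. \<exists>q\<in>protos \<sigma>. tile_equiv q t)) \<and>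
     (\<forall>p\<in>protos \<sigma>. \<forall>q\<in>protos \<sigma>. \<forall>A b B c.
        orthogonal_transformation A \<longrightarrow> orthogonal_transformation B \<longrightarrow>
        move (isom A b) p = move (isom B c) q \<longrightarrow>
        move (isom A (factor \<sigma> *\<^sub>R b)) ` dissect \<sigma> p
          = move (isom B (factor \<sigma> *\<^sub>R c)) ` dissect \<sigma> q)"

(* All members of the family united here coincide, by the last conjunct of is_substitution. *)

definition subst_tile :: "substitution \<Rightarrow> tile \<Rightarrow> tile set" where
  "subst_tile \<sigma> t = \<Union> {move (isom A (factor \<sigma> *\<^sub>R b)) ` dissect \<sigma> p | A b p.
     orthogonal_transformation A \<and> p \<in> protos \<sigma> \<and> t = move (isom A b) p}"

definition subst_patch :: "substitution \<Rightarrow> tile set \<Rightarrow> tile set" where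
  "subst_patch \<sigma> P = (\<Union>t\<in>P. subst_tile \<sigma> t)"

definition supertile :: "substitution \<Rightarrow> nat \<Rightarrow> tile \<Rightarrow> tile set" where
  "supertile \<sigma> k p = (subst_patch \<sigma> ^^ k) {p}"

definition primitive :: "substitution \<Rightarrow> bool" where
  "primitive \<sigma> \<longleftrightarrow> is_substitution \<sigma> \<and>
     (\<exists>k\<ge>1. \<forall>p\<in>protos \<sigma>. \<forall>q\<in>protos \<sigma>. \<exists>t\<in>supertile \<sigma> k p. tile_equiv q t)"

definition generated_by :: "substitution \<Rightarrow> tile set \<Rightarrow> bool" where
  "generated_by \<sigma> T \<longleftrightarrow> is_tiling T \<and>
     (\<forall>P. finite P \<and> P \<subseteq> T \<longrightarrow>
        (\<exists>k. \<exists>p\<in>protos \<sigma>. \<exists>A b. orthogonal_transformation A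
             \<and> P \<subseteq> move (isom A b) ` supertile \<sigma> k p))"

definition agree_on_ball :: "real \<Rightarrow> tile set \<Rightarrow> tile set \<Rightarrow> bool" where
  "agree_on_ball r S T \<longleftrightarrow>
     {t\<in>S. supp t \<inter> ball 0 r \<noteq> {}} = {t\<in>T. supp t \<inter> ball 0 r \<noteq> {}}"

definition eps_close :: "real \<Rightarrow> tile set \<Rightarrow> tile set \<Rightarrow> bool" where
  "eps_close \<epsilon> S T \<longleftrightarrow> (\<exists>\<theta> b. \<bar>\<theta>\<bar> < \<epsilon> \<and> norm b < \<epsilon> \<and>
     (agree_on_ball (1 / \<epsilon>) (move (isom (\<lambda>z. cis \<theta> * z) b) ` S) T
      \<or> agree_on_ball (1 / \<epsilon>) S (move (isom (\<lambda>z. cis \<theta> * z) b) ` T)))"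

definition tiling_hull :: "tile set \<Rightarrow> tile set set" where
  "tiling_hull T =
     {S. is_tiling S \<and> (\<forall>\<epsilon>>0. \<exists>x. eps_close \<epsilon> S (move (\<lambda>z. z + x) ` T))}"

(* The hull of a substitution is the common hull of all tilings generated by it. *)

definition is_hull_of :: "tile set set \<Rightarrow> substitution \<Rightarrow> bool" where
  "is_hull_of H \<sigma> \<longleftrightarrow>
     (\<exists>T. generated_by \<sigma> T) \<and> (\<forall>T. generated_by \<sigma> T \<longrightarrow> tiling_hull T = H)"

definition DTO :: "substitution \<Rightarrow> tile set \<Rightarrow> bool" where
  "DTO \<sigma> T \<longleftrightarrow> (\<exists>p\<in>protos \<sigma>.
     {0..<2 * pi} \<subseteq> closure {\<theta>\<in>{0..<2 * pi}. \<exists>x. move (isom (\<lambda>z. cis \<theta> * z) x) p \<in> T})"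

definition rotation :: "complex \<Rightarrow> real \<Rightarrow> complex \<Rightarrow> complex" where
  "rotation c \<theta> = (\<lambda>z. c + cis \<theta> * (z - c))"

(* reflection c a is the reflection in the line through c with direction cis a. *)

definition reflection :: "complex \<Rightarrow> real \<Rightarrow> complex \<Rightarrow> complex" where
  "reflection c \<alpha> = (\<lambda>z. c + cis (2 * \<alpha>) * cnj (z - c))"

definition invariant_under :: "(complex \<Rightarrow> complex) \<Rightarrow> tile set \<Rightarrow> bool" where
  "invariant_under f T \<longleftrightarrow> move f ` T = T"

end

theory Submission
  imports Defs
begin

text \<open>All prototiles are rectangles, right triangles and one isosceles triangle with apex angle
  \<open>2 \<pi> / N\<close>, the wedge; their side lengths lie in a finitely generated semiring \<open>S\<close> of positive reals.
  For an inflation factor in \<open>S\<close>, inflated rectangles and triangles are cut into prototiles by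
  straight cuts. An inflated unit square has room for anything that fits into a rectangle with sides
  in \<open>S\<close>: unit squares rotated by the irrational angle \<open>arctan (3/4)\<close> or reflected, all other prototiles,
  and a regular \<open>N\<close>-gon cut into \<open>N\<close> wedges around its centre, whose complement in a rectangle consists
  of four right triangles for \<open>N = 5, 6, 8\<close>. As the unit square occurs in every inflated
  prototile, large supertiles contain all smaller ones in almost all orientations and both
  chiralities, so that all generated tilings have the same hull, and they have dense tile
  orientations. The inflated wedge contains the wedge at its apex. Hence inflating the \<open>N\<close>-gon around its
  centre yields a growing sequence of patches, whose union is the tiling.

  If that tiling had a mirror line through the centre, then the wedges at the centre, which are
  rotated copies of each other, would occur in both chiralities. A mirror line off the centre would
  produce two independent periods, hence only finitely many tile orientations.

  The decorations of the prototiles have no symmetries, and their colours are distinct, so that the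
  consistency condition on a substitution holds trivially.\<close>

subsection \<open>Isometries and markings\<close>

text \<open>Rotated and mirrored copies of a generated tiling are generated as well, whereas the
  hull is formed with translations only and \<open>eps_close\<close> forgives just a small rotation.
  So equal hulls force every generated tiling to contain every patch in nearly every orientation and
  in both chiralities. The angle arctan (3/4) is chosen for this because 3, 4, 5 are integers and
  hence lengths, whatever irrationalities the polygon brings in.

  A semiring lacks subtraction, yet cutting a piece off a side leaves a difference of lengths. The
  remedy is a generous inflation factor 1 + 2 \<mu> + x + y: here x and y are the sides of a
  rectangle holding everything that the inflated square has to contain, and \<mu> times any length
  is 1 or 1 plus a length, so that a unit square can be split off. Every remainder that occurs is
  then again a length.

  Polygons with 8, 6 and 5 corners suffice, because an N-fold centre has n-fold symmetry for each
  divisor n of N.\<close>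

lemma move_move: "move f (move g t) = move (\<lambda>z. f (g z)) t"
  by (simp add: move_def image_image)

lemma move_ident [simp]: "move (\<lambda>z. z) t = t"
  by (cases t) (simp add: move_def)

lemma supp_move [simp]: "supp (move f t) = f ` supp t"
  and decor_move [simp]: "decor (move f t) = f ` decor t"
  and colour_move [simp]: "colour (move f t) = colour t"
  by (simp_all add: move_def)

lemma isom_ident [simp]: "isom (\<lambda>z. z) 0 = (\<lambda>z. z)"
  by (simp add: isom_def)

lemma isom_isom:
  assumes "orthogonal_transformation A"
  shows "isom A b (isom B c z) = isom (\<lambda>z. A (B z)) (A c + b) z"
  using linear_add[OF orthogonal_transformation_linear[OF assms]]
  by (simp add: isom_def)

lemma orth_compose:
  "orthogonal_transformation A \<Longrightarrow> orthogonal_transformation B \<Longrightarrow>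
    orthogonal_transformation (\<lambda>z. A (B z))"
  using orthogonal_transformation_compose[of A B] by (simp add: o_def)

lemma orth_0: "orthogonal_transformation A \<Longrightarrow> A 0 = 0"
  by (simp add: linear_0 orthogonal_transformation_linear)

lemma orth_diff: "orthogonal_transformation A \<Longrightarrow> A (x - y) = A x - A y"
  by (simp add: linear_diff orthogonal_transformation_linear)

lemma orth_add: "orthogonal_transformation A \<Longrightarrow> A (x + y) = A x + A y"
  by (simp add: linear_add orthogonal_transformation_linear)

lemma dist_isom: "orthogonal_transformation A \<Longrightarrow> dist (isom A b x) (isom A b y) = dist x y"
  by (simp add: isom_def dist_norm orthogonal_transformation_norm flip: orth_diff)

lemma isom_inverse:
  assumes "orthogonal_transformation A"
  obtains B c where "orthogonal_transformation B"
    "\<And>z. isom A b (isom B c z) = z" "\<And>z. isom B c (isom A b z) = z"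
    "\<And>z. A (B z) = z" "\<And>z. B (A z) = z"
proof -
  let ?B = "inv A"
  have bij: "bij A" and B: "orthogonal_transformation ?B"
    using assms orthogonal_transformation_bij orthogonal_transformation_inv by auto
  have AB: "A (?B z) = z" "?B (A z) = z" for z
    using bij by (simp_all add: bij_is_inj bij_is_surj surj_f_inv_f)
  have "isom A b (isom ?B (- ?B b) z) = z" for z
    using assms by (simp add: isom_def orth_add orth_diff AB flip: diff_conv_add_uminus)
  moreover have "isom ?B (- ?B b) (isom A b z) = z" for z
    using B by (simp add: isom_def orth_add AB)
  ultimately show ?thesis
    using that B AB by blast
qed

lemma bij_isom: "orthogonal_transformation A \<Longrightarrow> bij (isom A b)"
  by (rule isom_inverse[of A b], assumption) (metis (no_types) bijI')

lemma inj_isom: "orthogonal_transformation A \<Longrightarrow> inj (isom A b)"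
  using bij_isom bij_is_inj by blast

lemma interior_isom:
  assumes "orthogonal_transformation A"
  shows "interior (isom A b ` X) = isom A b ` interior X"
proof -
  have "isom A b ` X = (+) b ` A ` X" for X
    by (auto simp: isom_def image_image add.commute)
  then show ?thesis
    using assms interior_translation[of b "A ` X"]
      interior_injective_linear_image[of A X] orthogonal_transformation_inj[OF assms]
      orthogonal_transformation_linear[OF assms]
    by simp
qed

lemma closure_isom:
  assumes "orthogonal_transformation A"
  shows "closure (isom A b ` X) = isom A b ` closure X"
proof -
  have "isom A b ` X = (+) b ` A ` X" for X
    by (auto simp: isom_def image_image add.commute)
  then show ?thesis
    using assms closure_translation[of b "A ` X"]
      closure_injective_linear_image[of A X] orthogonal_transformation_inj[OF assms]
      orthogonal_transformation_linear[OF assms]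
    by simp
qed

lemma continuous_on_isom:
  assumes "orthogonal_transformation A"
  shows "continuous_on X (isom A b)"
  unfolding isom_def
  by (intro continuous_on_add continuous_on_const linear_continuous_on
      linear_linear[THEN iffD2] orthogonal_transformation_linear assms)

lemma is_tile_move:
  assumes "orthogonal_transformation A" "is_tile t"
  shows "is_tile (move (isom A b) t)"
  using assms
  by (auto simp: is_tile_def interior_isom closure_isom
      intro!: compact_continuous_image continuous_on_isom)

lemma isom_image_Int:
  "orthogonal_transformation A \<Longrightarrow> isom A b ` X \<inter> isom A b ` Y = isom A b ` (X \<inter> Y)"
  by (simp add: image_Int[OF inj_isom])

lemma disjoint_interiors_move:
  assumes A: "orthogonal_transformation A" and P: "disjoint_interiors P"
  shows "disjoint_interiors (move (isom A b) ` P)"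
  unfolding disjoint_interiors_def
proof (safe)
  fix s t x
  assume st: "s \<in> P" "t \<in> P" "move (isom A b) s \<noteq> move (isom A b) t"
    and x: "x \<in> interior (supp (move (isom A b) s))" "x \<in> interior (supp (move (isom A b) t))"
  have "interior (supp s) \<inter> interior (supp t) = {}"
    using P st unfolding disjoint_interiors_def by metis
  then have "isom A b ` interior (supp s) \<inter> isom A b ` interior (supp t) = {}"
    by (simp add: isom_image_Int[OF A])
  then show "x \<in> {}"
    using x by (auto simp: interior_isom[OF A])
qed

lemma is_patch_move:
  "orthogonal_transformation A \<Longrightarrow> is_patch P \<Longrightarrow> is_patch (move (isom A b) ` P)"
  by (auto simp: is_patch_def is_tile_move disjoint_interiors_move)

lemma is_tiling_move:
  assumes "orthogonal_transformation A" "is_tiling T"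
  shows "is_tiling (move (isom A b) ` T)"
proof -
  have "(\<Union>t\<in>move (isom A b) ` T. supp t) = isom A b ` (\<Union>t\<in>T. supp t)"
    by auto
  then have "(\<Union>t\<in>move (isom A b) ` T. supp t) = UNIV"
    using assms bij_is_surj[OF bij_isom[OF assms(1)]] by (simp add: is_tiling_def)
  then show ?thesis
    using assms by (auto simp: is_tiling_def is_tile_move disjoint_interiors_move)
qed

lemma tile_equiv_refl: "tile_equiv t t"
  unfolding tile_equiv_def
  by (rule exI[of _ "\<lambda>z. z"], rule exI[of _ 0]) simp

lemma tile_equiv_move:
  assumes "tile_equiv q t" "orthogonal_transformation A"
  shows "tile_equiv q (move (isom A b) t)"
proof -
  obtain B c where "orthogonal_transformation B" "t = move (isom B c) q"
    using assms(1) by (auto simp: tile_equiv_def)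
  then have "move (isom A b) t = move (isom (\<lambda>z. A (B z)) (A c + b)) q"
    "orthogonal_transformation (\<lambda>z. A (B z))"
    using assms(2) by (simp_all add: move_move isom_isom orth_compose)
  then show ?thesis
    unfolding tile_equiv_def by blast
qed

lemma scaleR_image_interior:
  fixes X :: "complex set"
  assumes "m > (0::real)"
  shows "interior ((\<lambda>z. m *\<^sub>R z) ` X) = (\<lambda>z. m *\<^sub>R z) ` interior X"
  by (rule interior_injective_linear_image) (use assms in \<open>auto intro!: injI bounded_linear.linear bounded_linear_scaleR_right\<close>)

lemma orth_complex_cases:
  fixes A :: "complex \<Rightarrow> complex"
  assumes "orthogonal_transformation A"
  obtains a where "cmod a = 1" "A = (\<lambda>z. a * z)" | a where "cmod a = 1" "A = (\<lambda>z. a * cnj z)"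
proof -
  have lin: "linear A"
    using assms by (rule orthogonal_transformation_linear)
  let ?a = "A 1" and ?b = "A \<i>"
  have A: "A z = Re z *\<^sub>R ?a + Im z *\<^sub>R ?b" for z
  proof -
    have "z = Re z *\<^sub>R 1 + Im z *\<^sub>R \<i>"
      by (simp add: complex_eq_iff)
    then have "A z = A (Re z *\<^sub>R 1 + Im z *\<^sub>R \<i>)"
      by simp
    then show ?thesis
      by (simp only: linear_add[OF lin] linear_scale[OF lin])
  qed
  have na: "cmod ?a = 1" and nb: "cmod ?b = 1"
    using orthogonal_transformation_norm[OF assms, of 1] orthogonal_transformation_norm[OF assms, of \<i>]
    by simp_all
  have "inner ?a ?b = inner 1 \<i>"
    using assms by (simp add: orthogonal_transformation_def)
  then have orth: "Re ?a * Re ?b + Im ?a * Im ?b = 0"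
    by (simp add: inner_complex_def)
  have sq: "(Re ?a)\<^sup>2 + (Im ?a)\<^sup>2 = 1" "(Re ?b)\<^sup>2 + (Im ?b)\<^sup>2 = 1"
    using na nb by (simp_all add: cmod_power2[symmetric])
  \<comment> \<open>The determinant of \<open>A\<close>. Lagrange's identity turns orthonormality of
    the columns into \<open>d\<^sup>2 = 1\<close>, and the sign of \<open>d\<close> selects one of
    the two forms.\<close>
  define d where "d = Re ?a * Im ?b - Im ?a * Re ?b"
  have "d\<^sup>2 + (Re ?a * Re ?b + Im ?a * Im ?b)\<^sup>2 = ((Re ?a)\<^sup>2 + (Im ?a)\<^sup>2) * ((Re ?b)\<^sup>2 + (Im ?b)\<^sup>2)"
    by (simp add: d_def power2_eq_square algebra_simps)
  then have "d\<^sup>2 = 1"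
    using orth sq by simp
  have "?b = d *\<^sub>R (\<i> * ?a)"
  proof -
    have "Re ?b = ((Re ?a)\<^sup>2 + (Im ?a)\<^sup>2) * Re ?b"
      using sq by simp
    also have "\<dots> = Re ?a * (Re ?a * Re ?b + Im ?a * Im ?b) - d * Im ?a"
      by (simp add: d_def power2_eq_square algebra_simps)
    finally have 1: "Re ?b = - (d * Im ?a)"
      using orth by simp
    have "Im ?b = ((Re ?a)\<^sup>2 + (Im ?a)\<^sup>2) * Im ?b"
      using sq by simp
    also have "\<dots> = Im ?a * (Re ?a * Re ?b + Im ?a * Im ?b) + d * Re ?a"
      by (simp add: d_def power2_eq_square algebra_simps)
    finally have 2: "Im ?b = d * Re ?a"
      using orth by simp
    show ?thesis
      using 1 2 by (simp add: complex_eq_iff)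
  qed
  moreover have "d = 1 \<or> d = -1"
    using \<open>d\<^sup>2 = 1\<close> by (simp add: power2_eq_1_iff)
  ultimately have "?b = \<i> * ?a \<or> ?b = - (\<i> * ?a)"
    by auto
  then show ?thesis
  proof
    assume b: "?b = \<i> * ?a"
    have "A = (\<lambda>z. ?a * z)"
    proof
      fix z
      show "A z = ?a * z"
        by (subst A, subst b) (simp add: complex_eq_iff algebra_simps)
    qed
    then show ?thesis
      using that(1) na by blast
  next
    assume b: "?b = - (\<i> * ?a)"
    have "A = (\<lambda>z. ?a * cnj z)"
    proof
      fix z
      show "A z = ?a * cnj z"
        by (subst A, subst b) (simp add: complex_eq_iff algebra_simps)
    qed
    then show ?thesis
      using that(2) na by blast
  qed
qed

lemma orth_mult: "cmod a = 1 \<Longrightarrow> orthogonal_transformation (\<lambda>z. a * z)"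
  by (auto simp: orthogonal_transformation norm_mult intro!: linearI simp: algebra_simps)

lemma orth_mult_cnj: "cmod a = 1 \<Longrightarrow> orthogonal_transformation (\<lambda>z. a * cnj z)"
  by (auto simp: orthogonal_transformation norm_mult intro!: linearI simp: algebra_simps)

text \<open>A rotation commutes with an orientation-preserving \<open>B\<close> and is inverted by
  an orientation-reversing one. Either way a bound on the absolute value of an error angle
  survives.\<close>

lemma orth_conj_cis:
  assumes "orthogonal_transformation B"
  shows "\<exists>s\<in>{1,-1}. \<forall>\<delta> z. B (cis \<delta> * z) = cis (s * \<delta>) * B z"
  using assms by (cases rule: orth_complex_cases) (auto simp: cis_cnj mult_ac)

subsection \<open>Iterating a substitution\<close>

text \<open>The invariant carried through all iterations: it passes from a patch to its moved and to
  its inflated version.\<close>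

definition dissects :: "tile set \<Rightarrow> complex set \<Rightarrow> tile set \<Rightarrow> bool" where
  "dissects Q X P \<longleftrightarrow>
     is_patch P \<and> (\<Union>t\<in>P. supp t) = X \<and> (\<forall>t\<in>P. \<exists>q\<in>Q. tile_equiv q t)"

lemma dissects_move:
  assumes "orthogonal_transformation A" "dissects Q X P"
  shows "dissects Q (isom A b ` X) (move (isom A b) ` P)"
proof -
  have "\<exists>q\<in>Q. tile_equiv q t" if "t \<in> move (isom A b) ` P" for t
    using assms that tile_equiv_move unfolding dissects_def by blast
  moreover have "(\<Union>t\<in>move (isom A b) ` P. supp t) = isom A b ` (\<Union>t\<in>P. supp t)"
    by auto
  ultimately show ?thesis
    using assms by (simp add: dissects_def is_patch_move)
qed

locale substitution_rule =
  fixes \<sigma> :: substitution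
  assumes is_subst: "is_substitution \<sigma>"
begin

abbreviation "\<Lambda> \<equiv> factor \<sigma>"
abbreviation "inflate k P \<equiv> (subst_patch \<sigma> ^^ k) P"

definition copy :: "tile \<Rightarrow> bool" where
  "copy t \<longleftrightarrow> (\<exists>q\<in>protos \<sigma>. tile_equiv q t)"

lemma factor_gt_1: "\<Lambda> > 1"
  using is_subst by (simp add: is_substitution_def)

lemma factor_power_pos: "\<Lambda> ^ k > 0"
  using factor_gt_1 by simp

lemma copyE:
  assumes "copy t"
  obtains p A b where "p \<in> protos \<sigma>" "orthogonal_transformation A" "t = move (isom A b) p"
  using assms by (auto simp: copy_def tile_equiv_def)

lemma copy_proto: "p \<in> protos \<sigma> \<Longrightarrow> copy p"
  using tile_equiv_refl by (auto simp: copy_def)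

lemma copy_move: "copy t \<Longrightarrow> orthogonal_transformation A \<Longrightarrow> copy (move (isom A b) t)"
  unfolding copy_def using tile_equiv_move by blast

lemma dissects_dissect: "p \<in> protos \<sigma> \<Longrightarrow> dissects (protos \<sigma>) ((\<lambda>z. \<Lambda> *\<^sub>R z) ` supp p) (dissect \<sigma> p)"
  using is_subst by (auto simp: is_substitution_def dissects_def)

text \<open>The consistency clause of \<open>is_substitution\<close> collapses the union that
  defines \<open>subst_tile\<close> to a single member.\<close>

lemma subst_tile_move_proto:
  assumes "p \<in> protos \<sigma>" "orthogonal_transformation A"
  shows "subst_tile \<sigma> (move (isom A b) p) = move (isom A (\<Lambda> *\<^sub>R b)) ` dissect \<sigma> p"
proof -
  have "move (isom B (\<Lambda> *\<^sub>R c)) ` dissect \<sigma> q = move (isom A (\<Lambda> *\<^sub>R b)) ` dissect \<sigma> p"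
    if "orthogonal_transformation B" "q \<in> protos \<sigma>" "move (isom A b) p = move (isom B c) q" for B c q
  proof -
    have "\<forall>p\<in>protos \<sigma>. \<forall>q\<in>protos \<sigma>. \<forall>A b B c.
        orthogonal_transformation A \<longrightarrow> orthogonal_transformation B \<longrightarrow>
        move (isom A b) p = move (isom B c) q \<longrightarrow>
        move (isom A (\<Lambda> *\<^sub>R b)) ` dissect \<sigma> p = move (isom B (\<Lambda> *\<^sub>R c)) ` dissect \<sigma> q"
      using is_subst unfolding is_substitution_def by (elim conjE)
    from this[rule_format, OF assms(1) that(2) assms(2) that(1,3)] show ?thesis
      by (rule sym)
  qed
  then have "{move (isom B (\<Lambda> *\<^sub>R c)) ` dissect \<sigma> q | B c q.
     orthogonal_transformation B \<and> q \<in> protos \<sigma> \<and> move (isom A b) p = move (isom B c) q}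
     = {move (isom A (\<Lambda> *\<^sub>R b)) ` dissect \<sigma> p}"
    using assms by blast
  then show ?thesis
    by (simp add: subst_tile_def)
qed

lemma subst_tile_proto: "p \<in> protos \<sigma> \<Longrightarrow> subst_tile \<sigma> p = dissect \<sigma> p"
  using subst_tile_move_proto[of p "\<lambda>z. z" 0] by simp

lemma subst_tile_move:
  assumes "copy t" "orthogonal_transformation A"
  shows "subst_tile \<sigma> (move (isom A b) t) = move (isom A (\<Lambda> *\<^sub>R b)) ` subst_tile \<sigma> t"
proof -
  obtain p B c where t: "p \<in> protos \<sigma>" "orthogonal_transformation B" "t = move (isom B c) p"
    using assms(1) by (rule copyE)
  have "move (isom A b) t = move (isom (\<lambda>z. A (B z)) (A c + b)) p"
    using assms t by (simp add: move_move isom_isom)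
  then have "subst_tile \<sigma> (move (isom A b) t)
      = move (isom (\<lambda>z. A (B z)) (\<Lambda> *\<^sub>R (A c + b))) ` dissect \<sigma> p"
    using t assms by (simp add: subst_tile_move_proto orth_compose)
  also have "\<dots> = move (isom A (\<Lambda> *\<^sub>R b)) ` move (isom B (\<Lambda> *\<^sub>R c)) ` dissect \<sigma> p"
    using assms t
    by (simp add: image_image move_move isom_isom scaleR_add_right orthogonal_transformation_scaleR)
  finally show ?thesis
    using t by (simp add: subst_tile_move_proto)
qed

lemma dissects_subst_tile:
  assumes "copy t"
  shows "dissects (protos \<sigma>) ((\<lambda>z. \<Lambda> *\<^sub>R z) ` supp t) (subst_tile \<sigma> t)"
proof -
  obtain p B c where t: "p \<in> protos \<sigma>" "orthogonal_transformation B" "t = move (isom B c) p"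
    using assms(1) by (rule copyE)
  have "(\<lambda>z. \<Lambda> *\<^sub>R z) ` supp t = isom B (\<Lambda> *\<^sub>R c) ` (\<lambda>z. \<Lambda> *\<^sub>R z) ` supp p"
    using t by (simp add: image_image isom_def scaleR_add_right orthogonal_transformation_scaleR)
  then show ?thesis
    using t dissects_move[OF t(2) dissects_dissect[OF t(1)]] by (simp add: subst_tile_move_proto)
qed

lemma dissects_subst_patch:
  assumes P: "dissects (protos \<sigma>) X P"
  shows "dissects (protos \<sigma>) ((\<lambda>z. \<Lambda> *\<^sub>R z) ` X) (subst_patch \<sigma> P)"
proof -
  have cp: "copy t" if "t \<in> P" for t
    using P that by (auto simp: dissects_def copy_def)
  have D: "dissects (protos \<sigma>) ((\<lambda>z. \<Lambda> *\<^sub>R z) ` supp t) (subst_tile \<sigma> t)" if "t \<in> P" for t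
    using cp dissects_subst_tile that by blast
  \<comment> \<open>Tiles from different parents stay apart because each lies in its inflated
    parent, and inflation keeps the interiors of the parents disjoint.\<close>
  have sub: "interior (supp s) \<subseteq> (\<lambda>z. \<Lambda> *\<^sub>R z) ` interior (supp t)" if "t \<in> P" "s \<in> subst_tile \<sigma> t" for s t
  proof -
    have "supp s \<subseteq> (\<lambda>z. \<Lambda> *\<^sub>R z) ` supp t"
      using D[OF that(1)] that(2) by (auto simp: dissects_def)
    then have "interior (supp s) \<subseteq> interior ((\<lambda>z. \<Lambda> *\<^sub>R z) ` supp t)"
      by (rule interior_mono)
    then show ?thesis
      using scaleR_image_interior[of \<Lambda> "supp t"] factor_gt_1 by simp
  qed
  have "disjoint_interiors (subst_patch \<sigma> P)"
    unfolding disjoint_interiors_def subst_patch_def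
  proof (intro ballI impI)
    fix s s' assume s: "s \<in> (\<Union>t\<in>P. subst_tile \<sigma> t)" "s' \<in> (\<Union>t\<in>P. subst_tile \<sigma> t)" "s \<noteq> s'"
    then obtain t t' where t: "t \<in> P" "t' \<in> P" "s \<in> subst_tile \<sigma> t" "s' \<in> subst_tile \<sigma> t'"
      by auto
    show "interior (supp s) \<inter> interior (supp s') = {}"
    proof (cases "t = t'")
      case True
      then show ?thesis
        using D[OF t(1)] s t by (auto simp: dissects_def is_patch_def disjoint_interiors_def)
    next
      case False
      then have "interior (supp t) \<inter> interior (supp t') = {}"
        using P t by (auto simp: dissects_def is_patch_def disjoint_interiors_def)
      moreover have "inj (\<lambda>z::complex. \<Lambda> *\<^sub>R z)"
        using factor_gt_1 by (auto intro!: injI)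
      ultimately have "(\<lambda>z. \<Lambda> *\<^sub>R z) ` interior (supp t) \<inter> (\<lambda>z. \<Lambda> *\<^sub>R z) ` interior (supp t') = {}"
        by (simp flip: image_Int)
      then show ?thesis
        using sub[OF t(1,3)] sub[OF t(2,4)] by blast
    qed
  qed
  moreover have "finite (subst_patch \<sigma> P)"
    using P D by (auto simp: subst_patch_def dissects_def is_patch_def)
  moreover have "\<forall>s\<in>subst_patch \<sigma> P. is_tile s \<and> (\<exists>q\<in>protos \<sigma>. tile_equiv q s)"
    using D by (auto simp: subst_patch_def dissects_def is_patch_def)
  moreover have "(\<Union>s\<in>subst_patch \<sigma> P. supp s) = (\<lambda>z. \<Lambda> *\<^sub>R z) ` X"
  proof -
    have "(\<Union>s\<in>subst_patch \<sigma> P. supp s) = (\<Union>t\<in>P. \<Union>s\<in>subst_tile \<sigma> t. supp s)"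
      by (auto simp: subst_patch_def)
    also have "\<dots> = (\<Union>t\<in>P. (\<lambda>z. \<Lambda> *\<^sub>R z) ` supp t)"
      using D by (intro SUP_cong refl) (simp add: dissects_def)
    also have "\<dots> = (\<lambda>z. \<Lambda> *\<^sub>R z) ` X"
      using P by (auto simp: dissects_def)
    finally show ?thesis .
  qed
  ultimately show ?thesis
    by (simp add: dissects_def is_patch_def)
qed

lemma dissects_inflate:
  assumes P: "dissects (protos \<sigma>) X P"
  shows "dissects (protos \<sigma>) ((\<lambda>z. \<Lambda> ^ k *\<^sub>R z) ` X) (inflate k P)"
proof (induction k)
  case (Suc k)
  then show ?case
    using dissects_subst_patch[OF Suc] by (simp add: image_image)
qed (use P in simp)

lemma dissects_single: "copy t \<Longrightarrow> is_tile t \<Longrightarrow> dissects (protos \<sigma>) (supp t) {t}"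
  by (auto simp: dissects_def is_patch_def disjoint_interiors_def copy_def)

lemma is_tile_proto: "p \<in> protos \<sigma> \<Longrightarrow> is_tile p"
  using is_subst by (simp add: is_substitution_def)

lemma is_tile_copy: "copy t \<Longrightarrow> is_tile t"
  by (erule copyE) (simp add: is_tile_move is_tile_proto)

lemma dissects_supertile:
  "p \<in> protos \<sigma> \<Longrightarrow> dissects (protos \<sigma>) ((\<lambda>z. \<Lambda> ^ k *\<^sub>R z) ` supp p) (supertile \<sigma> k p)"
  unfolding supertile_def
  by (intro dissects_inflate dissects_single copy_proto is_tile_proto)

lemma inflate_eq_Union: "inflate k P = (\<Union>t\<in>P. inflate k {t})"
proof (induction k)
  case (Suc k)
  have "inflate (Suc k) P = subst_patch \<sigma> (\<Union>t\<in>P. inflate k {t})"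
    using Suc by simp
  also have "\<dots> = (\<Union>t\<in>P. subst_patch \<sigma> (inflate k {t}))"
    unfolding subst_patch_def by blast
  finally show ?case
    by simp
qed simp

lemma inflate_mono: "P \<subseteq> R \<Longrightarrow> inflate k P \<subseteq> inflate k R"
  using inflate_eq_Union[of k P] inflate_eq_Union[of k R] by blast

lemma inflate_add: "inflate (k + m) P = inflate k (inflate m P)"
  by (simp add: funpow_add)

lemma copy_inflate:
  assumes "\<forall>t\<in>P. copy t" "s \<in> inflate k P"
  shows "copy s"
proof -
  obtain t where t: "t \<in> P" "s \<in> inflate k {t}"
    using assms(2) inflate_eq_Union[of k P] by blast
  have "dissects (protos \<sigma>) ((\<lambda>z. \<Lambda> ^ k *\<^sub>R z) ` supp t) (inflate k {t})"
    using assms t by (intro dissects_inflate dissects_single is_tile_copy) auto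
  then show ?thesis
    using t by (auto simp: dissects_def copy_def)
qed

lemma subst_patch_move:
  assumes "\<forall>t\<in>P. copy t" "orthogonal_transformation A"
  shows "subst_patch \<sigma> (move (isom A b) ` P) = move (isom A (\<Lambda> *\<^sub>R b)) ` subst_patch \<sigma> P"
  using assms by (auto simp: subst_patch_def subst_tile_move image_UN)

lemma inflate_move:
  assumes "\<forall>t\<in>P. copy t" "orthogonal_transformation A"
  shows "inflate k (move (isom A b) ` P) = move (isom A (\<Lambda> ^ k *\<^sub>R b)) ` inflate k P"
proof (induction k)
  case (Suc k)
  have "inflate (Suc k) (move (isom A b) ` P) = subst_patch \<sigma> (move (isom A (\<Lambda> ^ k *\<^sub>R b)) ` inflate k P)"
    using Suc by simp
  also have "\<dots> = move (isom A (\<Lambda> ^ Suc k *\<^sub>R b)) ` inflate (Suc k) P"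
    using subst_patch_move[of "inflate k P" A "\<Lambda> ^ k *\<^sub>R b"] assms copy_inflate by simp
  finally show ?case .
qed simp

lemma copy_supertile: "p \<in> protos \<sigma> \<Longrightarrow> t \<in> supertile \<sigma> k p \<Longrightarrow> copy t"
  unfolding supertile_def using copy_inflate[of "{p}"] copy_proto by blast

lemma supertile_1: "p \<in> protos \<sigma> \<Longrightarrow> supertile \<sigma> 1 p = dissect \<sigma> p"
  by (simp add: supertile_def subst_patch_def subst_tile_proto)

text \<open>Only the linear part is recorded, since orientation and chirality are all that matters;
  occurrences then compose like orthogonal maps.\<close>

definition occurs :: "nat \<Rightarrow> tile \<Rightarrow> (complex \<Rightarrow> complex) \<Rightarrow> tile \<Rightarrow> bool" where
  "occurs k q A p \<longleftrightarrow> (\<exists>b. move (isom A b) p \<in> supertile \<sigma> k q)"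

text \<open>Substituting \<open>l\<close> more times turns a copy of \<open>p\<close> into a
  supertile of order \<open>l\<close> with the same linear part.\<close>

lemma occurs_supertile:
  assumes "occurs k q A p" "p \<in> protos \<sigma>" "orthogonal_transformation A"
  obtains b where "move (isom A b) ` supertile \<sigma> l p \<subseteq> supertile \<sigma> (l + k) q"
proof -
  obtain b where b: "move (isom A b) p \<in> supertile \<sigma> k q"
    using assms(1) by (auto simp: occurs_def)
  have "inflate l {move (isom A b) p} \<subseteq> inflate l (supertile \<sigma> k q)"
    using b by (intro inflate_mono) auto
  moreover have "inflate l {move (isom A b) p} = move (isom A (\<Lambda> ^ l *\<^sub>R b)) ` supertile \<sigma> l p"
    using inflate_move[of "{p}" A l b] assms copy_proto by (simp add: supertile_def)
  ultimately show ?thesis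
    using that by (simp add: supertile_def inflate_add)
qed

lemma occurs_trans:
  assumes "occurs k q A p" "occurs l p B r" "p \<in> protos \<sigma>" "orthogonal_transformation A"
  shows "occurs (l + k) q (\<lambda>z. A (B z)) r"
proof -
  obtain b where b: "move (isom A b) ` supertile \<sigma> l p \<subseteq> supertile \<sigma> (l + k) q"
    using occurs_supertile assms by metis
  obtain c where "move (isom B c) r \<in> supertile \<sigma> l p"
    using assms by (auto simp: occurs_def)
  then have "move (isom A b) (move (isom B c) r) \<in> supertile \<sigma> (l + k) q"
    using b by auto
  then show ?thesis
    using assms by (auto simp: occurs_def move_move isom_isom)
qed

lemma occurs_1: "q \<in> protos \<sigma> \<Longrightarrow> occurs 1 q A p \<longleftrightarrow> (\<exists>b. move (isom A b) p \<in> dissect \<sigma> q)"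
  by (simp add: occurs_def supertile_1 del: One_nat_def)

end

section \<open>Approximating all angles by boundedly many powers of an irrational rotation\<close>

lemma dense_powers:
  assumes u: "cmod u = 1" "\<And>n. n > 0 \<Longrightarrow> u ^ n \<noteq> 1" and "\<epsilon> > 0"
  shows "\<exists>K. \<forall>\<eta>. \<exists>j\<le>K. \<exists>\<delta>. \<bar>\<delta>\<bar> < \<epsilon> \<and> u ^ j = cis \<delta> * cis \<eta>"
proof -
  obtain t where t: "u = cis (2 * pi * t)"
  proof
    show "u = cis (2 * pi * (Arg u / (2 * pi)))"
      using cis_Arg[of u] u(1) by (cases "u = 0") (simp_all add: sgn_eq)
  qed
  have frac: "cis (2 * pi * frac x) = cis (2 * pi * x)" for x
  proof -
    have "2 * pi * frac x = 2 * pi * x + 2 * pi * of_int (- \<lfloor>x\<rfloor>)"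
      by (simp add: frac_def algebra_simps)
    then show ?thesis
      by (simp only: cis_mult[symmetric] cis_multiple_2pi Ints_of_int mult_1_right)
  qed
  have "t \<notin> \<rat>"
  proof
    assume "t \<in> \<rat>"
    then obtain a b where ab: "b > 0" "t = of_int a / of_int b"
      using Rats_cases' by metis
    have "u ^ nat b = cis (real (nat b) * (2 * pi * t))"
      unfolding t by (rule Complex.DeMoivre)
    also have "real (nat b) * (2 * pi * t) = 2 * pi * of_int a"
      using ab by simp
    finally have "u ^ nat b = 1"
      by (simp only: cis_multiple_2pi Ints_of_int)
    then show False
      using u(2)[of "nat b"] ab by simp
  qed
  \<comment> \<open>On the circle of length 1, a target is within 1 / \<open>M\<close> of a grid
    point i / \<open>M\<close>, and Kronecker's theorem approximates the grid point up to 1 /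
    \<open>M\<close>. The total error, in radians, is below 4 \<pi> / \<open>M\<close> <
    \<epsilon>.\<close>
  obtain M :: nat where M: "real M > 4 * pi / \<epsilon>"
    using reals_Archimedean2 by blast
  then have M0: "M > 0"
    using \<open>\<epsilon> > 0\<close> by (cases M) (auto simp: field_simps)
  have "\<exists>k. \<bar>frac (real k * t) - real i / real M\<bar> < 1 / real M" if "i \<le> M" for i
    by (rule Kronecker_approx_1_explicit[OF \<open>t \<notin> \<rat>\<close>, of "real i / real M" "1 / real M"])
      (use that M0 in auto)
  then obtain k where k: "\<And>i. i \<le> M \<Longrightarrow> \<bar>frac (real (k i) * t) - real i / real M\<bar> < 1 / real M"
    by metis
  \<comment> \<open>There are finitely many grid points, so one bound on the exponent serves all
    angles at once.\<close>
  show ?thesis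
  proof (rule exI[of _ "Max (k ` {..M})"], rule allI)
    fix \<eta> :: real
    define y where "y = frac (\<eta> / (2 * pi))"
    have y: "0 \<le> y" "y < 1"
      by (auto simp: y_def frac_lt_1)
    define i where "i = nat \<lfloor>real M * y\<rfloor>"
    have i: "real i \<le> real M * y" "real M * y < real i + 1"
      using y unfolding i_def by (auto simp: of_nat_nat)
    then have "real i < real M + 1"
      using y M0 by (smt (verit) mult_left_le of_nat_0_le_iff)
    then have iM: "i \<le> M"
      by linarith
    have "y - real i / real M = (real M * y - real i) / real M"
      using M0 by (simp add: field_simps)
    then have "\<bar>y - real i / real M\<bar> = \<bar>real M * y - real i\<bar> / real M"
      by simp
    also have "\<dots> \<le> 1 / real M"
      using i by (intro divide_right_mono) auto
    finally have "\<bar>y - real i / real M\<bar> \<le> 1 / real M" .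
    then have "\<bar>frac (real (k i) * t) - y\<bar> < 2 / real M"
      using k[OF iM] by (simp add: abs_if split: if_splits)
    then have "2 * pi * \<bar>frac (real (k i) * t) - y\<bar> < 2 * pi * (2 / real M)"
      by (rule mult_strict_left_mono) simp
    also have "2 * pi * (2 / real M) < \<epsilon>"
      using M M0 \<open>\<epsilon> > 0\<close> by (simp add: field_simps)
    finally have small: "\<bar>2 * pi * (frac (real (k i) * t) - y)\<bar> < \<epsilon>"
      by (simp add: abs_mult)
    have "u ^ k i = cis (2 * pi * frac (real (k i) * t))"
      unfolding frac unfolding t Complex.DeMoivre by (simp only: mult_ac)
    also have "\<dots> = cis (2 * pi * (frac (real (k i) * t) - y)) * cis (2 * pi * y)"
      by (simp add: cis_mult algebra_simps)
    also have "cis (2 * pi * y) = cis \<eta>"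
      by (simp add: y_def frac)
    finally have "u ^ k i = cis (2 * pi * (frac (real (k i) * t) - y)) * cis \<eta>" .
    moreover have "k i \<le> Max (k ` {..M})"
      using iM by simp
    ultimately show "\<exists>j\<le>Max (k ` {..M}). \<exists>\<delta>. \<bar>\<delta>\<bar> < \<epsilon> \<and> u ^ j = cis \<delta> * cis \<eta>"
      using small by blast
  qed
qed

section \<open>Tiles identified by coverings, and local finiteness\<close>

lemma tiles_meet_open:
  assumes "open U" "x \<in> U" "x \<in> supp f" "is_tile f"
  shows "interior (supp f) \<inter> U \<noteq> {}"
  using assms open_Int_closure_eq_empty[of U "interior (supp f)"] by (auto simp: is_tile_def)

lemma interior_tile: "is_tile t \<Longrightarrow> interior (supp t) \<noteq> {}"
  by (auto simp: is_tile_def)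

text \<open>Some \<open>f\<close> of the cover contains a point of the open set interior
  (\<open>supp t\<close>) \<inter> \<open>U\<close>, hence has interior points there, so that
  disjointness within \<open>W\<close> leaves only f = t. This is how a tile known to lie in one
  collection is recognised as a member of another.\<close>

lemma tile_in_cover:
  assumes W: "disjoint_interiors W" "t \<in> W" "F \<subseteq> W" "\<And>f. f \<in> F \<Longrightarrow> is_tile f"
    and U: "open U" "interior (supp t) \<inter> U \<noteq> {}" "interior (supp t) \<inter> U \<subseteq> (\<Union>f\<in>F. supp f)"
  shows "t \<in> F"
proof -
  obtain x where x: "x \<in> interior (supp t) \<inter> U"
    using U by auto
  then obtain f where f: "f \<in> F" "x \<in> supp f"
    using U by auto
  have "interior (supp f) \<inter> (interior (supp t) \<inter> U) \<noteq> {}"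
    using x f U W by (intro tiles_meet_open) auto
  then have "f = t"
    using W f unfolding disjoint_interiors_def by blast
  then show ?thesis
    using f by simp
qed

text \<open>One inclusion is enough: the tiles of \<open>S\<close> that meet the ball already cover
  it, so \<open>T\<close> has no room for further tiles there.\<close>

lemma agree_on_ballI:
  assumes S: "is_tiling S" and T: "is_tiling T"
    and sub: "{t\<in>S. supp t \<inter> ball 0 r \<noteq> {}} \<subseteq> T"
  shows "agree_on_ball r S T"
  unfolding agree_on_ball_def
proof (intro equalityI subsetI)
  fix t assume "t \<in> {t\<in>S. supp t \<inter> ball 0 r \<noteq> {}}"
  then show "t \<in> {t\<in>T. supp t \<inter> ball 0 r \<noteq> {}}"
    using sub by auto
next
  fix t assume t: "t \<in> {t\<in>T. supp t \<inter> ball 0 r \<noteq> {}}"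
  have "t \<in> {t\<in>S. supp t \<inter> ball 0 r \<noteq> {}}"
  proof (rule tile_in_cover)
    show "disjoint_interiors T" "t \<in> T"
      using T t by (auto simp: is_tiling_def)
    show "interior (supp t) \<inter> ball 0 r \<noteq> {}"
      using t T tiles_meet_open[of "ball 0 r" _ t] by (auto simp: is_tiling_def)
    show "interior (supp t) \<inter> ball 0 r \<subseteq> (\<Union>f\<in>{t\<in>S. supp t \<inter> ball 0 r \<noteq> {}}. supp f)"
    proof
      fix x assume "x \<in> interior (supp t) \<inter> ball 0 r"
      moreover obtain s where "s \<in> S" "x \<in> supp s"
        using S unfolding is_tiling_def by blast
      ultimately show "x \<in> (\<Union>f\<in>{t\<in>S. supp t \<inter> ball 0 r \<noteq> {}}. supp f)"
        by blast
    qed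
    show "is_tile f" if "f \<in> {t\<in>S. supp t \<inter> ball 0 r \<noteq> {}}" for f
      using that S by (auto simp: is_tiling_def)
  qed (use sub in auto)
  then show "t \<in> {t\<in>S. supp t \<inter> ball 0 r \<noteq> {}}" .
qed

lemma finite_separated:
  fixes C :: "complex set"
  assumes "bounded C" "\<rho> > 0" "\<And>x y. x \<in> C \<Longrightarrow> y \<in> C \<Longrightarrow> x \<noteq> y \<Longrightarrow> dist x y \<ge> \<rho>"
  shows "finite C"
proof (rule ccontr)
  assume "infinite C"
  then obtain l where "l islimpt C"
    using bounded_infinite_imp_islimpt[of C C] assms(1) by auto
  then have inf: "infinite (C \<inter> ball l (\<rho> / 2))"
    using assms(2) by (simp add: islimpt_eq_infinite_ball)
  then obtain x where x: "x \<in> C \<inter> ball l (\<rho> / 2)"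
    using infinite_imp_nonempty by blast
  obtain y where y: "y \<in> C \<inter> ball l (\<rho> / 2)" "y \<noteq> x"
    using infinite_imp_nonempty[OF infinite_remove[OF inf, of x]] by blast
  have "dist x y < \<rho>"
    using x y dist_triangle_half_r[of l x \<rho> y] by auto
  then show False
    using assms(3)[of x y] x y by auto
qed

context substitution_rule
begin

lemma diameter_bound: "\<exists>D>0. \<forall>t. copy t \<longrightarrow> (\<forall>x\<in>supp t. \<forall>y\<in>supp t. dist x y \<le> D)"
proof -
  have "bounded (\<Union>p\<in>protos \<sigma>. supp p)"
    using is_subst is_tile_proto
    by (intro bounded_Union) (auto simp: is_substitution_def is_tile_def compact_imp_bounded)
  then obtain D where D: "D > 0" "\<And>x. x \<in> (\<Union>p\<in>protos \<sigma>. supp p) \<Longrightarrow> norm x \<le> D"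
    by (meson bounded_pos)
  have "dist x y \<le> 2 * D" if t: "copy t" "x \<in> supp t" "y \<in> supp t" for t x y
  proof -
    obtain p A b where p: "p \<in> protos \<sigma>" "orthogonal_transformation A" "t = move (isom A b) p"
      using t(1) by (rule copyE)
    then obtain x' y' where "x' \<in> supp p" "y' \<in> supp p" "x = isom A b x'" "y = isom A b y'"
      using t by auto
    then show ?thesis
    proof -
      have "norm x' \<le> D" "norm y' \<le> D"
        using D(2) p(1) \<open>x' \<in> supp p\<close> \<open>y' \<in> supp p\<close> by blast+
      then have "dist x' y' \<le> 2 * D"
        using norm_triangle_ineq4[of x' y'] by (simp add: dist_norm)
      then show ?thesis
        using \<open>x = isom A b x'\<close> \<open>y = isom A b y'\<close> by (simp add: dist_isom p(2))
    qed
  qed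
  moreover have "2 * D > 0"
    using D(1) by simp
  ultimately show ?thesis
    by blast
qed

lemma inner_ball: "\<exists>\<rho>>0. \<forall>t. copy t \<longrightarrow> (\<exists>c. ball c \<rho> \<subseteq> interior (supp t))"
proof -
  have "\<exists>r>0. \<exists>c. ball c r \<subseteq> interior (supp p)" if "p \<in> protos \<sigma>" for p
    using interior_tile[OF is_tile_proto[OF that]] open_contains_ball[of "interior (supp p)"] by auto
  then obtain f where f: "\<And>p. p \<in> protos \<sigma> \<Longrightarrow> f p > 0 \<and> (\<exists>c. ball c (f p) \<subseteq> interior (supp p))"
    by metis
  define \<rho> where "\<rho> = Min (f ` protos \<sigma>)"
  have fin: "finite (protos \<sigma>)" "protos \<sigma> \<noteq> {}"
    using is_subst by (auto simp: is_substitution_def)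
  have "\<exists>c. ball c \<rho> \<subseteq> interior (supp t)" if "copy t" for t
  proof -
    obtain p A b where p: "p \<in> protos \<sigma>" "orthogonal_transformation A" "t = move (isom A b) p"
      using \<open>copy t\<close> by (rule copyE)
    obtain c where c: "ball c (f p) \<subseteq> interior (supp p)"
      using f p by blast
    have "\<rho> \<le> f p"
      using p fin by (simp add: \<rho>_def)
    then have "ball c \<rho> \<subseteq> interior (supp p)"
      using c subset_ball by blast
    moreover have "ball (isom A b c) \<rho> \<subseteq> isom A b ` ball c \<rho>"
    proof
      fix y assume y: "y \<in> ball (isom A b c) \<rho>"
      obtain x where x: "y = isom A b x"
        using bij_is_surj[OF bij_isom[OF p(2)]] by (metis surjD)
      then show "y \<in> isom A b ` ball c \<rho>"
        using y dist_isom[OF p(2)] by auto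
    qed
    ultimately have "ball (isom A b c) \<rho> \<subseteq> interior (supp t)"
      using p interior_isom[OF p(2), of b "supp p"] by (simp add: subset_trans image_mono)
    then show ?thesis
      by blast
  qed
  moreover have "\<rho> > 0"
    using f fin by (simp add: \<rho>_def)
  ultimately show ?thesis
    by blast
qed

text \<open>A packing argument: inner balls of one common radius are disjoint for different tiles,
  so their centres are separated, and a diameter bound keeps the centres in a bounded set.\<close>

lemma finite_meeting_ball:
  assumes T: "disjoint_interiors T" "\<And>t. t \<in> T \<Longrightarrow> copy t"
  shows "finite {t\<in>T. supp t \<inter> ball a r \<noteq> {}}" (is "finite ?F")
proof -
  obtain D where D: "D > 0" "\<And>t x y. copy t \<Longrightarrow> x \<in> supp t \<Longrightarrow> y \<in> supp t \<Longrightarrow> dist x y \<le> D"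
    using diameter_bound by blast
  obtain \<rho> where \<rho>: "\<rho> > 0" "\<And>t. copy t \<Longrightarrow> \<exists>c. ball c \<rho> \<subseteq> interior (supp t)"
    using inner_ball by blast
  then obtain c where c: "\<And>t. copy t \<Longrightarrow> ball (c t) \<rho> \<subseteq> interior (supp t)"
    by metis
  have cin: "c t \<in> interior (supp t)" if "copy t" for t
    using c[OF that] \<rho>(1) by auto
  have inj: "c s \<noteq> c t \<and> dist (c s) (c t) \<ge> \<rho>" if "s \<in> T" "t \<in> T" "s \<noteq> t" for s t
  proof -
    have "interior (supp s) \<inter> interior (supp t) = {}"
      using T(1) that unfolding disjoint_interiors_def by blast
    then have "c t \<notin> ball (c s) \<rho>"
      using c[of s] cin[of t] T that by blast
    then show ?thesis
      using \<rho>(1) by auto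
  qed
  have "finite (c ` ?F)"
  proof (rule finite_separated[OF _ \<rho>(1)])
    have "dist a (c t) \<le> r + D" if "t \<in> ?F" for t
    proof -
      obtain x where x: "x \<in> supp t" "dist a x < r"
        using \<open>t \<in> ?F\<close> by auto
      have "dist x (c t) \<le> D"
        using D(2)[of t x "c t"] x cin[of t] T(2) that interior_subset by blast
      then show ?thesis
        using x dist_triangle[of a "c t" x] by linarith
    qed
    then show "bounded (c ` ?F)"
      unfolding bounded_def by blast
    show "dist x y \<ge> \<rho>" if "x \<in> c ` ?F" "y \<in> c ` ?F" "x \<noteq> y" for x y
      using that inj by blast
  qed
  moreover have "inj_on c ?F"
    using inj unfolding inj_on_def by blast
  ultimately show ?thesis
    by (rule finite_imageD)
qed

section \<open>Supertiles inside generated tilings\<close>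

lemma generated_copy:
  assumes "generated_by \<sigma> T" "t \<in> T"
  shows "copy t"
proof -
  have "finite {t} \<and> {t} \<subseteq> T"
    using assms by auto
  then obtain k p A b where "p \<in> protos \<sigma>" "orthogonal_transformation A"
    "{t} \<subseteq> move (isom A b) ` supertile \<sigma> k p"
    using assms(1) unfolding generated_by_def by meson
  then show ?thesis
    using copy_supertile copy_move by auto
qed

text \<open>By definition patches of \<open>T\<close> lie in supertiles; here conversely a supertile
  of the given order is found in \<open>T\<close>. The patch around a large ball lies in some
  supertile of order \<open>k\<close>, which is too small unless \<open>k\<close> >
  \<open>m\<close>. Regarded as \<open>k - m\<close> substitutions followed by \<open>m\<close>, it
  has an \<open>m\<close>-th order supertile around the origin, which stays inside the ball and
  therefore consists of tiles of \<open>T\<close>.\<close>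

lemma generated_supertile:
  assumes T: "generated_by \<sigma> T"
  obtains q B b where "q \<in> protos \<sigma>" "orthogonal_transformation B"
    "move (isom B b) ` supertile \<sigma> m q \<subseteq> T"
proof -
  obtain D where D: "D > 0" "\<And>t x y. copy t \<Longrightarrow> x \<in> supp t \<Longrightarrow> y \<in> supp t \<Longrightarrow> dist x y \<le> D"
    using diameter_bound by blast
  \<comment> \<open>Supertiles of order \<open>m\<close> have diameter at most
    \<Lambda>^\<open>m\<close> * \<open>D\<close>, so one that contains the origin lies in this
    ball.\<close>
  define R where "R = \<Lambda> ^ m * D + 1"
  have R: "R > 0"
    using D factor_gt_1 by (simp add: R_def add_pos_pos)
  have diam: "dist x y \<le> \<Lambda> ^ k * D"
    if t: "copy t" "orthogonal_transformation A" "x \<in> isom A b ` (\<lambda>z. \<Lambda> ^ k *\<^sub>R z) ` supp t"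
      "y \<in> isom A b ` (\<lambda>z. \<Lambda> ^ k *\<^sub>R z) ` supp t" for t x y k A b
  proof -
    obtain x' y' where xy: "x' \<in> supp t" "y' \<in> supp t"
      "x = isom A b (\<Lambda> ^ k *\<^sub>R x')" "y = isom A b (\<Lambda> ^ k *\<^sub>R y')"
      using t by auto
    have "dist x y = dist (\<Lambda> ^ k *\<^sub>R x') (\<Lambda> ^ k *\<^sub>R y')"
      unfolding xy by (rule dist_isom[OF t(2)])
    also have "\<dots> = \<Lambda> ^ k * dist x' y'"
      using factor_power_pos[of k] unfolding dist_norm scaleR_diff_right[symmetric] by simp
    finally have "dist x y = \<Lambda> ^ k * dist x' y'" .
    then show ?thesis
      using D(2)[OF t(1) xy(1,2)] factor_power_pos[of k] by simp
  qed
  have tiling: "is_tiling T"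
    using T by (simp add: generated_by_def)
  define P where "P = {t\<in>T. supp t \<inter> ball 0 R \<noteq> {}}"
  have "finite P"
    unfolding P_def using tiling generated_copy[OF T] by (intro finite_meeting_ball) (auto simp: is_tiling_def)
  then have "finite P \<and> P \<subseteq> T"
    by (auto simp: P_def)
  then obtain k p A b where p: "p \<in> protos \<sigma>" "orthogonal_transformation A"
    and sub: "P \<subseteq> move (isom A b) ` supertile \<sigma> k p"
    using T unfolding generated_by_def by meson
  let ?W = "move (isom A b) ` supertile \<sigma> k p"
  have W: "dissects (protos \<sigma>) (isom A b ` (\<lambda>z. \<Lambda> ^ k *\<^sub>R z) ` supp p) ?W"
    by (intro dissects_move dissects_supertile p)
  have cover: "ball 0 R \<subseteq> (\<Union>t\<in>P. supp t)"
  proof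
    fix x :: complex assume "x \<in> ball 0 R"
    moreover obtain s where "s \<in> T" "x \<in> supp s"
      using tiling unfolding is_tiling_def by blast
    ultimately show "x \<in> (\<Union>t\<in>P. supp t)"
      unfolding P_def by blast
  qed
  then have ball: "ball 0 R \<subseteq> isom A b ` (\<lambda>z. \<Lambda> ^ k *\<^sub>R z) ` supp p"
  proof -
    have "(\<Union>t\<in>P. supp t) \<subseteq> (\<Union>t\<in>?W. supp t)"
      using sub by (rule UN_mono) simp
    also have "\<dots> = isom A b ` (\<lambda>z. \<Lambda> ^ k *\<^sub>R z) ` supp p"
      using W by (simp only: dissects_def)
    finally show ?thesis
      using cover by simp
  qed
  \<comment> \<open>Otherwise the supertile would have diameter at most \<open>R - 1\<close>, but
    the ball contains two points at distance R - 1/2.\<close>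
  have "k > m"
  proof (rule ccontr)
    assume "\<not> k > m"
    then have "\<Lambda> ^ k * D \<le> \<Lambda> ^ m * D"
      using factor_gt_1 D(1) by (intro mult_right_mono power_increasing) auto
    moreover have "dist 0 (complex_of_real (R - 1/2)) \<le> \<Lambda> ^ k * D"
    proof (rule diam[OF copy_proto[OF p(1)] p(2)])
      show "0 \<in> isom A b ` (\<lambda>z. \<Lambda> ^ k *\<^sub>R z) ` supp p"
        using ball R by auto
      have "0 \<le> \<Lambda> ^ m * D"
        using D factor_power_pos[of m] by simp
      then have "complex_of_real (R - 1/2) \<in> ball 0 R"
        by (simp add: R_def del: of_real_diff of_real_add of_real_mult)
      then show "complex_of_real (R - 1/2) \<in> isom A b ` (\<lambda>z. \<Lambda> ^ k *\<^sub>R z) ` supp p"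
        using ball by blast
    qed
    ultimately have "\<bar>R - 1/2\<bar> \<le> \<Lambda> ^ m * D"
      by (simp add: dist_norm del: of_real_diff)
    then show False
      by (simp add: R_def)
  qed
  then obtain n where k: "k = m + n"
    using less_imp_add_positive by blast
  have "0 \<in> isom A b ` (\<lambda>z. \<Lambda> ^ k *\<^sub>R z) ` supp p"
    using ball R by auto
  \<comment> \<open>The large supertile is the union of the \<open>m\<close>-fold inflations of the
    tiles \<open>s\<close> of the \<open>n\<close>-th order one; the \<open>s\<close> whose
    inflation covers the origin is selected.\<close>
  also have "(\<lambda>z. \<Lambda> ^ k *\<^sub>R z) ` supp p = (\<lambda>z. \<Lambda> ^ m *\<^sub>R z) ` (\<Union>s\<in>supertile \<sigma> n p. supp s)"
    using dissects_supertile[OF p(1), of n]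
    by (simp add: dissects_def k power_add image_image)
  finally obtain s where s: "s \<in> supertile \<sigma> n p" "0 \<in> isom A b ` (\<lambda>z. \<Lambda> ^ m *\<^sub>R z) ` supp s"
    by auto
  then have cs: "copy s"
    using copy_supertile p by blast
  have Ws: "dissects (protos \<sigma>) ((\<lambda>z. \<Lambda> ^ m *\<^sub>R z) ` supp s) (inflate m {s})"
    by (intro dissects_inflate dissects_single cs is_tile_copy)
  have inW: "inflate m {s} \<subseteq> supertile \<sigma> k p"
  proof -
    have "inflate m {s} \<subseteq> inflate m (supertile \<sigma> n p)"
      using s(1) by (intro inflate_mono) simp
    also have "\<dots> = supertile \<sigma> k p"
      by (simp only: supertile_def k inflate_add)
    finally show ?thesis .
  qed
  have sub': "move (isom A b) ` inflate m {s} \<subseteq> T"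
  proof
    fix t assume t: "t \<in> move (isom A b) ` inflate m {s}"
    have tW: "t \<in> ?W"
      using t inW by blast
    obtain t' where t': "t' \<in> inflate m {s}" "t = move (isom A b) t'"
      using t by blast
    have "supp t' \<subseteq> (\<lambda>z. \<Lambda> ^ m *\<^sub>R z) ` supp s"
      using t' Ws unfolding dissects_def by blast
    then have supp: "supp t \<subseteq> isom A b ` (\<lambda>z. \<Lambda> ^ m *\<^sub>R z) ` supp s"
      unfolding t'(2) supp_move by (rule image_mono)
    have "supp t \<subseteq> ball 0 R"
    proof
      fix x assume "x \<in> supp t"
      then have "dist 0 x \<le> \<Lambda> ^ m * D"
        using supp by (intro diam[OF cs p(2) s(2)]) auto
      then show "x \<in> ball 0 R"
        by (simp add: R_def)
    qed
    \<comment> \<open>The whole tile is covered by \<open>P\<close>, and \<open>P\<close> and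
      \<open>t\<close> belong to the same large supertile, so \<open>t\<close> must be one of the
      tiles of \<open>P\<close>.\<close>
    then have cov: "interior (supp t) \<inter> UNIV \<subseteq> (\<Union>f\<in>P. supp f)"
      using cover interior_subset[of "supp t"] by blast
    have "is_patch ?W"
      using W by (simp add: dissects_def)
    then have "disjoint_interiors ?W" "is_tile t"
      using tW unfolding is_patch_def by blast+
    moreover have "is_tile f" if "f \<in> P" for f
      using that tiling unfolding P_def is_tiling_def by blast
    ultimately have "t \<in> P"
      using tile_in_cover[of ?W t P UNIV] sub cov tW interior_tile[of t] by simp
    then show "t \<in> T"
      by (auto simp: P_def)
  qed
  obtain q B c where q: "q \<in> protos \<sigma>" "orthogonal_transformation B" "s = move (isom B c) q"
    using cs by (rule copyE)
  have "inflate m {s} = move (isom B (\<Lambda> ^ m *\<^sub>R c)) ` supertile \<sigma> m q"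
    using inflate_move[of "{q}" B m c] q copy_proto by (simp add: supertile_def)
  then have "move (isom A b) ` inflate m {s}
      = move (isom (\<lambda>z. A (B z)) (A (\<Lambda> ^ m *\<^sub>R c) + b)) ` supertile \<sigma> m q"
    using p by (simp add: image_image move_move isom_isom)
  then show ?thesis
    using that[of q "\<lambda>z. A (B z)" "A (\<Lambda> ^ m *\<^sub>R c) + b"] q p sub' by (simp add: orth_compose)
qed

lemma generated_move:
  assumes T: "generated_by \<sigma> T" and A: "orthogonal_transformation A"
  shows "generated_by \<sigma> (move (isom A b) ` T)"
  unfolding generated_by_def
proof (intro conjI allI impI)
  show "is_tiling (move (isom A b) ` T)"
    using T A by (simp add: generated_by_def is_tiling_move)
  fix P assume "finite P \<and> P \<subseteq> move (isom A b) ` T"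
  then obtain P' where P': "finite P'" "P' \<subseteq> T" "P = move (isom A b) ` P'"
    using finite_subset_image by metis
  then obtain k p B c where p: "p \<in> protos \<sigma>" "orthogonal_transformation B"
    "P' \<subseteq> move (isom B c) ` supertile \<sigma> k p"
    using T unfolding generated_by_def by metis
  then have "P \<subseteq> move (isom A b) ` move (isom B c) ` supertile \<sigma> k p"
    using P' by blast
  also have "\<dots> = move (isom (\<lambda>z. A (B z)) (A c + b)) ` supertile \<sigma> k p"
    using A by (simp add: image_image move_move isom_isom)
  finally show "\<exists>k. \<exists>p\<in>protos \<sigma>. \<exists>A b. orthogonal_transformation A \<and> P \<subseteq> move (isom A b) ` supertile \<sigma> k p"
    using p orth_compose[OF A p(2)] by blast
qed

end

text \<open>Every supertile of high order contains every prototile in almost all orientations, of both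
  chiralities: the prototile \<open>Q\<close> is found everywhere, reproduces itself rotated by an angle that
  is an irrational multiple of \<open>\<pi>\<close>, and also reflected.\<close>

locale hub_subst = substitution_rule +
  fixes Q :: tile and u v :: complex
  assumes Q: "Q \<in> protos \<sigma>"
    and Q_everywhere: "\<And>p. p \<in> protos \<sigma> \<Longrightarrow> \<exists>t\<in>dissect \<sigma> p. tile_equiv Q t"
    and everything_in_Q: "\<And>p. p \<in> protos \<sigma> \<Longrightarrow> \<exists>t\<in>dissect \<sigma> Q. tile_equiv p t"
    and Q_translated: "\<exists>b. move (isom (\<lambda>z. z) b) Q \<in> dissect \<sigma> Q"
    and Q_rotated: "\<exists>b. move (isom (\<lambda>z. u * z) b) Q \<in> dissect \<sigma> Q"
    and Q_reflected: "\<exists>b. move (isom (\<lambda>z. v * cnj z) b) Q \<in> dissect \<sigma> Q"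
    and norm_u: "cmod u = 1" and u_power: "\<And>n. n > 0 \<Longrightarrow> u ^ n \<noteq> 1"
    and norm_v: "cmod v = 1"
begin

lemma occurs_hub: "p \<in> protos \<sigma> \<Longrightarrow> \<exists>A. orthogonal_transformation A \<and> occurs 1 p A Q"
  using Q_everywhere[of p] unfolding occurs_1 tile_equiv_def by metis

lemma occurs_in_hub: "p \<in> protos \<sigma> \<Longrightarrow> \<exists>A. orthogonal_transformation A \<and> occurs 1 Q A p"
  using everything_in_Q[of p] unfolding occurs_1[OF Q] tile_equiv_def by metis

text \<open>Order 2 suffices: one step leads from any prototile to \<open>Q\<close>, another one
  from \<open>Q\<close> to any prototile.\<close>

lemma primitive: "primitive \<sigma>"
proof -
  have "\<exists>t\<in>supertile \<sigma> 2 p. tile_equiv q t" if pq: "p \<in> protos \<sigma>" "q \<in> protos \<sigma>" for p q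
  proof -
    obtain A where A: "orthogonal_transformation A" "occurs 1 p A Q"
      using occurs_hub pq by blast
    obtain B where B: "orthogonal_transformation B" "occurs 1 Q B q"
      using occurs_in_hub pq by blast
    have "occurs (1 + 1) p (\<lambda>z. A (B z)) q"
      using occurs_trans[OF A(2) B(2) Q A(1)] .
    then obtain b where "move (isom (\<lambda>z. A (B z)) b) q \<in> supertile \<sigma> 2 p"
      by (auto simp: occurs_def numeral_2_eq_2)
    moreover have "tile_equiv q (move (isom (\<lambda>z. A (B z)) b) q)"
      unfolding tile_equiv_def using orth_compose[OF A(1) B(1)] by blast
    ultimately show ?thesis
      by blast
  qed
  then show ?thesis
    unfolding primitive_def using is_subst by (intro conjI exI[of _ 2]) auto
qed

lemma occurs_rotated: "j \<le> K \<Longrightarrow> occurs K Q (\<lambda>z. u ^ j * z) Q"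
proof (induction K arbitrary: j)
  case 0
  have "move (isom (\<lambda>z. z) 0) Q \<in> supertile \<sigma> 0 Q"
    by (simp add: supertile_def)
  then have "occurs 0 Q (\<lambda>z. z) Q"
    unfolding occurs_def by blast
  then show ?case
    using 0 by simp
next
  case (Suc K)
  show ?case
  proof (cases j)
    case 0
    have "occurs 1 Q (\<lambda>z. z) Q"
      using Q_translated by (simp add: occurs_1 Q del: One_nat_def)
    from occurs_trans[OF Suc.IH[of 0] this Q] 0 show ?thesis
      by simp
  next
    case (Suc i)
    have "occurs 1 Q (\<lambda>z. u * z) Q"
      using Q_rotated by (simp add: occurs_1 Q del: One_nat_def)
    moreover have "i \<le> K"
      using Suc Suc.prems by simp
    moreover have "orthogonal_transformation (\<lambda>z. u ^ i * z)"
      using norm_u by (intro orth_mult) (simp add: norm_power)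
    ultimately show ?thesis
      using occurs_trans[OF Suc.IH[of i], of 1 "\<lambda>z. u * z" Q] Q Suc by (simp add: mult_ac)
  qed
qed

text \<open>One extra step at the outermost level reflects; the remaining \<open>K\<close> steps
  rotate.\<close>

lemma occurs_reflected: "j \<le> K \<Longrightarrow> occurs (Suc K) Q (\<lambda>z. v * cnj (u ^ j * z)) Q"
proof -
  assume j: "j \<le> K"
  have "occurs 1 Q (\<lambda>z. v * cnj z) Q"
    using Q_reflected by (simp add: occurs_1 Q del: One_nat_def)
  from occurs_trans[OF this occurs_rotated[OF j] Q orth_mult_cnj[OF norm_v]] show ?thesis
    by simp
qed

lemma occurs_densely_in_hub:
  assumes "\<epsilon> > 0"
  shows "\<exists>K. \<forall>A. orthogonal_transformation A \<longrightarrow>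
    (\<exists>\<delta>. \<bar>\<delta>\<bar> < \<epsilon> \<and> occurs K Q (\<lambda>z. cis \<delta> * A z) Q)"
proof -
  obtain K where K: "\<And>\<eta>. \<exists>j\<le>K. \<exists>\<delta>. \<bar>\<delta>\<bar> < \<epsilon> \<and> u ^ j = cis \<delta> * cis \<eta>"
    using dense_powers[OF norm_u u_power assms] by blast
  have "\<exists>\<delta>. \<bar>\<delta>\<bar> < \<epsilon> \<and> occurs (Suc K) Q (\<lambda>z. cis \<delta> * A z) Q"
    if "orthogonal_transformation A" for A
    using that
  proof (cases rule: orth_complex_cases)
    case (1 a)
    obtain j \<delta> where j: "j \<le> K" "\<bar>\<delta>\<bar> < \<epsilon>" "u ^ j = cis \<delta> * cis (Arg a)"
      using K by blast
    have "cis (Arg a) = a"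
      using cis_Arg[of a] 1 by (cases "a = 0") (simp_all add: sgn_eq)
    then have "(\<lambda>z. u ^ j * z) = (\<lambda>z. cis \<delta> * A z)"
      using j 1 by (simp add: mult_ac)
    then show ?thesis
      using occurs_rotated[of j "Suc K"] j by auto
  next
    case (2 a)
    \<comment> \<open>The target solves \<open>v * cnj (u ^ j) = a\<close> up to the error, which
      changes its sign under conjugation.\<close>
    obtain j \<delta> where j: "j \<le> K" "\<bar>\<delta>\<bar> < \<epsilon>" "u ^ j = cis \<delta> * cis (Arg (v * cnj a))"
      using K by blast
    have "cis (Arg (v * cnj a)) = v * cnj a"
      using cis_Arg[of "v * cnj a"] 2 norm_v by (cases "v * cnj a = 0") (auto simp: sgn_eq norm_mult)
    then have u: "u ^ j = cis \<delta> * (v * cnj a)"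
      using j by simp
    have "v * cnj v = 1"
      using norm_v by (simp add: complex_norm_square[symmetric])
    then have "v * cnj (u ^ j * z) = cis (- \<delta>) * (a * cnj z)" for z
      unfolding u by (simp add: cis_cnj mult_ac)
    then have "(\<lambda>z. v * cnj (u ^ j * z)) = (\<lambda>z. cis (- \<delta>) * A z)"
      using 2 by auto
    then have "occurs (Suc K) Q (\<lambda>z. cis (- \<delta>) * A z) Q"
      using occurs_reflected[OF j(1)] by simp
    moreover have "\<bar>- \<delta>\<bar> < \<epsilon>"
      using j by simp
    ultimately show ?thesis
      by blast
  qed
  then show ?thesis
    by blast
qed

text \<open>Going from \<open>q\<close> to \<open>Q\<close> costs a fixed map \<open>B\<close>, and
  going from \<open>Q\<close> to \<open>p\<close> a fixed map \<open>C\<close>. To achieve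
  \<open>A\<close> overall, the middle part has to approximate \<open>B' o A o C'\<close> with the
  inverses of \<open>B\<close> and \<open>C\<close>; moving the error past \<open>B\<close> can only
  change its sign.\<close>

lemma occurs_densely:
  assumes "\<epsilon> > 0"
  shows "\<exists>K. \<forall>q\<in>protos \<sigma>. \<forall>p\<in>protos \<sigma>. \<forall>A. orthogonal_transformation A \<longrightarrow>
    (\<exists>\<delta>. \<bar>\<delta>\<bar> < \<epsilon> \<and> occurs K q (\<lambda>z. cis \<delta> * A z) p)"
proof -
  obtain K where K: "\<And>A. orthogonal_transformation A \<Longrightarrow>
      \<exists>\<delta>. \<bar>\<delta>\<bar> < \<epsilon> \<and> occurs K Q (\<lambda>z. cis \<delta> * A z) Q"
    using occurs_densely_in_hub[OF assms] by blast
  have "\<exists>\<delta>. \<bar>\<delta>\<bar> < \<epsilon> \<and> occurs (1 + (K + 1)) q (\<lambda>z. cis \<delta> * A z) p"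
    if q: "q \<in> protos \<sigma>" and p: "p \<in> protos \<sigma>" and A: "orthogonal_transformation A" for q p A
  proof -
    obtain B where B: "orthogonal_transformation B" "occurs 1 q B Q"
      using occurs_hub q by blast
    obtain C where C: "orthogonal_transformation C" "occurs 1 Q C p"
      using occurs_in_hub p by blast
    obtain B' where B': "orthogonal_transformation B'" "\<And>z. B (B' z) = z"
      using isom_inverse[OF B(1)] by metis
    obtain C' where C': "orthogonal_transformation C'" "\<And>z. C' (C z) = z"
      using isom_inverse[OF C(1)] by metis
    obtain \<delta> where \<delta>: "\<bar>\<delta>\<bar> < \<epsilon>" "occurs K Q (\<lambda>z. cis \<delta> * B' (A (C' z))) Q"
      using K[OF orth_compose[OF B'(1) orth_compose[OF A C'(1)]]] by blast
    let ?D = "\<lambda>z. cis \<delta> * B' (A (C' z))"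
    have D: "orthogonal_transformation ?D"
      using orth_compose[OF orth_mult[of "cis \<delta>"] orth_compose[OF B'(1) orth_compose[OF A C'(1)]]] by simp
    have 1: "occurs (K + 1) q (\<lambda>z. B (?D z)) Q"
      using occurs_trans[OF B(2) \<delta>(2) Q B(1)] .
    have 2: "occurs (1 + (K + 1)) q (\<lambda>z. B (?D (C z))) p"
      using occurs_trans[OF 1 C(2) Q orth_compose[OF B(1) D]] .
    obtain s where s: "s \<in> {1, -1}" "\<And>\<delta> z. B (cis \<delta> * z) = cis (s * \<delta>) * B z"
      using orth_conj_cis[OF B(1)] by blast
    have "(\<lambda>z. B (?D (C z))) = (\<lambda>z. cis (s * \<delta>) * A z)"
      by (simp add: s(2) B' C')
    moreover have "\<bar>s * \<delta>\<bar> < \<epsilon>"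
      using s \<delta> by auto
    ultimately show ?thesis
      using 2 by auto
  qed
  then show ?thesis
    by blast
qed

text \<open>A supertile of order \<open>l + K\<close> in \<open>T\<close> has unknown position and
  chirality \<open>B\<close>, but inside it every orientation is nearly available; asking there for
  the inverse of \<open>B\<close> followed by \<open>A\<close> cancels \<open>B\<close>.\<close>

lemma generated_occurs:
  assumes T: "generated_by \<sigma> T" and "\<epsilon> > 0" and p: "p \<in> protos \<sigma>"
    and A: "orthogonal_transformation A"
  obtains \<delta> c where "\<bar>\<delta>\<bar> < \<epsilon>" "move (isom (\<lambda>z. cis \<delta> * A z) c) ` supertile \<sigma> l p \<subseteq> T"
proof -
  obtain K where K: "\<And>q A. q \<in> protos \<sigma> \<Longrightarrow> orthogonal_transformation A \<Longrightarrow>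
    \<exists>\<delta>. \<bar>\<delta>\<bar> < \<epsilon> \<and> occurs K q (\<lambda>z. cis \<delta> * A z) p"
    using occurs_densely[OF \<open>\<epsilon> > 0\<close>] p by blast
  obtain q B b where q: "q \<in> protos \<sigma>" and B: "orthogonal_transformation B"
    and sub: "move (isom B b) ` supertile \<sigma> (l + K) q \<subseteq> T"
    using generated_supertile[OF T] .
  obtain B' where B': "orthogonal_transformation B'" "\<And>z. B (B' z) = z"
    using isom_inverse[OF B] by metis
  obtain \<delta> where \<delta>: "\<bar>\<delta>\<bar> < \<epsilon>" "occurs K q (\<lambda>z. cis \<delta> * B' (A z)) p"
    using K[OF q orth_compose[OF B'(1) A]] by blast
  let ?D = "\<lambda>z. cis \<delta> * B' (A z)"
  have "orthogonal_transformation ?D"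
    using orth_compose[OF orth_mult[of "cis \<delta>"] orth_compose[OF B'(1) A]] by simp
  then obtain c where c: "move (isom ?D c) ` supertile \<sigma> l p \<subseteq> supertile \<sigma> (l + K) q"
    using occurs_supertile[OF \<delta>(2) p] by blast
  obtain s where s: "s \<in> {1, -1}" "\<And>\<delta> z. B (cis \<delta> * z) = cis (s * \<delta>) * B z"
    using orth_conj_cis[OF B] by blast
  have "move (isom B b) ` move (isom ?D c) ` supertile \<sigma> l p
      = move (isom (\<lambda>z. cis (s * \<delta>) * A z) (B c + b)) ` supertile \<sigma> l p"
    using B by (simp add: image_image move_move isom_isom s(2) B')
  then have "move (isom (\<lambda>z. cis (s * \<delta>) * A z) (B c + b)) ` supertile \<sigma> l p \<subseteq> T"
    using c sub by blast
  moreover have "\<bar>s * \<delta>\<bar> < \<epsilon>"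
    using s \<delta> by auto
  ultimately show ?thesis
    using that by blast
qed

section \<open>All generated tilings have the same hull\<close>

lemma hull_local_patch:
  assumes "S \<in> tiling_hull T" "r > 0"
  obtains \<theta> b where "{t\<in>S. supp t \<inter> ball 0 r \<noteq> {}} \<subseteq> move (isom (\<lambda>z. cis \<theta> * z) b) ` T"
proof -
  \<comment> \<open>The extra 1 in the radius absorbs the shift by \<open>b\<close>, whose length is
    below \<epsilon> \<le> 1.\<close>
  define \<epsilon> where "\<epsilon> = 1 / (r + 1)"
  have \<epsilon>: "\<epsilon> > 0" "\<epsilon> \<le> 1" "1 / \<epsilon> = r + 1"
    using assms(2) by (auto simp: \<epsilon>_def)
  then obtain x where "eps_close \<epsilon> S (move (\<lambda>z. z + x) ` T)"
    using assms(1) by (auto simp: tiling_hull_def)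
  then obtain \<theta> b where b: "norm b < \<epsilon>" and
    or: "agree_on_ball (r + 1) (move (isom (\<lambda>z. cis \<theta> * z) b) ` S) (move (\<lambda>z. z + x) ` T)
       \<or> agree_on_ball (r + 1) S (move (isom (\<lambda>z. cis \<theta> * z) b) ` move (\<lambda>z. z + x) ` T)"
    unfolding eps_close_def using \<epsilon>(3) by metis
  from or show ?thesis
  proof
    \<comment> \<open>In this case it is \<open>S\<close> that has been moved; the inverse motion is
      transferred to \<open>T\<close>.\<close>
    assume ag: "agree_on_ball (r + 1) (move (isom (\<lambda>z. cis \<theta> * z) b) ` S) (move (\<lambda>z. z + x) ` T)"
    have "t \<in> move (isom (\<lambda>z. cis (-\<theta>) * z) (cis (-\<theta>) * (x - b))) ` T"
      if t: "t \<in> S" "supp t \<inter> ball 0 r \<noteq> {}" for t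
    proof -
      let ?t = "move (isom (\<lambda>z. cis \<theta> * z) b) t"
      obtain y where y: "y \<in> supp t" "norm y < r"
        using t by auto
      have "norm (cis \<theta> * y + b) < r + 1"
        using norm_triangle_ineq[of "cis \<theta> * y" b] y b \<epsilon> by (simp add: norm_mult)
      then have "cis \<theta> * y + b \<in> supp ?t \<inter> ball 0 (r + 1)"
        using y by (auto simp: isom_def)
      then have "?t \<in> move (\<lambda>z. z + x) ` T"
        using ag t unfolding agree_on_ball_def by blast
      then obtain t' where t': "t' \<in> T" "?t = move (\<lambda>z. z + x) t'"
        by blast
      have 1: "cis (- \<theta>) * (cis \<theta> * z) = z" for z
        by (simp add: cis_mult flip: mult.assoc)
      have "t = move (isom (\<lambda>z. cis (-\<theta>) * z) (- cis (-\<theta>) * b)) ?t"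
        by (simp add: move_move isom_def distrib_left 1)
      also have "\<dots> = move (isom (\<lambda>z. cis (-\<theta>) * z) (cis (-\<theta>) * (x - b))) t'"
        unfolding t'(2) by (simp add: move_move isom_def algebra_simps)
      finally show ?thesis
        using t' by blast
    qed
    then show ?thesis
      by (intro that[of "-\<theta>" "cis (-\<theta>) * (x - b)"]) blast
  next
    assume ag: "agree_on_ball (r + 1) S (move (isom (\<lambda>z. cis \<theta> * z) b) ` move (\<lambda>z. z + x) ` T)"
    have eq: "move (isom (\<lambda>z. cis \<theta> * z) b) ` move (\<lambda>z. z + x) ` T
        = move (isom (\<lambda>z. cis \<theta> * z) (cis \<theta> * x + b)) ` T"
      by (simp add: image_image move_move isom_def algebra_simps)
    have "t \<in> move (isom (\<lambda>z. cis \<theta> * z) (cis \<theta> * x + b)) ` T"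
      if "t \<in> S" "supp t \<inter> ball 0 r \<noteq> {}" for t
    proof -
      have "supp t \<inter> ball 0 (r + 1) \<noteq> {}"
        using that(2) by auto
      then have "t \<in> {t\<in>S. supp t \<inter> ball 0 (r + 1) \<noteq> {}}"
        using that(1) by blast
      then show ?thesis
        using ag unfolding agree_on_ball_def eq by simp
    qed
    then have "{t\<in>S. supp t \<inter> ball 0 r \<noteq> {}} \<subseteq> move (isom (\<lambda>z. cis \<theta> * z) (cis \<theta> * x + b)) ` T"
      by blast
    then show ?thesis
      by (rule that)
  qed
qed

text \<open>The tiles of \<open>S\<close> near the origin form a moved patch of \<open>T\<close>,
  which lies in a supertile. That supertile occurs in \<open>T'\<close> with an orientation error
  below \<epsilon>, and exactly this error may be undone by the small rotation that
  \<open>eps_close\<close> allows.\<close>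

lemma hull_subset:
  assumes T: "generated_by \<sigma> T" and T': "generated_by \<sigma> T'"
  shows "tiling_hull T \<subseteq> tiling_hull T'"
proof
  fix S assume S: "S \<in> tiling_hull T"
  have tiling: "is_tiling S"
    using S by (simp add: tiling_hull_def)
  have tilings: "is_tiling T" "is_tiling T'"
    using T T' by (simp_all add: generated_by_def)
  have "\<exists>x. eps_close \<epsilon> S (move (\<lambda>z. z + x) ` T')" if "\<epsilon> > 0" for \<epsilon>
  proof -
    define F where "F = {t\<in>S. supp t \<inter> ball 0 (1 / \<epsilon>) \<noteq> {}}"
    obtain \<theta> b where F: "F \<subseteq> move (isom (\<lambda>z. cis \<theta> * z) b) ` T"
      unfolding F_def using hull_local_patch[OF S, of "1 / \<epsilon>"] \<open>\<epsilon> > 0\<close> by auto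
    let ?R = "isom (\<lambda>z. cis \<theta> * z) b"
    have R: "orthogonal_transformation (\<lambda>z. cis \<theta> * z)"
      by (rule orth_mult) simp
    have "finite {t\<in>move ?R ` T. supp t \<inter> ball 0 (1 / \<epsilon>) \<noteq> {}}"
      using tilings disjoint_interiors_move[OF R] copy_move[OF _ R] generated_copy[OF T]
      by (intro finite_meeting_ball) (auto simp: is_tiling_def)
    moreover have "F \<subseteq> {t\<in>move ?R ` T. supp t \<inter> ball 0 (1 / \<epsilon>) \<noteq> {}}"
      using F by (auto simp: F_def)
    ultimately have "finite F"
      by (rule rev_finite_subset)
    then obtain P where P: "P \<subseteq> T" "finite P" "F = move ?R ` P"
      using finite_subset_image[OF _ F] by blast
    then obtain k p A c where p: "p \<in> protos \<sigma>" "orthogonal_transformation A"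
      "P \<subseteq> move (isom A c) ` supertile \<sigma> k p"
      using T unfolding generated_by_def by metis
    have "orthogonal_transformation (\<lambda>z. cis \<theta> * A z)"
      using orth_compose[OF R p(2)] .
    then obtain \<delta> c' where \<delta>: "\<bar>\<delta>\<bar> < \<epsilon>"
      and sub: "move (isom (\<lambda>z. cis \<delta> * (cis \<theta> * A z)) c') ` supertile \<sigma> k p \<subseteq> T'"
      using generated_occurs[OF T' \<open>\<epsilon> > 0\<close> p(1)] by metis
    \<comment> \<open>The translation that makes the copy in \<open>T'\<close>, once it is turned
      back by \<delta> about the origin, coincide with the wanted position.\<close>
    define x where "x = cis \<delta> * (cis \<theta> * c + b) - c'"
    let ?T = "move (isom (\<lambda>z. cis (-\<delta>) * z) 0) ` move (\<lambda>z. z + x) ` T'"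
    have "F \<subseteq> ?T"
    proof
      fix t assume "t \<in> F"
      then obtain s where s: "s \<in> supertile \<sigma> k p" "t = move ?R (move (isom A c) s)"
        using P p by blast
      let ?s = "move (isom (\<lambda>z. cis \<delta> * (cis \<theta> * A z)) c') s"
      have 1: "cis (- \<delta>) * (cis \<delta> * z) = z" for z
        by (simp add: cis_mult flip: mult.assoc)
      have "cis (- \<delta>) * (cis \<delta> * (cis \<theta> * A z) + c' + x) = cis \<theta> * (A z + c) + b" for z
      proof -
        have "cis \<delta> * (cis \<theta> * A z) + c' + x = cis \<delta> * (cis \<theta> * (A z + c) + b)"
          by (simp add: x_def algebra_simps)
        then show ?thesis
          by (simp only: 1)
      qed
      then have "t = move (isom (\<lambda>z. cis (-\<delta>) * z) 0) (move (\<lambda>z. z + x) ?s)"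
        by (simp add: s move_move isom_def)
      then show "t \<in> ?T"
        using s sub by blast
    qed
    moreover have "is_tiling ?T"
      using is_tiling_move[OF orth_mult[of "cis (-\<delta>)"]
          is_tiling_move[OF orthogonal_transformation_id tilings(2), of x], of 0]
      by (simp add: isom_def)
    ultimately have "agree_on_ball (1 / \<epsilon>) S ?T"
      using tiling unfolding F_def by (intro agree_on_ballI) auto
    then have "\<bar>-\<delta>\<bar> < \<epsilon> \<and> norm (0::complex) < \<epsilon> \<and> agree_on_ball (1 / \<epsilon>) S ?T"
      using \<delta> \<open>\<epsilon> > 0\<close> by simp
    then have "eps_close \<epsilon> S (move (\<lambda>z. z + x) ` T')"
      unfolding eps_close_def by blast
    then show ?thesis
      by blast
  qed
  then show "S \<in> tiling_hull T'"
    using tiling by (simp add: tiling_hull_def)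
qed

lemma is_hull: "generated_by \<sigma> T \<Longrightarrow> is_hull_of (tiling_hull T) \<sigma>"
  unfolding is_hull_of_def using hull_subset by blast

lemma in_own_hull: "is_tiling T \<Longrightarrow> T \<in> tiling_hull T"
proof -
  assume T: "is_tiling T"
  have "eps_close \<epsilon> T (move (\<lambda>z. z + 0) ` T)" if "\<epsilon> > 0" for \<epsilon>
    unfolding eps_close_def using that
    by (intro exI[of _ 0]) (simp add: agree_on_ball_def isom_def)
  then show ?thesis
    unfolding tiling_hull_def using T by blast
qed

end

subsection \<open>The rotationally symmetric tiling\<close>

lemma invariant_compose:
  "invariant_under f T \<Longrightarrow> invariant_under g T \<Longrightarrow> invariant_under (\<lambda>z. f (g z)) T"
proof -
  have "move (\<lambda>z. f (g z)) ` T = move f ` (move g ` T)"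
    by (simp only: image_image move_move)
  then show "invariant_under f T \<Longrightarrow> invariant_under g T \<Longrightarrow> invariant_under (\<lambda>z. f (g z)) T"
    by (simp only: invariant_under_def)
qed

lemma invariant_inverse:
  assumes "invariant_under f T" "\<And>z. g (f z) = z"
  shows "invariant_under g T"
proof -
  have "move g ` T = move g ` move f ` T"
    using assms(1) by (simp add: invariant_under_def)
  then show ?thesis
    using assms(2) by (simp add: invariant_under_def image_image move_move)
qed

lemma patch_subset: "is_patch P \<Longrightarrow> R \<subseteq> P \<Longrightarrow> is_patch R"
  unfolding is_patch_def disjoint_interiors_def by (meson finite_subset subsetD)

definition has_symmetric_DTO_tiling :: "nat \<Rightarrow> bool" where
  "has_symmetric_DTO_tiling n \<longleftrightarrow> (\<exists>\<sigma> H. primitive \<sigma> \<and> is_hull_of H \<sigma> \<and>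
    (\<exists>T\<in>H. \<exists>c.
       DTO \<sigma> T \<and>
       invariant_under (rotation c (2 * pi / real n)) T \<and>
       (\<forall>a \<alpha>. \<not> invariant_under (reflection a \<alpha>) T) \<and>
       (\<forall>\<alpha>. is_tiling (move (reflection c \<alpha>) ` T) \<and>
            move (reflection c \<alpha>) ` T \<noteq> T \<and>
            move (reflection c \<alpha>) ` T \<in> H \<and>
            invariant_under (rotation c (2 * pi / real n)) (move (reflection c \<alpha>) ` T))))"

definition star :: "nat \<Rightarrow> tile \<Rightarrow> tile set" where
  "star N t = (\<lambda>j. move (isom (\<lambda>z. cis (2 * pi * real j / real N) * z) 0) t) ` {..<N}"

lemma star_rotate:
  assumes "N > 0"
  shows "move (isom (\<lambda>z. cis (2 * pi / real N) * z) 0) ` star N t = star N t"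
proof -
  let ?f = "\<lambda>j. move (isom (\<lambda>z. cis (2 * pi * real j / real N) * z) 0) t"
  have step: "move (isom (\<lambda>z. cis (2 * pi / real N) * z) 0) (?f j) = ?f (Suc j)" for j
    by (simp add: move_move isom_def cis_mult add_divide_distrib distrib_left flip: mult.assoc)
  have N: "?f N = ?f 0"
    using assms by (simp add: isom_def)
  have "move (isom (\<lambda>z. cis (2 * pi / real N) * z) 0) ` star N t = ?f ` Suc ` {..<N}"
    by (simp add: star_def image_image step)
  \<comment> \<open>The index shift leads from {..<N} to {1..N}; both have the same image because
    the indices 0 and \<open>N\<close> give the same tile.\<close>
  also have "\<dots> = ?f ` {..<N}"
  proof -
    have "{1..N} \<union> {0} = {..<N} \<union> {N}"
      by auto
    then have "?f ` ({1..N} \<union> {0}) = ?f ` ({..<N} \<union> {N})"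
      by (rule arg_cong)
    then have "?f ` {1..N} \<union> {?f 0} = ?f ` {..<N} \<union> {?f N}"
      unfolding image_Un image_insert image_empty .
    moreover have "?f 0 \<in> ?f ` {..<N}"
      by (rule imageI) (use assms in simp)
    moreover have "?f N \<in> ?f ` {1..N}"
      by (rule imageI) (use assms in simp)
    moreover have "X = Y" if "X \<union> {a} = Y \<union> {b}" "a \<in> Y" "b \<in> X" "b = a" for X Y and a b :: tile
      using that by blast
    ultimately show ?thesis
      unfolding image_Suc_lessThan using N by metis
  qed
  finally show ?thesis
    by (simp add: star_def)
qed

text \<open>\<open>W_at_apex\<close> demands the very tile \<open>W\<close>, not merely a copy, so
  that the star recurs unmoved around the origin when it is inflated. \<open>star_in_Q\<close>
  places the star inside a supertile, as generatedness requires, and \<open>rigid\<close> allows the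
  orientation to be read off a marked tile.\<close>

locale star_subst = hub_subst +
  fixes N :: nat and W :: tile and \<rho> :: real
  assumes N: "N \<ge> 3"
    and W: "W \<in> protos \<sigma>"
    and W_at_apex: "W \<in> dissect \<sigma> W"
    and star_in_Q: "\<exists>B b. orthogonal_transformation B \<and> move (isom B b) ` star N W \<subseteq> dissect \<sigma> Q"
    and star_covers: "\<rho> > 0" "ball 0 \<rho> \<subseteq> (\<Union>t\<in>star N W. supp t)"
    and zero_in_W: "0 \<in> supp W"
    and rigid: "\<And>p A b. p \<in> protos \<sigma> \<Longrightarrow> orthogonal_transformation A \<Longrightarrow> move (isom A b) p = p
                  \<Longrightarrow> A = (\<lambda>z. z)"
begin

abbreviation "rot j \<equiv> isom (\<lambda>z. cis (2 * pi * real j / real N) * z) 0"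

lemma orth_rot: "orthogonal_transformation (\<lambda>z. cis \<theta> * z)"
  by (rule orth_mult) simp

lemma star_copies: "\<forall>t\<in>star N W. copy t"
  unfolding star_def using copy_move[OF copy_proto[OF W] orth_rot] by blast

lemma star_embeds: "\<exists>B b. orthogonal_transformation B \<and> star N W \<subseteq> move (isom B b) ` supertile \<sigma> 1 Q"
proof -
  obtain B b where B: "orthogonal_transformation B" "move (isom B b) ` star N W \<subseteq> dissect \<sigma> Q"
    using star_in_Q by blast
  obtain C c where C: "orthogonal_transformation C" "\<And>z. isom C c (isom B b z) = z"
    using isom_inverse[OF B(1)] by metis
  have "move (isom C c) ` move (isom B b) ` star N W \<subseteq> move (isom C c) ` dissect \<sigma> Q"
    using B(2) by blast
  then have "star N W \<subseteq> move (isom C c) ` supertile \<sigma> 1 Q"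
    by (simp add: image_image move_move C(2) supertile_1 Q del: One_nat_def)
  then show ?thesis
    using C by blast
qed

text \<open>The wedges of the star do not overlap because they all belong to one congruent copy of a
  supertile.\<close>

lemma dissects_star: "dissects (protos \<sigma>) (\<Union>t\<in>star N W. supp t) (star N W)"
proof -
  obtain B b where B: "orthogonal_transformation B" "star N W \<subseteq> move (isom B b) ` supertile \<sigma> 1 Q"
    using star_embeds by blast
  have "is_patch (move (isom B b) ` supertile \<sigma> 1 Q)"
    using dissects_supertile[OF Q] B(1) is_patch_move unfolding dissects_def by blast
  then have "is_patch (star N W)"
    using B(2) by (rule patch_subset)
  then show ?thesis
    using star_copies by (simp add: dissects_def copy_def)
qed

definition tiling :: "tile set" where
  "tiling = (\<Union>k. inflate k (star N W))"

lemma inflate_rot: "inflate k (move (isom (\<lambda>z. cis \<theta> * z) 0) ` star N W)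
    = move (isom (\<lambda>z. cis \<theta> * z) 0) ` inflate k (star N W)"
  using inflate_move[OF star_copies orth_rot, of k \<theta> 0] by simp

text \<open>The centre of the star is the origin, which both the rotations and the inflation fix;
  hence each wedge reappears in its own substitution. This makes the inflated stars
  increase.\<close>

lemma star_subset_inflate: "star N W \<subseteq> inflate 1 (star N W)"
proof
  fix t assume t: "t \<in> star N W"
  then obtain j where j: "t = move (rot j) W"
    by (auto simp: star_def)
  have "t \<in> subst_tile \<sigma> t"
    using W_at_apex unfolding j subst_tile_move[OF copy_proto[OF W] orth_rot]
    by (simp add: subst_tile_proto W)
  then show "t \<in> inflate 1 (star N W)"
    using t by (auto simp: subst_patch_def)
qed

lemma inflate_star_mono: "k \<le> l \<Longrightarrow> inflate k (star N W) \<subseteq> inflate l (star N W)"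
proof (induction l rule: dec_induct)
  case (step n)
  have "inflate n (star N W) \<subseteq> inflate n (inflate 1 (star N W))"
    by (rule inflate_mono[OF star_subset_inflate])
  also have "\<dots> = inflate (n + 1) (star N W)"
    by (simp only: inflate_add)
  finally show ?case
    using step by simp
qed simp

lemma star_subset_tiling: "star N W \<subseteq> tiling"
  unfolding tiling_def by (rule order_trans[OF _ UN_upper[of 0]]) simp_all

lemma finite_subset_tiling:
  assumes "finite P" "P \<subseteq> tiling"
  obtains k where "P \<subseteq> inflate k (star N W)"
proof -
  have "\<forall>t\<in>P. \<exists>k. t \<in> inflate k (star N W)"
    using assms by (auto simp: tiling_def)
  then obtain k where k: "\<And>t. t \<in> P \<Longrightarrow> t \<in> inflate (k t) (star N W)"
    by metis
  have "P \<subseteq> inflate (Max (insert 0 (k ` P))) (star N W)"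
  proof
    fix t assume "t \<in> P"
    then show "t \<in> inflate (Max (insert 0 (k ` P))) (star N W)"
      using k[of t] inflate_star_mono[of "k t" "Max (insert 0 (k ` P))"] assms(1) by auto
  qed
  then show ?thesis
    by (rule that)
qed

lemma is_tiling_tiling: "is_tiling tiling"
proof -
  have D: "dissects (protos \<sigma>) ((\<lambda>z. \<Lambda> ^ k *\<^sub>R z) ` (\<Union>t\<in>star N W. supp t)) (inflate k (star N W))" for k
    by (rule dissects_inflate[OF dissects_star])
  have "countable (inflate k (star N W))" for k
    using D[of k] by (simp add: dissects_def is_patch_def countable_finite)
  then have "countable tiling"
    unfolding tiling_def by (intro countable_UN) auto
  moreover have "is_tile t" if "t \<in> tiling" for t
    using that D unfolding tiling_def dissects_def is_patch_def by blast
  moreover have "disjoint_interiors tiling"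
    unfolding disjoint_interiors_def
  proof (intro ballI impI)
    fix s t assume st: "s \<in> tiling" "t \<in> tiling" "s \<noteq> t"
    then obtain k where "{s, t} \<subseteq> inflate k (star N W)"
      using finite_subset_tiling[of "{s, t}"] by auto
    moreover have "disjoint_interiors (inflate k (star N W))"
      using D[of k] by (simp add: dissects_def is_patch_def)
    ultimately show "interior (supp s) \<inter> interior (supp t) = {}"
      using st(3) by (simp add: disjoint_interiors_def)
  qed
  moreover have "z \<in> (\<Union>t\<in>tiling. supp t)" for z
  proof -
    \<comment> \<open>Inflating \<open>k\<close> times blows the covered disc of radius \<rho> up
      beyond \<open>z\<close>.\<close>
    obtain k where k: "norm z / \<rho> < \<Lambda> ^ k"
      using real_arch_pow[OF factor_gt_1] by blast
    have L: "\<Lambda> ^ k > 0"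
      by (rule factor_power_pos)
    have "norm ((1 / \<Lambda> ^ k) *\<^sub>R z) < \<rho>"
      using k L star_covers(1) by (simp add: field_simps)
    then have "(1 / \<Lambda> ^ k) *\<^sub>R z \<in> (\<Union>t\<in>star N W. supp t)"
      by (intro subsetD[OF star_covers(2)]) (simp only: mem_ball_0)
    then have "\<Lambda> ^ k *\<^sub>R (1 / \<Lambda> ^ k) *\<^sub>R z \<in> (\<lambda>z. \<Lambda> ^ k *\<^sub>R z) ` (\<Union>t\<in>star N W. supp t)"
      by blast
    moreover have "\<Lambda> ^ k *\<^sub>R (1 / \<Lambda> ^ k) *\<^sub>R z = z"
      using factor_gt_1 by simp
    ultimately have "z \<in> (\<Union>t\<in>inflate k (star N W). supp t)"
      using D[of k] by (simp only: dissects_def)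
    then show ?thesis
      by (auto simp: tiling_def)
  qed
  ultimately show ?thesis
    by (auto simp: is_tiling_def)
qed

lemma generated_tiling: "generated_by \<sigma> tiling"
  unfolding generated_by_def
proof (intro conjI allI impI is_tiling_tiling)
  fix P assume "finite P \<and> P \<subseteq> tiling"
  then obtain k where k: "P \<subseteq> inflate k (star N W)"
    using finite_subset_tiling by blast
  obtain B b where B: "orthogonal_transformation B" "star N W \<subseteq> move (isom B b) ` supertile \<sigma> 1 Q"
    using star_embeds by blast
  have "P \<subseteq> inflate k (move (isom B b) ` supertile \<sigma> 1 Q)"
    using k inflate_mono[OF B(2), of k] by blast
  also have "\<dots> = move (isom B (\<Lambda> ^ k *\<^sub>R b)) ` inflate k (supertile \<sigma> 1 Q)"
    using copy_supertile[OF Q] by (intro inflate_move B(1)) blast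
  also have "inflate k (supertile \<sigma> 1 Q) = supertile \<sigma> (k + 1) Q"
    by (simp only: supertile_def inflate_add)
  finally show "\<exists>k. \<exists>p\<in>protos \<sigma>. \<exists>A b. orthogonal_transformation A \<and> P \<subseteq> move (isom A b) ` supertile \<sigma> k p"
    using Q B(1) by blast
qed

lemma tiling_rot: "invariant_under (rot j) tiling"
proof (induction j)
  case 0
  show ?case
    by (simp add: isom_def invariant_under_def)
next
  case (Suc j)
  have "invariant_under (isom (\<lambda>z. cis (2 * pi / real N) * z) 0) tiling"
    using N by (simp add: invariant_under_def tiling_def image_UN star_rotate flip: inflate_rot)
  from invariant_compose[OF this Suc] show ?case
    by (simp add: isom_def cis_mult add_divide_distrib distrib_left flip: mult.assoc)
qed

text \<open>The star covers a neighbourhood of the origin, which leaves no room for other tiles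
  there.\<close>

lemma tile_at_center:
  assumes "t \<in> tiling" "0 \<in> supp t"
  shows "t \<in> star N W"
proof (rule tile_in_cover)
  show "disjoint_interiors tiling" "t \<in> tiling" "star N W \<subseteq> tiling"
    using is_tiling_tiling assms star_subset_tiling by (auto simp: is_tiling_def)
  show "is_tile f" if "f \<in> star N W" for f
    using that star_copies is_tile_copy by blast
  show "interior (supp t) \<inter> ball 0 \<rho> \<noteq> {}"
    using assms star_covers(1) is_tiling_tiling by (intro tiles_meet_open) (auto simp: is_tiling_def)
  show "interior (supp t) \<inter> ball 0 \<rho> \<subseteq> (\<Union>t\<in>star N W. supp t)"
    using star_covers(2) by blast
qed simp

section \<open>Dense orientations and the absence of mirror lines\<close>

lemma rigid_rotation:
  assumes p: "p \<in> protos \<sigma>"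
    and eq: "move (isom (\<lambda>z. cis \<theta> * z) x) p = move (isom (\<lambda>z. cis \<theta>' * z) y) p"
  shows "cis \<theta> = cis \<theta>'"
proof -
  have "move (isom (\<lambda>z. cis (-\<theta>') * z) (- cis (-\<theta>') * y)) (move (isom (\<lambda>z. cis \<theta> * z) x) p)
      = move (isom (\<lambda>z. cis (-\<theta>') * z) (- cis (-\<theta>') * y)) (move (isom (\<lambda>z. cis \<theta>' * z) y) p)"
    using eq by simp
  also have "\<dots> = p"
    by (simp add: move_move isom_def distrib_left cis_mult flip: mult.assoc)
  finally have "move (isom (\<lambda>z. cis (-\<theta>') * (cis \<theta> * z)) (cis (-\<theta>') * x - cis (-\<theta>') * y)) p = p"
    by (simp add: move_move isom_def distrib_left add_diff_eq)
  from rigid[OF p orth_compose[OF orth_rot orth_rot] this]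
  have "cis (-\<theta>') * (cis \<theta> * 1) = 1"
    by (rule fun_cong)
  then have "cis \<theta>' * (cis (-\<theta>') * (cis \<theta> * 1)) = cis \<theta>'"
    by simp
  then show ?thesis
    by (simp add: cis_mult flip: mult.assoc)
qed

lemma DTO_generated:
  assumes T: "generated_by \<sigma> T"
  shows "{0..<2 * pi} \<subseteq> closure {\<theta>\<in>{0..<2 * pi}. \<exists>x. move (isom (\<lambda>z. cis \<theta> * z) x) W \<in> T}"
proof
  fix \<phi> :: real assume \<phi>: "\<phi> \<in> {0..<2 * pi}"
  show "\<phi> \<in> closure {\<theta>\<in>{0..<2 * pi}. \<exists>x. move (isom (\<lambda>z. cis \<theta> * z) x) W \<in> T}"
    unfolding closure_approachable
  proof (intro allI impI)
    fix e :: real assume "e > 0"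
    \<comment> \<open>The angle aimed at is \<phi> + \<open>d\<close> with error below
      \<open>d\<close>. Aiming at \<phi> itself could yield an angle outside of [0, 2 \<pi>), for
      instance for \<phi> = 0.\<close>
    define d where "d = min e (2 * pi - \<phi>) / 2"
    have d: "d > 0" "2 * d \<le> e" "\<phi> + 2 * d \<le> 2 * pi"
      using \<open>e > 0\<close> \<phi> by (auto simp: d_def)
    obtain \<delta> c where \<delta>: "\<bar>\<delta>\<bar> < d"
      "move (isom (\<lambda>z. cis \<delta> * (cis (\<phi> + d) * z)) c) ` supertile \<sigma> 0 W \<subseteq> T"
      using generated_occurs[OF T d(1) W orth_rot, of "\<phi> + d" 0] .
    then have "move (isom (\<lambda>z. cis (\<delta> + (\<phi> + d)) * z) c) W \<in> T"
      by (simp add: supertile_def cis_mult flip: mult.assoc)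
    moreover have "\<delta> + (\<phi> + d) \<in> {0..<2 * pi}"
      using \<delta>(1) d \<phi> by auto
    moreover have "dist (\<delta> + (\<phi> + d)) \<phi> < e"
      using \<delta>(1) d by (simp add: dist_real_def)
    ultimately show "\<exists>y\<in>{\<theta>\<in>{0..<2 * pi}. \<exists>x. move (isom (\<lambda>z. cis \<theta> * z) x) W \<in> T}. dist y \<phi> < e"
      by blast
  qed
qed

text \<open>Modulo two independent periods there are only finitely many tiles, hence only finitely many
  orientations.\<close>

lemma no_two_periods:
  assumes d: "invariant_under (\<lambda>z. z + d) tiling" "d \<noteq> 0"
    and w: "invariant_under (\<lambda>z. z + \<zeta> * d) tiling" "Im \<zeta> \<noteq> 0"
  shows False
proof -
  have minus: "invariant_under (\<lambda>z. z + - x) tiling" if "invariant_under (\<lambda>z. z + x) tiling" for x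
    using that by (rule invariant_inverse) simp
  have nat: "invariant_under (\<lambda>z. z + of_nat m * x) tiling" if "invariant_under (\<lambda>z. z + x) tiling" for x m
  proof (induction m)
    case (Suc m)
    from invariant_compose[OF that Suc] show ?case
      by (simp add: algebra_simps)
  qed (simp add: invariant_under_def)
  have int: "invariant_under (\<lambda>z. z + of_int m * x) tiling" if "invariant_under (\<lambda>z. z + x) tiling" for x m
  proof (cases m rule: int_cases2)
    case (nonneg n)
    then show ?thesis
      using nat[OF that] by simp
  next
    case (nonpos n)
    then show ?thesis
      using minus[OF nat[OF that]] by simp
  qed
  \<comment> \<open>Every point of the period parallelogram with corner 0 has norm at most
    \<open>norm d + norm (\<zeta> * d)\<close>, which is less than \<open>R\<close> since
    \<open>d\<close> is nonzero.\<close>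
  define R where "R = 2 * norm d + 2 * norm (\<zeta> * d)"
  define F where "F = {t\<in>tiling. supp t \<inter> ball 0 R \<noteq> {}}"
  have "finite F"
    unfolding F_def using is_tiling_tiling generated_copy[OF generated_tiling]
    by (intro finite_meeting_ball) (auto simp: is_tiling_def)
  have reduce: "\<exists>x. move (\<lambda>z. z + x) t \<in> F" if t: "t \<in> tiling" for t
  proof -
    have "is_tile t"
      using t is_tiling_tiling by (auto simp: is_tiling_def)
    then obtain y where y: "y \<in> supp t"
      by (auto simp: is_tile_def)
    \<comment> \<open>Coordinates of \<open>y\<close> in the real basis \<open>d\<close>,
      \<open>\<zeta> * d\<close>; subtracting their integer parts moves \<open>y\<close> into the
      period parallelogram.\<close>
    define b where "b = Im (y / d) / Im \<zeta>"
    define a where "a = Re (y / d) - b * Re \<zeta>"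
    have "y / d = of_real a + of_real b * \<zeta>"
      using w(2) by (simp add: complex_eq_iff a_def b_def)
    then have yab: "y = of_real a * d + of_real b * (\<zeta> * d)"
      using d(2) by (simp add: field_simps)
    let ?x = "of_int (- \<lfloor>a\<rfloor>) * d + of_int (- \<lfloor>b\<rfloor>) * (\<zeta> * d)"
    have "invariant_under (\<lambda>z. z + ?x) tiling"
      using invariant_compose[OF int[OF w(1), of "- \<lfloor>b\<rfloor>"] int[OF d(1), of "- \<lfloor>a\<rfloor>"]]
      by (simp only: add.assoc)
    then have tx: "move (\<lambda>z. z + ?x) t \<in> tiling"
      using t unfolding invariant_under_def by blast
    have "y + ?x = of_real (frac a) * d + of_real (frac b) * (\<zeta> * d)"
      by (simp add: yab frac_def algebra_simps)
    then have "norm (y + ?x) \<le> norm (of_real (frac a) * d) + norm (of_real (frac b) * (\<zeta> * d))"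
      by (simp add: norm_triangle_ineq)
    also have "\<dots> \<le> 1 * norm d + 1 * norm (\<zeta> * d)"
      unfolding norm_mult[of "of_real _"]
      by (intro add_mono mult_right_mono) (auto simp: frac_lt_1 less_imp_le)
    also have "\<dots> < R"
      using d(2) norm_ge_zero[of "\<zeta> * d"] zero_less_norm_iff[of d] unfolding R_def by linarith
    finally have "y + ?x \<in> supp (move (\<lambda>z. z + ?x) t) \<inter> ball 0 R"
      using y by simp
    then show ?thesis
      using tx unfolding F_def by blast
  qed
  define \<Theta> where "\<Theta> = {\<theta>\<in>{0..<2 * pi}. \<exists>x. move (isom (\<lambda>z. cis \<theta> * z) x) W \<in> tiling}"
  have "\<exists>x. move (isom (\<lambda>z. cis \<theta> * z) x) W \<in> F" if \<theta>: "\<theta> \<in> \<Theta>" for \<theta>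
  proof -
    obtain x where "move (isom (\<lambda>z. cis \<theta> * z) x) W \<in> tiling"
      using \<theta> by (auto simp: \<Theta>_def)
    then obtain y where "move (\<lambda>z. z + y) (move (isom (\<lambda>z. cis \<theta> * z) x) W) \<in> F"
      using reduce by blast
    then have "move (isom (\<lambda>z. cis \<theta> * z) (x + y)) W \<in> F"
      by (simp add: move_move isom_def add.assoc)
    then show ?thesis ..
  qed
  then obtain x where x: "\<And>\<theta>. \<theta> \<in> \<Theta> \<Longrightarrow> move (isom (\<lambda>z. cis \<theta> * z) (x \<theta>)) W \<in> F"
    by metis
  have "inj_on (\<lambda>\<theta>. move (isom (\<lambda>z. cis \<theta> * z) (x \<theta>)) W) \<Theta>"
  proof (rule inj_onI)
    fix \<theta> \<theta>' assume \<theta>: "\<theta> \<in> \<Theta>" "\<theta>' \<in> \<Theta>"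
      and "move (isom (\<lambda>z. cis \<theta> * z) (x \<theta>)) W = move (isom (\<lambda>z. cis \<theta>' * z) (x \<theta>')) W"
    then have "cis \<theta> = cis \<theta>'"
      using rigid_rotation[OF W] by blast
    moreover have "Arg2pi (cis \<phi>) = \<phi>" if "\<phi> \<in> \<Theta>" for \<phi>
      using that by (intro Arg2pi_unique[of 1]) (simp_all add: \<Theta>_def cis_conv_exp)
    ultimately show "\<theta> = \<theta>'"
      using \<theta> by metis
  qed
  moreover have "finite ((\<lambda>\<theta>. move (isom (\<lambda>z. cis \<theta> * z) (x \<theta>)) W) ` \<Theta>)"
    using x \<open>finite F\<close> by (auto intro: finite_subset)
  ultimately have "finite \<Theta>"
    by (rule finite_imageD[rotated])
  moreover have "{0..<2 * pi} \<subseteq> closure \<Theta>"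
    unfolding \<Theta>_def by (rule DTO_generated[OF generated_tiling])
  \<comment> \<open>A finite set is closed, so a finite dense set of angles would be the whole
    interval.\<close>
  ultimately have "finite {0..<2 * pi}"
    using finite_subset finite_imp_closed closure_closed by metis
  then show False
    by (simp add: infinite_Ico)
qed

lemma reflection_eq: "reflection a \<alpha> = isom (\<lambda>z. cis (2 * \<alpha>) * cnj z) (a - cis (2 * \<alpha>) * cnj a)"
  by (auto simp: reflection_def isom_def algebra_simps)

text \<open>The offset \<open>c\<close> vanishes precisely when the mirror line passes through the
  origin. Then \<open>W\<close> is mapped to a tile at the origin, that is to a rotated copy of
  itself, against rigidity. Otherwise the reflection and the rotations about a point off its axis
  generate translations in independent directions.\<close>

lemma not_mirror_symmetric: "\<not> invariant_under (reflection a \<alpha>) tiling"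
proof
  assume inv: "invariant_under (reflection a \<alpha>) tiling"
  define e where "e = cis (2 * \<alpha>)"
  define c where "c = a - e * cnj a"
  have e: "e * cnj e = 1" "cmod e = 1"
    by (simp_all add: e_def cis_cnj cis_mult)
  have refl: "reflection a \<alpha> = (\<lambda>z. e * cnj z + c)"
    by (simp add: reflection_eq isom_def e_def c_def)
  \<comment> \<open>Expresses that a reflection is an involution: it sends 0 to \<open>c\<close> and
    \<open>c\<close> back to 0.\<close>
  have ec: "e * cnj c = - c"
    using e(1) by (simp add: c_def algebra_simps flip: mult.assoc)
  show False
  proof (cases "c = 0")
    case True
    have "move (\<lambda>z. e * cnj z) W \<in> tiling"
    proof -
      have "move (rot 0) W \<in> star N W"
        unfolding star_def by (rule imageI) (use N in simp)
      moreover have "move (rot 0) W = W"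
        by simp
      ultimately have "W \<in> star N W"
        by (simp only:)
      then have "move (reflection a \<alpha>) W \<in> tiling"
        using inv star_subset_tiling unfolding invariant_under_def by blast
      then show ?thesis
        using True by (simp add: refl)
    qed
    moreover have "0 \<in> supp (move (\<lambda>z. e * cnj z) W)"
      using zero_in_W by (auto intro: rev_image_eqI)
    ultimately have "move (\<lambda>z. e * cnj z) W \<in> star N W"
      by (rule tile_at_center)
    then obtain \<theta> where "move (\<lambda>z. e * cnj z) W = move (isom (\<lambda>z. cis \<theta> * z) 0) W"
      by (auto simp: star_def)
    then have "move (isom (\<lambda>z. cis (-\<theta>) * z) 0) (move (\<lambda>z. e * cnj z) W)
        = move (isom (\<lambda>z. cis (-\<theta>) * z) 0) (move (isom (\<lambda>z. cis \<theta> * z) 0) W)"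
      by simp
    then have "move (isom (\<lambda>z. cis (-\<theta>) * (e * cnj z)) 0) W = W"
      by (simp add: move_move isom_def cis_mult flip: mult.assoc)
    \<comment> \<open>An orientation-reversing map cannot be the identity: the values at 1 and at
      the imaginary unit are incompatible.\<close>
    from rigid[OF W orth_compose[OF orth_rot orth_mult_cnj[OF e(2)]] this]
    have "cis (-\<theta>) * (e * cnj 1) = 1" "cis (-\<theta>) * (e * cnj \<i>) = \<i>"
      by (rule fun_cong)+
    then show False
      by (simp add: complex_eq_iff)
  next
    case False
    define \<zeta> where "\<zeta> = cis (2 * pi / real N)"
    have \<zeta>: "\<zeta> * cnj \<zeta> = 1"
      by (simp add: \<zeta>_def cis_cnj cis_mult)
    have "2 * pi / real N < pi"
      using N by (simp add: field_simps)
    then have Im: "Im \<zeta> > 0"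
      using N by (simp add: \<zeta>_def sin_gt_zero)
    then have "\<zeta> \<noteq> 1"
      by auto
    have rot: "invariant_under (\<lambda>z. \<zeta> * z) tiling"
      using tiling_rot[of 1] by (simp add: isom_def \<zeta>_def)
    then have rot': "invariant_under (\<lambda>z. cnj \<zeta> * z) tiling"
      by (rule invariant_inverse) (metis \<zeta> mult.assoc mult.commute mult_1)
    let ?v = "(1 - \<zeta>) * c"
    have refl': "invariant_under (\<lambda>z. e * cnj z + c) tiling"
      using inv by (simp add: refl)
    \<comment> \<open>Reflection after inverse rotation, applied twice: the linear part is itself a
      reflection, so its square is the identity and a pure translation remains.\<close>
    have "e * cnj (cnj \<zeta> * (e * cnj (cnj \<zeta> * z) + c)) + c = z + ?v" for z
    proof -
      have "e * cnj (cnj \<zeta> * (e * cnj (cnj \<zeta> * z) + c)) + c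
          = (e * cnj e) * (\<zeta> * cnj \<zeta>) * z + \<zeta> * (e * cnj c) + c"
        by (simp add: algebra_simps)
      also have "\<dots> = z + ?v"
        using e \<zeta> ec by (simp add: algebra_simps)
      finally show ?thesis .
    qed
    then have 1: "invariant_under (\<lambda>z. z + ?v) tiling"
      using invariant_compose[OF refl' invariant_compose[OF rot' invariant_compose[OF refl' rot']]] by simp
    \<comment> \<open>Conjugation with the rotation turns the period \<open>?v\<close> into
      \<open>\<zeta> * ?v\<close>, which is independent of it as \<open>N\<close> \<ge> 3 makes
      \<zeta> nonreal.\<close>
    have "\<zeta> * (cnj \<zeta> * z + ?v) = z + \<zeta> * ?v" for z
      using \<zeta> by (simp add: distrib_left flip: mult.assoc)
    then have 2: "invariant_under (\<lambda>z. z + \<zeta> * ?v) tiling"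
      using invariant_compose[OF rot invariant_compose[OF 1 rot']] by simp
    show False
      using no_two_periods[OF 1 _ 2] False \<open>\<zeta> \<noteq> 1\<close> Im by simp
  qed
qed

theorem symmetric_tiling:
  assumes n: "n dvd N"
  shows "has_symmetric_DTO_tiling n"
  unfolding has_symmetric_DTO_tiling_def
proof (intro exI[of _ \<sigma>] exI[of _ "tiling_hull tiling"] conjI bexI[of _ tiling] exI[of _ 0] allI)
  show "Defs.primitive \<sigma>"
    by (rule primitive)
  show "is_hull_of (tiling_hull tiling) \<sigma>"
    by (rule is_hull[OF generated_tiling])
  show "tiling \<in> tiling_hull tiling"
    by (rule in_own_hull[OF is_tiling_tiling])
  show "DTO \<sigma> tiling"
    unfolding DTO_def using DTO_generated[OF generated_tiling] W by blast
  obtain m where m: "N = n * m"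
    using n by (auto elim: dvdE)
  have "m > 0"
    using N m by (cases m) auto
  then have mn: "2 * pi * real m / real N = 2 * pi / real n"
    by (simp add: m)
  have rot: "rotation 0 (2 * pi / real n) = rot m"
    by (simp add: mn rotation_def isom_def)
  show inv: "invariant_under (rotation 0 (2 * pi / real n)) tiling"
    unfolding rot by (rule tiling_rot)
  show "\<not> invariant_under (reflection a \<alpha>) tiling" for a \<alpha>
    by (rule not_mirror_symmetric)
  fix \<alpha>
  have refl: "reflection 0 \<alpha> = isom (\<lambda>z. cis (2 * \<alpha>) * cnj z) 0"
    by (simp add: reflection_eq)
  have orth: "orthogonal_transformation (\<lambda>z. cis (2 * \<alpha>) * cnj z)"
    by (rule orth_mult_cnj) simp
  show "is_tiling (move (reflection 0 \<alpha>) ` tiling)"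
    unfolding refl by (rule is_tiling_move[OF orth is_tiling_tiling])
  show "move (reflection 0 \<alpha>) ` tiling \<noteq> tiling"
    using not_mirror_symmetric unfolding invariant_under_def .
  \<comment> \<open>The mirror image is generated by the same substitution, because generatedness
    allows all isometries; therefore it lies in the common hull.\<close>
  have gen: "generated_by \<sigma> (move (reflection 0 \<alpha>) ` tiling)"
    unfolding refl by (rule generated_move[OF generated_tiling orth])
  then show "move (reflection 0 \<alpha>) ` tiling \<in> tiling_hull tiling"
    using hull_subset[OF gen generated_tiling] in_own_hull generated_by_def by blast
  let ?R = "rotation 0 (2 * pi / real n)"
  have "invariant_under (\<lambda>z. cis (- (2 * pi / real n)) * z) tiling"
    using inv by (rule invariant_inverse) (simp add: rotation_def cis_mult flip: mult.assoc)
  then have "move (\<lambda>z. cis (- (2 * pi / real n)) * z) ` tiling = tiling"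
    by (simp add: invariant_under_def)
  \<comment> \<open>A reflection through the centre conjugates the rotation into its inverse, which
    is a symmetry as well.\<close>
  moreover have "?R (reflection 0 \<alpha> z) = reflection 0 \<alpha> (cis (- (2 * pi / real n)) * z)" for z
    by (simp add: rotation_def reflection_def cis_cnj)
  then have "move ?R ` move (reflection 0 \<alpha>) ` tiling
      = move (reflection 0 \<alpha>) ` move (\<lambda>z. cis (- (2 * pi / real n)) * z) ` tiling"
    by (simp add: image_image move_move)
  ultimately show "invariant_under ?R (move (reflection 0 \<alpha>) ` tiling)"
    by (simp add: invariant_under_def)
qed

end

subsection \<open>Marked shapes\<close>

text \<open>The vertices of a scalene triangle: a right triangle with legs \<open>e\<close> and
  \<open>2 * e\<close>, whose hypotenuse is \<open>e\<close> times the square root of 5. As the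
  three distances differ, an isometry preserving the triple fixes every vertex.\<close>

lemma rigid_subset_exists:
  assumes "interior X \<noteq> {}"
  shows "\<exists>D\<subseteq>X. \<forall>A b. orthogonal_transformation A \<longrightarrow> isom A b ` D = D \<longrightarrow> A = (\<lambda>z. z) \<and> b = 0"
proof -
  obtain x d where d: "d > 0" "ball x d \<subseteq> X"
    using assms by (metis all_not_in_conv mem_interior)
  define e where "e = d / 3"
  have e: "e > 0" "2 * e < d"
    using d by (auto simp: e_def)
  define y where "y = x + of_real e"
  define z where "z = x + of_real (2 * e) * \<i>"
  have dist: "dist x y = e" "dist x z = 2 * e"
    using e by (simp_all add: y_def z_def dist_norm norm_mult)
  have "(dist y z)\<^sup>2 = 5 * e\<^sup>2"
    unfolding dist_norm cmod_power2 by (simp add: y_def z_def power2_eq_square algebra_simps)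
  moreover have "5 * e\<^sup>2 \<noteq> e\<^sup>2" "5 * e\<^sup>2 \<noteq> (2 * e)\<^sup>2"
    using e by (simp_all add: power_mult_distrib)
  ultimately have yz: "dist y z \<noteq> e" "dist y z \<noteq> 2 * e"
    by auto
  have "{x, y, z} \<subseteq> X"
  proof -
    have "x \<in> ball x d" "y \<in> ball x d" "z \<in> ball x d"
      using dist e d(1) by simp_all
    then show ?thesis
      using d(2) by blast
  qed
  moreover have "A = (\<lambda>z. z) \<and> b = 0"
    if A: "orthogonal_transformation A" and D: "isom A b ` {x, y, z} = {x, y, z}" for A b
  proof -
    let ?g = "isom A b"
    have g: "?g x \<in> {x, y, z}" "?g y \<in> {x, y, z}" "?g z \<in> {x, y, z}"
      using D by blast+
    have dg: "dist (?g x) (?g y) = e" "dist (?g x) (?g z) = 2 * e"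
      using dist by (simp_all add: dist_isom A)
    have zy: "dist y x = e" "dist z x = 2 * e" "dist z y \<noteq> e" "dist z y \<noteq> 2 * e" "e \<noteq> 0" "2 * e \<noteq> e"
      using dist yz e by (simp_all add: dist_commute)
    \<comment> \<open>A pair of vertices is determined by its distance; \<open>x\<close> is the
      vertex that the two leg pairs share.\<close>
    have "{p, q} = {x, y}" if "p \<in> {x, y, z}" "q \<in> {x, y, z}" "dist p q = e" for p q
      using that dist yz zy by (elim insertE emptyE) (simp_all add: insert_commute)
    then have "{?g x, ?g y} = {x, y}"
      using g(1,2) dg(1) by blast
    moreover have "{p, q} = {x, z}" if "p \<in> {x, y, z}" "q \<in> {x, y, z}" "dist p q = 2 * e" for p q
      using that dist yz zy by (elim insertE emptyE) (simp_all add: insert_commute)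
    then have "{?g x, ?g z} = {x, z}"
      using g(1,3) dg(2) by blast
    moreover have "x \<noteq> y" "x \<noteq> z" "y \<noteq> z"
      using dist e yz by auto
    ultimately have fx: "?g x = x" "?g y = y" "?g z = z"
      by (auto simp: doubleton_eq_iff)
    have "A (y - x) = ?g y - ?g x" "A (z - x) = ?g z - ?g x"
      by (simp_all add: orth_diff[OF A] isom_def)
    then have "A (y - x) = y - x" "A (z - x) = z - x"
      unfolding fx .
    then have Ae: "A (of_real e) = of_real e" "A (of_real (2 * e) * \<i>) = of_real (2 * e) * \<i>"
      by (simp_all add: y_def z_def)
    from A have "A = (\<lambda>z. z)"
    proof (cases rule: orth_complex_cases)
      case (1 a)
      then have "a = 1"
        using Ae(1) e by simp
      then show ?thesis
        using 1 by simp
    next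
      case (2 a)
      then have "a = 1"
        using Ae(1) e by simp
      then have False
        using Ae(2) e 2 by simp
      then show ?thesis ..
    qed
    moreover have "b = 0"
      using fx(1) calculation by (simp add: isom_def)
    ultimately show ?thesis
      by simp
  qed
  ultimately show ?thesis
    by blast
qed

lemma separated_interiors:
  assumes "\<And>z. z \<in> X \<Longrightarrow> a * Re z + b * Im z \<le> c" "\<And>z. z \<in> Y \<Longrightarrow> a * Re z + b * Im z \<ge> c"
    and "a \<noteq> 0 \<or> b \<noteq> 0"
  shows "interior X \<inter> interior Y = {}"
proof -
  let ?n = "Complex a b"
  have n: "?n \<noteq> 0"
    using assms(3) by (simp add: complex_eq_iff)
  have "X \<subseteq> {z. ?n \<bullet> z \<le> c}" "Y \<subseteq> {z. ?n \<bullet> z \<ge> c}"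
    using assms(1,2) by (auto simp: inner_complex_def)
  then have "interior X \<subseteq> {z. ?n \<bullet> z < c}" "interior Y \<subseteq> {z. ?n \<bullet> z > c}"
    using interior_mono interior_halfspace_le[OF n, of c] interior_halfspace_ge[OF n, of c] by blast+
  then show ?thesis
    by fastforce
qed

locale marked_shapes =
  fixes \<S> :: "complex set set"
  assumes finite_shapes: "finite \<S>"
    and nonempty_shapes: "\<S> \<noteq> {}"
    and shape: "\<And>X. X \<in> \<S> \<Longrightarrow> compact X \<and> convex X \<and> interior X \<noteq> {}"
begin

definition marking :: "complex set \<Rightarrow> complex set" where
  "marking X = (SOME D. D \<subseteq> X \<and>
     (\<forall>A b. orthogonal_transformation A \<longrightarrow> isom A b ` D = D \<longrightarrow> A = (\<lambda>z. z) \<and> b = 0))"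

definition label :: "complex set \<Rightarrow> nat" where
  "label = (SOME f. inj_on f \<S>)"

definition mark :: "complex set \<Rightarrow> tile" where
  "mark X = Tile X (marking X) (label X)"

lemma supp_mark [simp]: "supp (mark X) = X"
  by (simp add: mark_def)

lemma marking:
  assumes "X \<in> \<S>"
  shows "marking X \<subseteq> X"
    and "orthogonal_transformation A \<Longrightarrow> isom A b ` marking X = marking X \<Longrightarrow> A = (\<lambda>z. z) \<and> b = 0"
proof -
  have "\<exists>D. D \<subseteq> X \<and> (\<forall>A b. orthogonal_transformation A \<longrightarrow> isom A b ` D = D \<longrightarrow> A = (\<lambda>z. z) \<and> b = 0)"
    using rigid_subset_exists shape[OF assms] by blast
  note D = someI_ex[OF this, folded marking_def]
  show "marking X \<subseteq> X"
    using D by blast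
  show "orthogonal_transformation A \<Longrightarrow> isom A b ` marking X = marking X \<Longrightarrow> A = (\<lambda>z. z) \<and> b = 0"
    using D by blast
qed

lemma inj_label: "inj_on label \<S>"
proof -
  have "\<exists>f :: complex set \<Rightarrow> nat. inj_on f \<S>"
    using finite_imp_inj_to_nat_seg[OF finite_shapes] by blast
  then show ?thesis
    unfolding label_def by (rule someI_ex)
qed

lemma is_tile_mark: "X \<in> \<S> \<Longrightarrow> is_tile (mark X)"
  using shape[of X] marking(1)[of X] convex_closure_interior[of X]
  by (auto simp: is_tile_def mark_def compact_imp_closed)

lemma mark_rigid:
  assumes "X \<in> \<S>" "orthogonal_transformation A" "move (isom A b) (mark X) = mark X"
  shows "A = (\<lambda>z. z)" "b = 0"
proof -
  have "isom A b ` marking X = marking X"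
    using assms(3) by (simp add: mark_def move_def)
  then show "A = (\<lambda>z. z)" "b = 0"
    using marking(2)[OF assms(1,2)] by auto
qed

text \<open>The colour tells the shape, and undoing the second isometry leaves a symmetry of the
  marking, which has none. So a tile is a copy of a prototile in only one way, which is what
  consistency of a substitution asks for.\<close>

lemma mark_move_eqD:
  assumes XY: "X \<in> \<S>" "Y \<in> \<S>" and A: "orthogonal_transformation A" and B: "orthogonal_transformation B"
    and eq: "move (isom A b) (mark X) = move (isom B c) (mark Y)"
  shows "X = Y" "A = B" "b = c"
proof -
  have "label X = label Y"
    using eq by (simp add: mark_def move_def)
  then show "X = Y"
    using inj_label XY by (simp add: inj_on_eq_iff)
  obtain C d where C: "orthogonal_transformation C" "\<And>z. isom B c (isom C d z) = z"
    "\<And>z. isom C d (isom B c z) = z" "\<And>z. B (C z) = z" "\<And>z. C (B z) = z"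
    using isom_inverse[OF B] by metis
  have "move (isom C d) (move (isom A b) (mark X)) = mark X"
    unfolding eq using \<open>X = Y\<close> by (simp add: move_move C)
  then have "move (isom (\<lambda>z. C (A z)) (C b + d)) (mark X) = mark X"
    by (simp add: move_move isom_isom C)
  from mark_rigid[OF XY(1) orth_compose[OF C(1) A] this]
  have CA: "(\<lambda>z. C (A z)) = (\<lambda>z. z)" "C b + d = 0" .
  show "A = B"
  proof
    fix z
    have "B (C (A z)) = B z"
      using fun_cong[OF CA(1), of z] by simp
    then show "A z = B z"
      by (simp add: C(4))
  qed
  have "isom C d b = isom C d c"
    using CA(2) C(3)[of 0] B by (simp add: isom_def orth_0)
  then show "b = c"
    using C(2) by metis
qed

text \<open>Only the tiles \<open>F\<close> that a dissection must contain are tracked, and the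
  remaining ones are existential; \<open>fits {} X\<close> just says that \<open>X\<close> can be
  dissected. Cutting arguments thus never have to name a whole patch.\<close>

definition fits :: "tile set \<Rightarrow> complex set \<Rightarrow> bool" where
  "fits F X \<longleftrightarrow> (\<exists>P. dissects (mark ` \<S>) X P \<and> F \<subseteq> P)"

lemma fits_mono: "fits F X \<Longrightarrow> F' \<subseteq> F \<Longrightarrow> fits F' X"
  unfolding fits_def by blast

lemma fits_move:
  "orthogonal_transformation A \<Longrightarrow> fits F X \<Longrightarrow> fits (move (isom A b) ` F) (isom A b ` X)"
  unfolding fits_def using dissects_move image_mono by metis

lemma fits_shape: "X \<in> \<S> \<Longrightarrow> fits {mark X} X"
  unfolding fits_def dissects_def is_patch_def disjoint_interiors_def
  by (intro exI[of _ "{mark X}"]) (auto simp: is_tile_mark intro!: bexI[of _ X] tile_equiv_refl)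

lemma fits_UN:
  assumes I: "finite I" and F: "\<And>i. i \<in> I \<Longrightarrow> fits (F i) (X i)"
    and disj: "\<And>i j. i \<in> I \<Longrightarrow> j \<in> I \<Longrightarrow> i \<noteq> j \<Longrightarrow> interior (X i) \<inter> interior (X j) = {}"
  shows "fits (\<Union>i\<in>I. F i) (\<Union>i\<in>I. X i)"
proof -
  obtain P where P: "\<And>i. i \<in> I \<Longrightarrow> dissects (mark ` \<S>) (X i) (P i)" "\<And>i. i \<in> I \<Longrightarrow> F i \<subseteq> P i"
    using F unfolding fits_def by metis
  have sub: "interior (supp t) \<subseteq> interior (X i)" if "i \<in> I" "t \<in> P i" for i t
    using P(1)[OF that(1)] that(2) by (intro interior_mono) (auto simp: dissects_def)
  have "disjoint_interiors (\<Union>i\<in>I. P i)"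
    unfolding disjoint_interiors_def
  proof (intro ballI impI)
    fix s t assume st: "s \<in> (\<Union>i\<in>I. P i)" "t \<in> (\<Union>i\<in>I. P i)" "s \<noteq> t"
    then obtain i j where ij: "i \<in> I" "s \<in> P i" "j \<in> I" "t \<in> P j"
      by blast
    show "interior (supp s) \<inter> interior (supp t) = {}"
    proof (cases "i = j")
      case True
      have "disjoint_interiors (P i)"
        using P(1)[OF ij(1)] by (simp add: dissects_def is_patch_def)
      then show ?thesis
        using st(3) ij True by (simp add: disjoint_interiors_def)
    next
      case False
      then show ?thesis
        using disj[OF ij(1,3)] sub[OF ij(1,2)] sub[OF ij(3,4)] by blast
    qed
  qed
  moreover have "finite (\<Union>i\<in>I. P i)"
    using I P(1) by (intro finite_UN_I) (auto simp: dissects_def is_patch_def)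
  moreover have "is_tile t \<and> (\<exists>q\<in>mark ` \<S>. tile_equiv q t)" if t: "t \<in> (\<Union>i\<in>I. P i)" for t
  proof -
    obtain i where i: "i \<in> I" "t \<in> P i"
      using t by blast
    then show ?thesis
      using P(1)[OF i(1)] unfolding dissects_def is_patch_def by blast
  qed
  moreover have "(\<Union>t\<in>(\<Union>i\<in>I. P i). supp t) = (\<Union>i\<in>I. X i)"
  proof -
    have "(\<Union>t\<in>(\<Union>i\<in>I. P i). supp t) = (\<Union>i\<in>I. \<Union>t\<in>P i. supp t)"
      by blast
    also have "\<dots> = (\<Union>i\<in>I. X i)"
      using P(1) by (intro SUP_cong refl) (simp add: dissects_def)
    finally show ?thesis .
  qed
  ultimately have "dissects (mark ` \<S>) (\<Union>i\<in>I. X i) (\<Union>i\<in>I. P i)"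
    by (simp add: dissects_def is_patch_def)
  moreover have "(\<Union>i\<in>I. F i) \<subseteq> (\<Union>i\<in>I. P i)"
    using P(2) by blast
  ultimately show ?thesis
    unfolding fits_def by blast
qed

lemma fits_Un:
  assumes "fits F X" "fits G Y" "interior X \<inter> interior Y = {}"
  shows "fits (F \<union> G) (X \<union> Y)"
proof -
  have "fits (\<Union>i\<in>{True, False}. if i then F else G) (\<Union>i\<in>{True, False}. if i then X else Y)"
    by (rule fits_UN) (use assms in \<open>auto split: if_splits\<close>)
  then show ?thesis
    by (simp add: Un_commute)
qed

definition subst_of :: "real \<Rightarrow> (complex set \<Rightarrow> tile set) \<Rightarrow> substitution" where
  "subst_of m f = \<lparr>protos = mark ` \<S>, factor = m, dissect = (\<lambda>t. f (supp t))\<rparr>"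

lemma is_substitution_subst_of:
  assumes "m > 1" and f: "\<And>X. X \<in> \<S> \<Longrightarrow> dissects (mark ` \<S>) ((\<lambda>z. m *\<^sub>R z) ` X) (f X)"
  shows "is_substitution (subst_of m f)"
  unfolding is_substitution_def
proof (intro conjI ballI allI impI)
  fix p assume "p \<in> protos (subst_of m f)"
  then obtain X where X: "X \<in> \<S>" "p = mark X"
    by (auto simp: subst_of_def)
  show "is_tile p"
    using X is_tile_mark by simp
  show "is_patch (dissect (subst_of m f) p)"
    "(\<Union>t\<in>dissect (subst_of m f) p. supp t) = (\<lambda>z. factor (subst_of m f) *\<^sub>R z) ` supp p"
    using f[OF X(1)] X(2) by (simp_all add: dissects_def subst_of_def)
  show "\<exists>q\<in>protos (subst_of m f). tile_equiv q t" if "t \<in> dissect (subst_of m f) p" for t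
    using f[OF X(1)] X(2) that by (simp add: dissects_def subst_of_def)
  fix q A b B c
  assume q: "q \<in> protos (subst_of m f)"
    and AB: "orthogonal_transformation A" "orthogonal_transformation B"
    and eq: "move (isom A b) p = move (isom B c) q"
  obtain Y where Y: "Y \<in> \<S>" "q = mark Y"
    using q by (auto simp: subst_of_def)
  note mark_move_eqD[OF X(1) Y(1) AB eq[unfolded X(2) Y(2)]]
  then show "move (isom A (factor (subst_of m f) *\<^sub>R b)) ` dissect (subst_of m f) p
      = move (isom B (factor (subst_of m f) *\<^sub>R c)) ` dissect (subst_of m f) q"
    using X(2) Y(2) by simp
qed (use assms(1) finite_shapes nonempty_shapes in \<open>auto simp: subst_of_def\<close>)

end

subsection \<open>Rectangles, right triangles and wedges\<close>

text \<open>Nonempty finite sums, so that 0 is excluded and positive generators give admissible side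
  lengths only.\<close>

inductive_set combos :: "real set \<Rightarrow> real set" for L where
  base: "l \<in> L \<Longrightarrow> l \<in> combos L"
| add: "x \<in> combos L \<Longrightarrow> y \<in> combos L \<Longrightarrow> x + y \<in> combos L"

definition rect :: "real \<Rightarrow> real \<Rightarrow> complex set" where
  "rect x y = {z. 0 \<le> Re z \<and> Re z \<le> x \<and> 0 \<le> Im z \<and> Im z \<le> y}"

text \<open>The right triangle with legs \<open>a\<close> and \<open>b\<close> on the coordinate
  axes.\<close>

definition tri :: "real \<Rightarrow> real \<Rightarrow> complex set" where
  "tri a b = {z. 0 \<le> Re z \<and> 0 \<le> Im z \<and> b * Re z + a * Im z \<le> a * b}"

text \<open>The isosceles triangle with apex 0, height \<open>r\<close> along the real axis and base
  of length \<open>2 * u\<close>.\<close>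

definition wedge :: "real \<Rightarrow> real \<Rightarrow> complex set" where
  "wedge r u = {z. Re z \<le> r \<and> r * \<bar>Im z\<bar> \<le> u * Re z}"

lemma scaleR_image_Collect:
  fixes m :: real
  assumes "m > 0"
  shows "(\<lambda>z. m *\<^sub>R z) ` X = {z. (1 / m) *\<^sub>R z \<in> (X :: complex set)}"
  using assms by (auto intro!: image_eqI[where x = "(1 / m) *\<^sub>R _"])

lemma scale_rect: "m > 0 \<Longrightarrow> (\<lambda>z. m *\<^sub>R z) ` rect x y = rect (m * x) (m * y)"
  by (subst scaleR_image_Collect) (auto simp: rect_def field_simps)

lemma scale_tri: "m > 0 \<Longrightarrow> (\<lambda>z. m *\<^sub>R z) ` tri a b = tri (m * a) (m * b)"
proof -
  assume m: "m > 0"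
  have "b * (x / m) + a * (y / m) \<le> a * b \<longleftrightarrow> (m * b) * x + (m * a) * y \<le> (m * a) * (m * b)" for x y
  proof -
    have "(m * b) * x + (m * a) * y = (m * m) * (b * (x / m) + a * (y / m))"
      using m by (simp add: field_simps)
    moreover have "(m * a) * (m * b) = (m * m) * (a * b)"
      by simp
    ultimately show ?thesis
      using m by (simp only: mult_le_cancel_left_pos[OF mult_pos_pos[OF m m]])
  qed
  then show ?thesis
    using m by (subst scaleR_image_Collect) (auto simp: tri_def zero_le_divide_iff)
qed

lemma scale_wedge: "m > 0 \<Longrightarrow> (\<lambda>z. m *\<^sub>R z) ` wedge r u = wedge (m * r) (m * u)"
proof -
  assume m: "m > 0"
  have "r * \<bar>y / m\<bar> \<le> u * (x / m) \<longleftrightarrow> (m * r) * \<bar>y\<bar> \<le> (m * u) * x" for x y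
  proof -
    have "(m * r) * \<bar>y\<bar> = (m * m) * (r * \<bar>y / m\<bar>)" "(m * u) * x = (m * m) * (u * (x / m))"
      using m by (simp_all add: field_simps)
    then show ?thesis
      using m by (simp only: mult_le_cancel_left_pos[OF mult_pos_pos[OF m m]])
  qed
  then show ?thesis
    using m by (subst scaleR_image_Collect) (auto simp: wedge_def field_simps)
qed

lemma interior_nonempty_if_ball:
  assumes "e > 0" "\<And>z. \<bar>Re z - Re c\<bar> \<le> e \<Longrightarrow> \<bar>Im z - Im c\<bar> \<le> e \<Longrightarrow> z \<in> X"
  shows "interior X \<noteq> {}"
proof -
  have "ball c e \<subseteq> X"
  proof
    fix z assume "z \<in> ball c e"
    then have "cmod (z - c) \<le> e"
      by (simp add: dist_norm norm_minus_commute)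
    then show "z \<in> X"
      using abs_Re_le_cmod[of "z - c"] abs_Im_le_cmod[of "z - c"] by (intro assms(2)) auto
  qed
  then show ?thesis
    using assms(1) by (metis centre_in_ball empty_iff interior_maximal open_ball subsetD)
qed

lemma bounded_if_box:
  assumes "\<And>z. z \<in> X \<Longrightarrow> \<bar>Re z\<bar> \<le> B \<and> \<bar>Im z\<bar> \<le> B"
  shows "bounded (X :: complex set)"
proof (rule boundedI)
  fix z assume "z \<in> X"
  then show "norm z \<le> B + B"
    using assms[of z] cmod_le[of z] by linarith
qed

lemma convex_halfplane: "convex {z. a * Re z + b * Im z \<le> c}"
  using convex_halfspace_le[of "Complex a b" c] by (simp add: inner_complex_def)

lemma closed_halfplane: "closed {z. a * Re z + b * Im z \<le> c}"
  using closed_halfspace_le[of "Complex a b" c] by (simp add: inner_complex_def)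

lemma rect_shape:
  assumes "x > 0" "y > 0"
  shows "compact (rect x y) \<and> convex (rect x y) \<and> interior (rect x y) \<noteq> {}"
proof (intro conjI)
  have eq: "rect x y = {z. -1 * Re z + 0 * Im z \<le> 0} \<inter> {z. 1 * Re z + 0 * Im z \<le> x}
      \<inter> {z. 0 * Re z + (-1) * Im z \<le> 0} \<inter> {z. 0 * Re z + 1 * Im z \<le> y}"
    by (auto simp: rect_def)
  show "convex (rect x y)"
    unfolding eq by (intro convex_Int convex_halfplane)
  have "closed (rect x y)"
    unfolding eq by (intro closed_Int closed_halfplane)
  moreover have "bounded (rect x y)"
    by (rule bounded_if_box[of _ "x + y"]) (use assms in \<open>auto simp: rect_def\<close>)
  ultimately show "compact (rect x y)"
    by (simp add: compact_eq_bounded_closed)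
  show "interior (rect x y) \<noteq> {}"
  proof (rule interior_nonempty_if_ball[of "min x y / 2" "Complex (x / 2) (y / 2)"])
    fix z assume "\<bar>Re z - Re (Complex (x / 2) (y / 2))\<bar> \<le> min x y / 2"
      "\<bar>Im z - Im (Complex (x / 2) (y / 2))\<bar> \<le> min x y / 2"
    moreover have "min x y / 2 \<le> x / 2" "min x y / 2 \<le> y / 2"
      by auto
    ultimately have "\<bar>Re z - x / 2\<bar> \<le> x / 2" "\<bar>Im z - y / 2\<bar> \<le> y / 2"
      unfolding complex.sel by linarith+
    then show "z \<in> rect x y"
      unfolding rect_def mem_Collect_eq by arith
  qed (use assms in simp)
qed

lemma tri_bounds:
  fixes a b x y :: real
  assumes "a > 0" "b > 0" "0 \<le> x" "0 \<le> y" "b * x + a * y \<le> a * b"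
  shows "x \<le> a" "y \<le> b"
proof -
  have "0 \<le> a * y" "0 \<le> b * x"
    using assms by simp_all
  then have "b * x \<le> b * a" "a * y \<le> a * b"
    using assms(5) unfolding mult.commute[of b a] by linarith+
  then show "x \<le> a" "y \<le> b"
    using assms by simp_all
qed

lemma tri_shape:
  assumes "a > 0" "b > 0"
  shows "compact (tri a b) \<and> convex (tri a b) \<and> interior (tri a b) \<noteq> {}"
proof (intro conjI)
  have eq: "tri a b = {z. -1 * Re z + 0 * Im z \<le> 0} \<inter> {z. 0 * Re z + (-1) * Im z \<le> 0}
      \<inter> {z. b * Re z + a * Im z \<le> a * b}"
    by (auto simp: tri_def)
  show "convex (tri a b)"
    unfolding eq by (intro convex_Int convex_halfplane)
  have "closed (tri a b)"
    unfolding eq by (intro closed_Int closed_halfplane)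
  moreover have "bounded (tri a b)"
  proof (rule bounded_if_box[of _ "a + b"])
    fix z assume z: "z \<in> tri a b"
    then have "Re z \<le> a" "Im z \<le> b"
      using tri_bounds[of a b "Re z" "Im z"] assms by (simp_all add: tri_def)
    then show "\<bar>Re z\<bar> \<le> a + b \<and> \<bar>Im z\<bar> \<le> a + b"
      using z assms by (simp add: tri_def)
  qed
  ultimately show "compact (tri a b)"
    by (simp add: compact_eq_bounded_closed)
  show "interior (tri a b) \<noteq> {}"
  proof (rule interior_nonempty_if_ball[of "min a b / 4" "Complex (min a b / 4) (min a b / 4)"])
    let ?e = "min a b / 4"
    show "?e > 0"
      using assms by simp
    fix z assume z: "\<bar>Re z - Re (Complex ?e ?e)\<bar> \<le> ?e" "\<bar>Im z - Im (Complex ?e ?e)\<bar> \<le> ?e"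
    moreover have "?e \<le> a / 4" "?e \<le> b / 4"
      by auto
    ultimately have "0 \<le> Re z" "0 \<le> Im z" "Re z \<le> a / 2" "Im z \<le> b / 2"
      unfolding complex.sel by linarith+
    then have "b * Re z + a * Im z \<le> b * (a / 2) + a * (b / 2)"
      using assms by (intro add_mono mult_left_mono) auto
    then show "z \<in> tri a b"
      using \<open>0 \<le> Re z\<close> \<open>0 \<le> Im z\<close> by (simp add: tri_def)
  qed
qed

lemma wedge_shape:
  assumes "r > 0" "u > 0"
  shows "compact (wedge r u) \<and> convex (wedge r u) \<and> interior (wedge r u) \<noteq> {}"
proof (intro conjI)
  have eq: "wedge r u = {z. 1 * Re z + 0 * Im z \<le> r} \<inter> {z. (-u) * Re z + r * Im z \<le> 0}
      \<inter> {z. (-u) * Re z + (-r) * Im z \<le> 0}"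
  proof -
    have "r * \<bar>y\<bar> = \<bar>r * y\<bar>" for y
      using assms by (simp add: abs_mult)
    then show ?thesis
      by (auto simp: wedge_def abs_le_iff)
  qed
  show "convex (wedge r u)"
    unfolding eq by (intro convex_Int convex_halfplane)
  have "closed (wedge r u)"
    unfolding eq by (intro closed_Int closed_halfplane)
  moreover have "bounded (wedge r u)"
  proof (rule bounded_if_box[of _ "r + u"])
    fix z assume z: "z \<in> wedge r u"
    have "0 \<le> r * \<bar>Im z\<bar>"
      using assms by simp
    then have "0 \<le> u * Re z"
      using z by (auto simp: wedge_def)
    then have re: "0 \<le> Re z" "Re z \<le> r"
      using z assms by (auto simp: wedge_def zero_le_mult_iff)
    then have "u * Re z \<le> u * r"
      using assms by simp
    then have "r * \<bar>Im z\<bar> \<le> r * u"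
      using z by (auto simp: wedge_def mult.commute)
    then have "\<bar>Im z\<bar> \<le> u"
      using assms by simp
    then show "\<bar>Re z\<bar> \<le> r + u \<and> \<bar>Im z\<bar> \<le> r + u"
      using re assms by simp
  qed
  ultimately show "compact (wedge r u)"
    by (simp add: compact_eq_bounded_closed)
  show "interior (wedge r u) \<noteq> {}"
  proof (rule interior_nonempty_if_ball[of "min r u / 4" "Complex (r / 2) 0"])
    show "min r u / 4 > 0"
      using assms by simp
    fix z assume z: "\<bar>Re z - Re (Complex (r / 2) 0)\<bar> \<le> min r u / 4" "\<bar>Im z - Im (Complex (r / 2) 0)\<bar> \<le> min r u / 4"
    moreover have "min r u / 4 \<le> r / 4" "min r u / 4 \<le> u / 4"
      by auto
    ultimately have z': "r / 4 \<le> Re z" "Re z \<le> r" "\<bar>Im z\<bar> \<le> u / 4"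
      using assms unfolding complex.sel by linarith+
    have "r * \<bar>Im z\<bar> \<le> r * (u / 4)" "u * (r / 4) \<le> u * Re z"
      using z' assms by simp_all
    moreover have "r * (u / 4) = u * (r / 4)"
      by simp
    ultimately have "r * \<bar>Im z\<bar> \<le> u * Re z"
      by linarith
    then show "z \<in> wedge r u"
      using z' by (simp add: wedge_def)
  qed
qed

text \<open>The regular \<open>N\<close>-gon around 0 with inradius \<open>r\<close>, one of whose
  edges is perpendicular to the real axis.\<close>

definition ngon :: "nat \<Rightarrow> real \<Rightarrow> complex set" where
  "ngon N r = {z. \<forall>i<N. Re (z * cis (- (2 * pi * real i / real N))) \<le> r}"

text \<open>The wedge consists of the points of the polygon for which the constraint of the edge with
  outer normal \<open>1\<close> is the most critical one.\<close>

lemma wedge_eq: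
  assumes N: "N \<ge> 3" and r: "r > 0" and u: "u = r * tan (pi / real N)"
  shows "wedge r u = {z. Re z \<le> r \<and> (\<forall>i<N. Re (z * cis (- (2 * pi * real i / real N))) \<le> Re z)}"
proof -
  let ?t = "pi / real N"
  have t: "0 < ?t" "?t < pi / 2"
    using N by (auto simp: field_simps)
  have ct: "cos ?t > 0" and st: "sin ?t > 0"
    using t by (auto intro!: cos_gt_zero sin_gt_zero2)
  \<comment> \<open>The double angle formulas factor the difference between the constraints of the
    edges 0 and \<open>i\<close>, so that comparing them becomes a matter of signs.\<close>
  have re: "Re (z * cis (- (2 * pi * real i / real N)))
      = Re z - 2 * sin (i * ?t) * (sin (i * ?t) * Re z - cos (i * ?t) * Im z)" for z i
  proof -
    have "Re (z * cis (- a)) = Re z * cos a + Im z * sin a" for a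
      by simp
    moreover have "2 * pi * real i / real N = 2 * (i * ?t)"
      by simp
    ultimately have "Re (z * cis (- (2 * pi * real i / real N)))
        = Re z * cos (2 * (i * ?t)) + Im z * sin (2 * (i * ?t))"
      by (simp only:)
    also have "\<dots> = Re z * (1 - 2 * (sin (i * ?t))\<^sup>2) + Im z * (2 * sin (i * ?t) * cos (i * ?t))"
      by (simp only: cos_double_sin sin_double)
    finally show ?thesis
      by (simp add: power2_eq_square algebra_simps)
  qed
  have key: "r * \<bar>Im z\<bar> \<le> u * Re z \<longleftrightarrow> cos ?t * \<bar>Im z\<bar> \<le> sin ?t * Re z" for z
  proof -
    have "r * \<bar>Im z\<bar> \<le> u * Re z \<longleftrightarrow> \<bar>Im z\<bar> \<le> tan ?t * Re z"
      unfolding u mult.assoc using r by simp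
    also have "\<dots> \<longleftrightarrow> cos ?t * \<bar>Im z\<bar> \<le> sin ?t * Re z"
      using ct by (simp add: tan_def field_simps)
    finally show ?thesis .
  qed
  have "cos ?t * \<bar>Im z\<bar> \<le> sin ?t * Re z
      \<longleftrightarrow> (\<forall>i<N. Re (z * cis (- (2 * pi * real i / real N))) \<le> Re z)" (is "?L \<longleftrightarrow> ?R") for z
  proof
    assume R: ?R
    \<comment> \<open>The two neighbouring edges, with indices 1 and \<open>N - 1\<close>, yield the
      two slanted sides of the wedge.\<close>
    have "sin ?t * (sin ?t * Re z - cos ?t * Im z) \<ge> 0"
      using R[rule_format, of 1] N re[of z 1] by simp
    then have 1: "cos ?t * Im z \<le> sin ?t * Re z"
      using st by (simp add: zero_le_mult_iff)
    have "real (N - 1) * ?t = pi - ?t"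
      using N by (simp add: field_simps of_nat_diff)
    then have "sin ?t * (sin ?t * Re z + cos ?t * Im z) \<ge> 0"
      using R[rule_format, of "N - 1"] N re[of z "N - 1"] by simp
    then have "- (cos ?t * Im z) \<le> sin ?t * Re z"
      using st by (simp add: zero_le_mult_iff)
    with 1 show ?L
      using ct by (auto simp: abs_if)
  next
    assume L: ?L
    show ?R
    proof (intro allI impI)
      fix i assume i: "i < N"
      show "Re (z * cis (- (2 * pi * real i / real N))) \<le> Re z"
      proof (cases "i = 0")
        case False
        let ?s = "i * ?t"
        have s: "?t \<le> ?s" "?s \<le> pi - ?t"
        proof -
          have "1 * ?t \<le> ?s"
            using False t by (intro mult_right_mono) auto
          then show "?t \<le> ?s"
            by simp
          have "real i + 1 \<le> real N"
            using i by linarith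
          then have "(real i + 1) * ?t \<le> real N * ?t"
            using t by (intro mult_right_mono) auto
          moreover have "(real i + 1) * ?t = ?s + ?t" "real N * ?t = pi"
            using N by (simp_all only: distrib_right mult_1) simp
          ultimately show "?s \<le> pi - ?t"
            by linarith
        qed
        have ss: "sin ?s \<ge> 0"
          using s t by (intro sin_ge_zero) auto
        have "sin (?s - ?t) \<ge> 0" "sin (?s + ?t) \<ge> 0"
          using s t by (auto intro!: sin_ge_zero)
        \<comment> \<open>In other words, the cotangent of \<open>?s\<close> is bounded by that of
          \<open>?t\<close> in absolute value: the neighbouring edges impose the strongest
          conditions.\<close>
        then have "\<bar>cos ?s\<bar> * sin ?t \<le> sin ?s * cos ?t"
          by (auto simp: sin_diff sin_add abs_if mult.commute)
        have "Re z \<ge> 0"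
        proof -
          have "0 \<le> cos ?t * \<bar>Im z\<bar>"
            using ct by simp
          then have "0 \<le> sin ?t * Re z"
            using L by linarith
          then show ?thesis
            using st by (simp add: zero_le_mult_iff)
        qed
        have "cos ?t * (cos ?s * Im z) \<le> \<bar>cos ?s\<bar> * (cos ?t * \<bar>Im z\<bar>)"
          using ct by (simp add: abs_mult[symmetric] mult.left_commute)
        also have "\<dots> \<le> \<bar>cos ?s\<bar> * (sin ?t * Re z)"
          using L by (intro mult_left_mono) auto
        also have "\<dots> \<le> (sin ?s * cos ?t) * Re z"
          using \<open>\<bar>cos ?s\<bar> * sin ?t \<le> sin ?s * cos ?t\<close> \<open>Re z \<ge> 0\<close>
          by (simp add: mult.assoc[symmetric] mult_right_mono)
        finally have "cos ?s * Im z \<le> sin ?s * Re z"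
          using ct by (simp add: mult_ac)
        then have "sin ?s * (sin ?s * Re z - cos ?s * Im z) \<ge> 0"
          using ss by simp
        then show ?thesis
          unfolding re by linarith
      qed simp
    qed
  qed
  then show ?thesis
    unfolding wedge_def key by blast
qed

lemma image_eq_preimage:
  assumes "\<And>z. f (g z) = z" "\<And>z. g (f z) = z"
  shows "f ` X = {z. g z \<in> X}"
  using assms by (auto intro: rev_image_eqI)

lemma isom_reflect_image:
  "isom (\<lambda>z. -1 * cnj z) c ` X = {z. Complex (Re c - Re z) (Im z - Im c) \<in> X}"
  by (rule image_eq_preimage) (simp_all add: isom_def complex_eq_iff)

lemma isom_halfturn_image: "isom (\<lambda>z. -1 * z) c ` X = {z. Complex (Re c - Re z) (Im c - Im z) \<in> X}"
  by (rule image_eq_preimage) (simp_all add: isom_def complex_eq_iff)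

lemma isom_cnj_image: "isom (\<lambda>z. 1 * cnj z) c ` X = {z. Complex (Re z - Re c) (Im c - Im z) \<in> X}"
  by (rule image_eq_preimage) (simp_all add: isom_def complex_eq_iff)

lemma isom_translate_image: "isom (\<lambda>z. z) c ` X = {z. z - c \<in> X}"
  by (rule image_eq_preimage) (simp_all add: isom_def)

text \<open>A rectangle without its four corner triangles, listed counterclockwise from the lower
  left one; each has the horizontal leg \<open>p\<close> and the vertical leg
  \<open>q\<close>.\<close>

definition framed :: "real \<Rightarrow> real \<Rightarrow> real \<Rightarrow> real \<Rightarrow> real \<Rightarrow> real \<Rightarrow> real \<Rightarrow> real \<Rightarrow> real \<Rightarrow> real \<Rightarrow> complex set" where
  "framed w h p1 q1 p2 q2 p3 q3 p4 q4 = {z. z \<in> rect w h \<and>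
     p1 * q1 \<le> q1 * Re z + p1 * Im z \<and> p2 * q2 \<le> q2 * (w - Re z) + p2 * Im z \<and>
     p3 * q3 \<le> q3 * (w - Re z) + p3 * (h - Im z) \<and> p4 * q4 \<le> q4 * Re z + p4 * (h - Im z)}"

section \<open>Straight cuts of rectangles and triangles\<close>

context marked_shapes
begin

lemma fits_cut:
  assumes "fits F T" "fits G R'" "R = T \<union> R'"
    and "\<And>z. z \<in> T \<Longrightarrow> a * Re z + b * Im z \<le> c" "\<And>z. z \<in> R' \<Longrightarrow> a * Re z + b * Im z \<ge> c"
    and "a \<noteq> 0 \<or> b \<noteq> 0"
  shows "fits (F \<union> G) R"
  unfolding assms(3) by (rule fits_Un[OF assms(1,2) separated_interiors[OF assms(4-6)]])

text \<open>A reflection, a half turn and the complex conjugation carry the triangle at the lower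
  left corner to the lower right, upper right and upper left corners of a rectangle.\<close>

lemma fits_tri_corners:
  assumes "fits {} (tri a b)"
  shows "fits {} {z. Re z \<le> w \<and> 0 \<le> Im z \<and> b * (w - Re z) + a * Im z \<le> a * b}"
    and "fits {} {z. Re z \<le> w \<and> Im z \<le> h \<and> b * (w - Re z) + a * (h - Im z) \<le> a * b}"
    and "fits {} {z. 0 \<le> Re z \<and> Im z \<le> h \<and> b * Re z + a * (h - Im z) \<le> a * b}"
proof -
  have *: "fits {} (isom A c ` tri a b)" if "orthogonal_transformation A" for A c
    using fits_move[OF that assms] by simp
  show "fits {} {z. Re z \<le> w \<and> 0 \<le> Im z \<and> b * (w - Re z) + a * Im z \<le> a * b}"
    using *[OF orth_mult_cnj[of "-1"], of "Complex w 0"] unfolding isom_reflect_image by (simp add: tri_def)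
  show "fits {} {z. Re z \<le> w \<and> Im z \<le> h \<and> b * (w - Re z) + a * (h - Im z) \<le> a * b}"
    using *[OF orth_mult[of "-1"], of "Complex w h"] unfolding isom_halfturn_image by (simp add: tri_def)
  show "fits {} {z. 0 \<le> Re z \<and> Im z \<le> h \<and> b * Re z + a * (h - Im z) \<le> a * b}"
    using *[OF orth_mult_cnj[of 1], of "Complex 0 h"] unfolding isom_cnj_image by (simp add: tri_def)
qed

text \<open>The corners are cut off one after the other. There is one condition in
  \<open>room\<close> for each pair of corners, separating the two triangles horizontally or
  vertically, so each triangle is intact when its turn comes.\<close>

lemma fits_frame:
  assumes pos: "p1 > 0" "q1 > 0" "p2 > 0" "q2 > 0" "p3 > 0" "q3 > 0" "p4 > 0" "q4 > 0"
    and room: "p1 + p2 \<le> w" "p3 + p4 \<le> w" "p1 + p3 \<le> w" "q2 + q3 \<le> h" "q1 + q4 \<le> h" "q2 + q4 \<le> h"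
    and tri: "fits {} (tri p1 q1)" "fits {} (tri p2 q2)" "fits {} (tri p3 q3)" "fits {} (tri p4 q4)"
    and F: "fits F (framed w h p1 q1 p2 q2 p3 q3 p4 q4)"
  shows "fits F (rect w h)"
proof -
  let ?T2 = "{z. Re z \<le> w \<and> 0 \<le> Im z \<and> q2 * (w - Re z) + p2 * Im z \<le> p2 * q2}"
  let ?T3 = "{z. Re z \<le> w \<and> Im z \<le> h \<and> q3 * (w - Re z) + p3 * (h - Im z) \<le> p3 * q3}"
  let ?T4 = "{z. 0 \<le> Re z \<and> Im z \<le> h \<and> q4 * Re z + p4 * (h - Im z) \<le> p4 * q4}"
  let ?c1 = "\<lambda>z. p1 * q1 \<le> q1 * Re z + p1 * Im z"
  let ?c2 = "\<lambda>z. p2 * q2 \<le> q2 * (w - Re z) + p2 * Im z"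
  let ?c3 = "\<lambda>z. p3 * q3 \<le> q3 * (w - Re z) + p3 * (h - Im z)"
  let ?c4 = "\<lambda>z. p4 * q4 \<le> q4 * Re z + p4 * (h - Im z)"
  define R1 where "R1 = {z \<in> rect w h. ?c1 z}"
  define R2 where "R2 = {z \<in> R1. ?c2 z}"
  define R3 where "R3 = {z \<in> R2. ?c3 z}"
  define R4 where "R4 = {z \<in> R3. ?c4 z}"
  have R4: "R4 = framed w h p1 q1 p2 q2 p3 q3 p4 q4"
    by (auto simp: R1_def R2_def R3_def R4_def framed_def)
  have c1: "?c1 z" if "p1 \<le> Re z \<and> 0 \<le> Im z \<or> q1 \<le> Im z \<and> 0 \<le> Re z" for z
    using that
  proof
    assume "p1 \<le> Re z \<and> 0 \<le> Im z"
    then have "q1 * p1 \<le> q1 * Re z" "0 \<le> p1 * Im z"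
      using pos by simp_all
    then show ?thesis
      by (simp add: mult.commute)
  next
    assume "q1 \<le> Im z \<and> 0 \<le> Re z"
    then have "p1 * q1 \<le> p1 * Im z" "0 \<le> q1 * Re z"
      using pos by simp_all
    then show ?thesis
      by simp
  qed
  have c2: "?c2 z" if "q2 \<le> Im z" "Re z \<le> w" for z
  proof -
    have "p2 * q2 \<le> p2 * Im z" "0 \<le> q2 * (w - Re z)"
      using pos that by simp_all
    then show ?thesis
      by simp
  qed
  have c3: "?c3 z" if "Re z \<le> w - p3" "Im z \<le> h" for z
  proof -
    have "q3 * p3 \<le> q3 * (w - Re z)" "0 \<le> p3 * (h - Im z)"
      using pos that by simp_all
    then show ?thesis
      by (simp add: mult.commute)
  qed
  have T1: "Re z \<le> p1 \<and> Im z \<le> q1" if "z \<in> tri p1 q1" for z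
    using tri_bounds[OF pos(1,2), of "Re z" "Im z"] that by (simp add: tri_def)
  have T2: "w - p2 \<le> Re z \<and> Im z \<le> q2" if "z \<in> ?T2" for z
    using tri_bounds[OF pos(3,4), of "w - Re z" "Im z"] that by simp
  have T3: "w - p3 \<le> Re z \<and> h - q3 \<le> Im z" if "z \<in> ?T3" for z
    using tri_bounds[OF pos(5,6), of "w - Re z" "h - Im z"] that by simp
  have T4: "Re z \<le> p4 \<and> h - q4 \<le> Im z" if "z \<in> ?T4" for z
    using tri_bounds[OF pos(7,8), of "Re z" "h - Im z"] that by simp
  have T1_sub: "tri p1 q1 \<subseteq> rect w h"
  proof
    fix z assume z: "z \<in> tri p1 q1"
    then show "z \<in> rect w h"
      using T1[OF z] pos room by (simp add: tri_def rect_def)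
  qed
  have T2_sub: "?T2 \<subseteq> R1"
  proof
    fix z assume z: "z \<in> ?T2"
    then show "z \<in> R1"
      using T2[OF z] c1[of z] pos room by (simp add: R1_def rect_def)
  qed
  have T3_sub: "?T3 \<subseteq> R2"
  proof
    fix z assume z: "z \<in> ?T3"
    then show "z \<in> R2"
      using T3[OF z] c1[of z] c2[of z] pos room by (simp add: R1_def R2_def rect_def)
  qed
  have T4_sub: "?T4 \<subseteq> R3"
  proof
    fix z assume z: "z \<in> ?T4"
    then show "z \<in> R3"
      using T4[OF z] c1[of z] c2[of z] c3[of z] pos room by (simp add: R1_def R2_def R3_def rect_def)
  qed
  have rect: "R1 \<subseteq> rect w h" "R2 \<subseteq> rect w h" "R3 \<subseteq> rect w h"
    by (auto simp: R1_def R2_def R3_def)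
  have "fits ({} \<union> F) R3"
  proof (rule fits_cut[OF fits_tri_corners(3)[OF tri(4)] F[folded R4],
        where a = q4 and b = "- p4" and c = "p4 * q4 - p4 * h"])
    show "R3 = ?T4 \<union> R4"
      using T4_sub rect(3) by (auto simp: R4_def rect_def)
  qed (use pos in \<open>auto simp: R4_def algebra_simps\<close>)
  then have 3: "fits F R3"
    by simp
  have "fits ({} \<union> F) R2"
  proof (rule fits_cut[OF fits_tri_corners(2)[OF tri(3)] 3,
        where a = "- q3" and b = "- p3" and c = "p3 * q3 - p3 * h - q3 * w"])
    show "R2 = ?T3 \<union> R3"
      using T3_sub rect(2) by (auto simp: R3_def rect_def)
  qed (use pos in \<open>auto simp: R3_def algebra_simps\<close>)
  then have 2: "fits F R2"
    by simp
  have "fits ({} \<union> F) R1"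
  proof (rule fits_cut[OF fits_tri_corners(1)[OF tri(2)] 2,
        where a = "- q2" and b = p2 and c = "p2 * q2 - q2 * w"])
    show "R1 = ?T2 \<union> R2"
      using T2_sub rect(1) by (auto simp: R2_def rect_def)
  qed (use pos in \<open>auto simp: R2_def algebra_simps\<close>)
  then have 1: "fits F R1"
    by simp
  have "fits ({} \<union> F) (rect w h)"
  proof (rule fits_cut[OF tri(1) 1, where a = q1 and b = p1 and c = "p1 * q1"])
    show "rect w h = tri p1 q1 \<union> R1"
      using T1_sub by (auto simp: R1_def rect_def tri_def)
  qed (use pos in \<open>auto simp: R1_def tri_def\<close>)
  then show ?thesis
    by simp
qed

lemma fits_rect_horizontal:
  assumes "fits F (rect x y)" "fits G (rect x' y)" "x \<ge> 0" "x' \<ge> 0"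
  shows "fits (F \<union> move (isom (\<lambda>z. z) (of_real x)) ` G) (rect (x + x') y)"
proof (rule fits_cut[where a = 1 and b = 0 and c = x])
  show "fits (move (isom (\<lambda>z. z) (of_real x)) ` G) (isom (\<lambda>z. z) (of_real x) ` rect x' y)"
    by (rule fits_move[OF orthogonal_transformation_id assms(2)])
qed (use assms in \<open>auto simp: isom_translate_image rect_def\<close>)

lemma fits_rect_vertical:
  assumes "fits F (rect x y)" "fits G (rect x y')" "y \<ge> 0" "y' \<ge> 0"
  shows "fits (F \<union> move (isom (\<lambda>z. z) (Complex 0 y)) ` G) (rect x (y + y'))"
proof (rule fits_cut[where a = 0 and b = 1 and c = y])
  show "fits (move (isom (\<lambda>z. z) (Complex 0 y)) ` G) (isom (\<lambda>z. z) (Complex 0 y) ` rect x y')"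
    by (rule fits_move[OF orthogonal_transformation_id assms(2)])
qed (use assms in \<open>auto simp: isom_translate_image rect_def\<close>)

text \<open>From a point of the hypotenuse, cuts parallel to the legs leave a rectangle in the
  right-angled corner and two similar triangles of scales \<open>x\<close> (above) and
  \<open>y\<close> (to the right).\<close>

lemma fits_tri_split:
  assumes "fits {} (tri (x * a) (x * b))" "fits {} (tri (y * a) (y * b))" "fits F (rect (x * a) (y * b))"
    and pos: "x > 0" "y > 0" "a > 0" "b > 0"
  shows "fits F (tri ((x + y) * a) ((x + y) * b))"
proof -
  have cond: "((x + y) * b) * s + ((x + y) * a) * t \<le> ((x + y) * a) * ((x + y) * b) \<longleftrightarrow> b * s + a * t \<le> (x + y) * a * b"
    if "x + y > 0" for x y s t
  proof -
    have "((x + y) * b) * s + ((x + y) * a) * t = (x + y) * (b * s + a * t)"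
      "((x + y) * a) * ((x + y) * b) = (x + y) * ((x + y) * a * b)"
      by (simp_all add: algebra_simps)
    then show ?thesis
      using that by (simp only: mult_le_cancel_left_pos)
  qed
  let ?T = "tri ((x + y) * a) ((x + y) * b)"
  have T: "?T = {z. 0 \<le> Re z \<and> 0 \<le> Im z \<and> b * Re z + a * Im z \<le> (x + y) * a * b}"
    using pos by (simp add: tri_def cond)
  have t: "tri (s * a) (s * b) = {z. 0 \<le> Re z \<and> 0 \<le> Im z \<and> b * Re z + a * Im z \<le> s * a * b}" if "s > 0" for s
    using cond[of s 0] that by (simp add: tri_def)
  let ?U = "isom (\<lambda>z. z) (Complex 0 (y * b)) ` tri (x * a) (x * b)"
  let ?V = "isom (\<lambda>z. z) (Complex (x * a) 0) ` tri (y * a) (y * b)"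
  have U: "?U = {z. 0 \<le> Re z \<and> y * b \<le> Im z \<and> b * Re z + a * Im z \<le> (x + y) * a * b}"
    unfolding isom_translate_image t[OF pos(1)] by (auto simp: algebra_simps)
  have V: "?V = {z. x * a \<le> Re z \<and> 0 \<le> Im z \<and> b * Re z + a * Im z \<le> (x + y) * a * b}"
    unfolding isom_translate_image t[OF pos(2)] by (auto simp: algebra_simps)
  have le_x: "s \<le> x * a" if "y * b \<le> t" "b * s + a * t \<le> (x + y) * a * b" for s t
  proof -
    have "a * (y * b) \<le> a * t"
      using that pos by simp
    then have "b * s \<le> b * (x * a)"
      using that by (simp add: algebra_simps)
    then show ?thesis
      using pos by simp
  qed
  have le_y: "t \<le> y * b" if "x * a \<le> s" "b * s + a * t \<le> (x + y) * a * b" for s t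
  proof -
    have "b * (x * a) \<le> b * s"
      using that pos by simp
    then have "a * t \<le> a * (y * b)"
      using that by (simp add: algebra_simps)
    then show ?thesis
      using pos by simp
  qed
  have in_T: "b * s + a * t \<le> (x + y) * a * b" if "s \<le> x * a" "t \<le> y * b" for s t
  proof -
    have "b * s \<le> b * (x * a)" "a * t \<le> a * (y * b)"
      using that pos by simp_all
    then show ?thesis
      by (simp add: algebra_simps)
  qed
  have xa: "0 \<le> x * a" "0 \<le> y * b"
    using pos by simp_all
  let ?R = "{z \<in> ?T. Im z \<le> y * b}"
  have U': "fits {} ?U" and V': "fits {} ?V"
    using fits_move[OF orthogonal_transformation_id assms(1)]
      fits_move[OF orthogonal_transformation_id assms(2)] by simp_all
  have "fits (F \<union> {}) ?R"
  proof (rule fits_cut[OF assms(3) V', where a = 1 and b = 0 and c = "x * a"])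
    show "?R = rect (x * a) (y * b) \<union> ?V"
      using le_y in_T xa unfolding T V by (auto simp: rect_def)
  qed (unfold V, auto simp: rect_def)
  then have "fits (F \<union> {} \<union> {}) ?T"
  proof (rule fits_cut[OF _ U', where a = 0 and b = 1 and c = "y * b"])
    show "?T = ?R \<union> ?U"
      using xa unfolding T U by auto
  qed (unfold U, auto)
  then show ?thesis
    by simp
qed

end

subsection \<open>The substitution\<close>

text \<open>Lengths from which a unit can be cut off, leaving nothing or another length. The number
  1 is inserted separately since \<open>combos\<close> lacks 0.\<close>

definition one_more :: "real set \<Rightarrow> real set" where
  "one_more L = insert 1 ((\<lambda>x. 1 + x) ` combos L)"

text \<open>What one has to supply for each \<open>N\<close>: generators whose products are again
  sums of generators, a multiplier \<mu> giving each length a unit to spare, and a rectangle in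
  which four corner triangles leave a regular \<open>N\<close>-gon centred at \<open>c\<close>. The
  figure is symmetric about a horizontal line, hence only two kinds of corners.\<close>

locale star_gadget =
  fixes L :: "real set" and \<mu> :: real and N :: nat and r u w h p1 q1 p2 q2 :: real and c :: complex
  assumes finite_L: "finite L" and L_pos: "\<And>l. l \<in> L \<Longrightarrow> l > 0" and one_L: "1 \<in> L"
    and L_mult: "\<And>l m. l \<in> L \<Longrightarrow> m \<in> L \<Longrightarrow> l * m \<in> combos L"
    and mu: "\<mu> \<in> combos L" "\<And>l. l \<in> L \<Longrightarrow> \<mu> * l \<in> one_more L"
    and N: "N \<ge> 3"
    and combos: "r \<in> combos L" "u \<in> combos L" "w \<in> combos L" "h \<in> combos L"
      "p1 \<in> combos L" "q1 \<in> combos L" "p2 \<in> combos L" "q2 \<in> combos L"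
    and tan: "u = r * tan (pi / real N)"
    and room: "p1 + p2 \<le> w" "2 * q1 \<le> h" "2 * q2 \<le> h" "q1 + q2 \<le> h"
    and frame: "\<And>z. z \<in> framed w h p1 q1 p2 q2 p2 q2 p1 q1 \<longleftrightarrow> z - c \<in> ngon N r"
begin

lemma combos_pos: "x \<in> combos L \<Longrightarrow> x > 0"
  by (induction rule: combos.induct) (auto simp: L_pos)

lemma combos_mult: "x \<in> combos L \<Longrightarrow> y \<in> combos L \<Longrightarrow> x * y \<in> combos L"
proof (induction rule: combos.induct)
  case (base l)
  show ?case
    using base(2,1)
  proof (induction rule: combos.induct)
    case (base m)
    then show ?case
      using L_mult by blast
  next
    case (add x y)
    then show ?case
      by (simp add: distrib_left combos.add)
  qed
qed (simp add: distrib_right combos.add)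

lemma one_combos: "1 \<in> combos L"
  by (rule combos.base[OF one_L])

lemma numeral_combos: "numeral k \<in> combos L"
proof -
  have "real (Suc n) \<in> combos L" for n
  proof (induction n)
    case (Suc n)
    then show ?case
      using combos.add[OF one_combos Suc] by simp
  qed (simp add: one_combos)
  from this[of "pred_numeral k"] show ?thesis
    by (simp only: numeral_eq_Suc[symmetric] of_nat_numeral)
qed

lemma one_more_add: "x \<in> one_more L \<Longrightarrow> y \<in> combos L \<Longrightarrow> x + y \<in> one_more L"
  by (auto simp: one_more_def add.assoc intro: combos.add)

lemma mu_mult: "x \<in> combos L \<Longrightarrow> \<mu> * x \<in> one_more L"
proof (induction rule: combos.induct)
  case (add x y)
  then show ?case
    using one_more_add[OF add(3) combos_mult[OF mu(1) add(2)]] by (simp add: distrib_left)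
qed (rule mu(2))

text \<open>Leg pairs: 3 and 4 for the corners around the tilted square, \<open>r\<close> and
  \<open>u\<close> for half a wedge, and the others for the corners around the polygon.\<close>

definition dims :: "(real \<times> real) set" where
  "dims = {(3, 4), (4, 3), (r, u), (p1, q1), (p2, q2)}"

text \<open>The triangles come in all scales from \<open>L\<close>, so that repeated splitting
  reaches every scale in \<open>combos L\<close>.\<close>

definition shapes :: "complex set set" where
  "shapes = (\<lambda>(l, m). rect l m) ` (L \<times> L)
     \<union> (\<lambda>(l, a, b). tri (l * a) (l * b)) ` (L \<times> dims) \<union> {wedge r u}"

lemma dims: "(a, b) \<in> dims \<Longrightarrow> a \<in> combos L \<and> b \<in> combos L"
  using combos numeral_combos by (auto simp: dims_def)

sublocale marked_shapes shapes
proof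
  show "finite shapes"
    by (simp add: shapes_def dims_def finite_L)
  show "shapes \<noteq> {}"
    by (simp add: shapes_def)
  fix X assume "X \<in> shapes"
  then consider l m where "l \<in> L" "m \<in> L" "X = rect l m"
    | l a b where "l \<in> L" "(a, b) \<in> dims" "X = tri (l * a) (l * b)" | "X = wedge r u"
    unfolding shapes_def by auto
  then show "compact X \<and> convex X \<and> interior X \<noteq> {}"
  proof cases
    case 1
    then show ?thesis
      using rect_shape L_pos by simp
  next
    case 2
    then show ?thesis
      using dims[of a b] by (simp add: tri_shape L_pos combos_pos)
  next
    case 3
    then show ?thesis
      using wedge_shape combos combos_pos by simp
  qed
qed

section \<open>Finding room for a unit square\<close>

abbreviation "square \<equiv> rect 1 1"

lemma shapes_rect: "l \<in> L \<Longrightarrow> m \<in> L \<Longrightarrow> rect l m \<in> shapes"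
  and shapes_tri: "l \<in> L \<Longrightarrow> (a, b) \<in> dims \<Longrightarrow> tri (l * a) (l * b) \<in> shapes"
  and shapes_wedge: "wedge r u \<in> shapes"
  by (force simp: shapes_def)+

lemma fits_weaken: "fits F X \<Longrightarrow> fits {} X"
  by (rule fits_mono) auto

lemma fits_rect: "x \<in> combos L \<Longrightarrow> y \<in> combos L \<Longrightarrow> fits {} (rect x y)"
proof (induction rule: combos.induct)
  case (base l)
  show ?case
    using base(2,1)
  proof (induction rule: combos.induct)
    case (base m)
    then show ?case
      using fits_weaken[OF fits_shape[OF shapes_rect]] by blast
  next
    case (add y y')
    then show ?case
      using fits_rect_vertical[of "{}" l y "{}" y'] combos_pos[of y] combos_pos[of y'] by simp
  qed
next
  case (add x x')
  then show ?case
    using fits_rect_horizontal[of "{}" x y "{}" x'] combos_pos[of x] combos_pos[of x'] by simp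
qed

text \<open>The unit square stays in the corner at 0, and what remains consists of rectangles with
  sides in \<open>combos L\<close>.\<close>

lemma fits_square:
  assumes F: "fits F square" and x: "x \<in> one_more L" and y: "y \<in> one_more L"
  shows "fits F (rect x y)"
proof -
  have 1: "fits F (rect x 1)"
  proof (cases "x = 1")
    case False
    then obtain x' where x': "x' \<in> combos L" "x = 1 + x'"
      using x by (auto simp: one_more_def)
    then show ?thesis
      using fits_rect_horizontal[OF F fits_rect[OF x'(1) one_combos]] combos_pos[of x'] by simp
  qed (simp add: F)
  have "x \<in> combos L"
    using x one_combos by (auto simp: one_more_def intro: combos.add)
  show ?thesis
  proof (cases "y = 1")
    case False
    then obtain y' where y': "y' \<in> combos L" "y = 1 + y'"
      using y by (auto simp: one_more_def)
    then show ?thesis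
      using fits_rect_vertical[OF 1 fits_rect[OF \<open>x \<in> combos L\<close> y'(1)]] combos_pos[of y'] by simp
  qed (simp add: 1)
qed

lemma fits_tri:
  assumes ab: "(a, b) \<in> dims" and x: "x \<in> combos L"
  shows "fits {} (tri (x * a) (x * b))"
  using x
proof (induction rule: combos.induct)
  case (base l)
  then show ?case
    using fits_weaken[OF fits_shape[OF shapes_tri[OF _ ab]]] by blast
next
  case (add x y)
  then show ?case
    using dims[OF ab] by (intro fits_tri_split fits_rect combos_mult) (auto simp: combos_pos)
qed

lemma fits_tri_1: "(a, b) \<in> dims \<Longrightarrow> fits {} (tri a b)"
  using fits_tri[OF _ one_combos] by simp

lemma square_in_shapes: "square \<in> shapes"
  using shapes_rect one_L by simp

text \<open>Splitting the scale as \<mu> * l plus (\<mu> + x) * l makes both sides of the rectangle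
  multiples of \<mu>, up to an added length; this explains the 2 \<mu> in the inflation
  factor.\<close>

lemma fits_tri_square:
  assumes ab: "(a, b) \<in> dims" and l: "l \<in> combos L" and x: "x \<in> combos L"
  shows "fits {mark square} (tri ((2 * \<mu> + x) * l * a) ((2 * \<mu> + x) * l * b))"
proof -
  note abc = dims[OF ab]
  have 1: "\<mu> * l \<in> combos L" "\<mu> * l + x * l \<in> combos L"
    using combos_mult[OF mu(1) l] combos_mult[OF x l] by (auto intro: combos.add)
  have "\<mu> * l * a \<in> one_more L"
    using mu_mult[OF combos_mult[OF l]] abc by (simp add: mult.assoc)
  moreover have "\<mu> * l * b + x * l * b \<in> one_more L"
    using one_more_add[OF mu_mult[OF combos_mult[OF l]] combos_mult[OF combos_mult[OF x l]]] abc
    by (simp add: mult.assoc)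
  then have "(\<mu> * l + x * l) * b \<in> one_more L"
    by (simp add: distrib_right)
  ultimately have "fits {mark square} (rect (\<mu> * l * a) ((\<mu> * l + x * l) * b))"
    by (rule fits_square[OF fits_shape[OF square_in_shapes]])
  from fits_tri_split[OF fits_tri[OF ab 1(1)] fits_tri[OF ab 1(2)] this combos_pos[OF 1(1)]
      combos_pos[OF 1(2)] combos_pos[OF conjunct1[OF abc]] combos_pos[OF conjunct2[OF abc]]]
  have "fits {mark square} (tri ((\<mu> * l + (\<mu> * l + x * l)) * a) ((\<mu> * l + (\<mu> * l + x * l)) * b))" .
  moreover have "\<mu> * l + (\<mu> * l + x * l) = (2 * \<mu> + x) * l"
    by (simp add: algebra_simps)
  ultimately show ?thesis
    by simp
qed

text \<open>Beyond the original wedge at the apex lies a trapezoid: a central rectangle as high as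
  the base of the wedge, and above and below it a half wedge scaled by \<nu>. The tiles
  \<open>F\<close> go into the upper one.\<close>

lemma wedge_dissection:
  assumes \<nu>: "\<nu> \<in> combos L" and F: "fits F (tri (\<nu> * r) (\<nu> * u))"
  shows "fits ({mark (wedge r u)} \<union> move (isom (\<lambda>z. -1 * cnj z) (Complex ((1 + \<nu>) * r) u)) ` F)
    (wedge ((1 + \<nu>) * r) ((1 + \<nu>) * u))"
proof -
  let ?\<Lambda> = "1 + \<nu>"
  have pos: "r > 0" "u > 0" "\<nu> > 0"
    using combos \<nu> combos_pos by auto
  have cancel: "(?\<Lambda> * r) * s \<le> (?\<Lambda> * u) * t \<longleftrightarrow> r * s \<le> u * t" for s t
    using pos by (simp add: mult.assoc add_pos_pos)
  let ?X = "wedge (?\<Lambda> * r) (?\<Lambda> * u)"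
  have X: "?X = {z. Re z \<le> ?\<Lambda> * r \<and> r * \<bar>Im z\<bar> \<le> u * Re z}"
    by (simp add: wedge_def cancel)
  let ?U = "isom (\<lambda>z. -1 * cnj z) (Complex (?\<Lambda> * r) u) ` tri (\<nu> * r) (\<nu> * u)"
  let ?V = "isom (\<lambda>z. -1 * z) (Complex (?\<Lambda> * r) (- u)) ` tri (\<nu> * r) (\<nu> * u)"
  let ?M = "isom (\<lambda>z. z) (Complex r (- u)) ` rect (\<nu> * r) (2 * u)"
  \<comment> \<open>The hypotenuse of the upper triangle runs along the slanted side of the inflated
    wedge.\<close>
  have line: "\<nu> * u * (?\<Lambda> * r - s) + \<nu> * r * (t - u) \<le> \<nu> * r * (\<nu> * u) \<longleftrightarrow> r * t \<le> u * s" for s t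
  proof -
    have "\<nu> * r * (\<nu> * u) - (\<nu> * u * (?\<Lambda> * r - s) + \<nu> * r * (t - u)) = \<nu> * (u * s - r * t)"
      by (simp add: algebra_simps)
    then have "\<nu> * u * (?\<Lambda> * r - s) + \<nu> * r * (t - u) \<le> \<nu> * r * (\<nu> * u) \<longleftrightarrow> 0 \<le> \<nu> * (u * s - r * t)"
      by linarith
    then show ?thesis
      using pos by (simp add: zero_le_mult_iff)
  qed
  have U: "?U = {z. Re z \<le> ?\<Lambda> * r \<and> u \<le> Im z \<and> r * Im z \<le> u * Re z}"
    unfolding isom_reflect_image tri_def using line by auto
  have V: "?V = {z. Re z \<le> ?\<Lambda> * r \<and> Im z \<le> - u \<and> r * (- Im z) \<le> u * Re z}"
  proof (rule set_eqI)
    fix z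
    have "- u - Im z = - Im z - u"
      by simp
    then show "z \<in> ?V \<longleftrightarrow> z \<in> {z. Re z \<le> ?\<Lambda> * r \<and> Im z \<le> - u \<and> r * (- Im z) \<le> u * Re z}"
      unfolding isom_halfturn_image tri_def mem_Collect_eq complex.sel by (simp only: line) auto
  qed
  have M: "?M = {z. r \<le> Re z \<and> Re z \<le> ?\<Lambda> * r \<and> - u \<le> Im z \<and> Im z \<le> u}"
    unfolding isom_translate_image rect_def by (auto simp: algebra_simps)
  have le: "r \<le> s" if "r * t \<le> u * s" "u \<le> t" for s t
  proof -
    have "r * u \<le> r * t"
      using that pos by simp
    then have "u * r \<le> u * s"
      using that by (simp add: mult.commute)
    then show ?thesis
      using pos by simp
  qed
  have ge: "r * \<bar>t\<bar> \<le> u * s" if "r \<le> s" "\<bar>t\<bar> \<le> u" for s t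
  proof -
    have "r * \<bar>t\<bar> \<le> r * u" "u * r \<le> u * s"
      using that pos by simp_all
    then show ?thesis
      by (simp add: mult.commute)
  qed
  have ab: "(r, u) \<in> dims"
    by (simp add: dims_def)
  have fM: "fits {} ?M"
    using fits_move[OF orthogonal_transformation_id fits_rect[of "\<nu> * r" "2 * u"]]
      combos_mult[OF \<nu>] combos_mult[OF numeral_combos] combos by simp
  have fV: "fits {} ?V"
    using fits_move[OF orth_mult[of "-1"] fits_tri[OF ab \<nu>]] by simp
  have fU: "fits (move (isom (\<lambda>z. -1 * cnj z) (Complex (?\<Lambda> * r) u)) ` F) ?U" (is "fits ?F _")
    by (rule fits_move[OF orth_mult_cnj F]) simp
  \<comment> \<open>The trapezoid beyond the base of the original wedge, and its part below the
    upper triangle.\<close>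
  let ?R1 = "{z \<in> ?X. r \<le> Re z}"
  let ?R2 = "{z \<in> ?R1. Im z \<le> u}"
  have "fits ({} \<union> {}) ?R2"
  proof (rule fits_cut[OF fV fM, where a = 0 and b = 1 and c = "- u"])
    show "?R2 = ?V \<union> ?M"
    proof (intro equalityI subsetI)
      fix z assume "z \<in> ?R2"
      then show "z \<in> ?V \<union> ?M"
        unfolding V M X using pos by (cases "Im z \<le> - u") auto
    next
      fix z assume "z \<in> ?V \<union> ?M"
      then show "z \<in> ?R2"
        unfolding V M X using le[of "- Im z" "Re z"] ge[of "Re z" "Im z"] pos by auto
    qed
  qed (unfold V M, auto)
  then have f2: "fits {} ?R2"
    by simp
  have "fits ({} \<union> ?F) ?R1"
  proof (rule fits_cut[OF f2 fU, where a = 0 and b = 1 and c = u])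
    show "?R1 = ?R2 \<union> ?U"
    proof (intro equalityI subsetI)
      fix z assume "z \<in> ?R1"
      then show "z \<in> ?R2 \<union> ?U"
        unfolding U X using pos by (cases "Im z \<le> u") auto
    next
      fix z assume "z \<in> ?R2 \<union> ?U"
      then show "z \<in> ?R1"
        unfolding U X using le[of "Im z" "Re z"] pos by auto
    qed
  qed (unfold U, auto)
  then have f1: "fits ?F ?R1"
    by simp
  show ?thesis
  proof (rule fits_cut[OF fits_shape[OF shapes_wedge] f1, where a = 1 and b = 0 and c = r])
    have "r \<le> ?\<Lambda> * r"
      using pos by (simp add: distrib_right)
    then show "?X = wedge r u \<union> ?R1"
      unfolding X wedge_def[of r u] by auto
  qed (auto simp: wedge_def)
qed

section \<open>The regular polygon cut into wedges\<close>

lemma cis_minus_periodic: "cis (- (x + 2 * pi)) = cis (- x)"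
proof -
  have "cis (x + 2 * pi) = cis x"
    by (simp add: complex_eq_iff)
  then show ?thesis
    by (simp only: cis_cnj[symmetric])
qed

text \<open>The wedge with index \<open>j\<close> consists of the polygon points at which the
  constraint of edge \<open>j\<close> is the largest. Some constraint is always the largest, so the
  wedges cover, and comparing two constraints separates two wedges by a line.\<close>

lemma fits_ngon: "fits (star N (mark (wedge r u))) (ngon N r)"
  and supp_star: "(\<Union>t\<in>star N (mark (wedge r u)). supp t) = ngon N r"
proof -
  define \<beta> where "\<beta> j = 2 * pi * real j / real N" for j
  have r: "r > 0"
    using combos combos_pos by auto
  have W: "wedge r u = {z. Re z \<le> r \<and> (\<forall>i<N. Re (z * cis (- \<beta> i)) \<le> Re z)}"
    unfolding \<beta>_def by (rule wedge_eq[OF N r tan])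
  have \<beta>_add: "\<beta> i + \<beta> j = \<beta> (i + j)" for i j
    by (simp add: \<beta>_def distrib_left add_divide_distrib)
  have \<beta>_N: "\<beta> N = 2 * pi"
    using N by (simp add: \<beta>_def)
  let ?X = "\<lambda>j. isom (\<lambda>z. cis (\<beta> j) * z) 0 ` wedge r u"
  \<comment> \<open>Indices are taken modulo \<open>N\<close>; a full turn does not change the
    constraint.\<close>
  have shift: "\<exists>k<N. \<forall>z. Re (z * cis (- (\<beta> j + \<beta> i))) = Re (z * cis (- \<beta> k))"
    if "i < N" "j < N" for i j
  proof -
    have "\<beta> j + \<beta> i = \<beta> (j + i)"
      by (rule \<beta>_add)
    moreover have "\<beta> (j + i) = \<beta> (j + i - N) + 2 * pi" if "j + i \<ge> N"
      using \<beta>_add[of "j + i - N" N] \<beta>_N that by simp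
    ultimately show ?thesis
      using that
    proof (cases "j + i < N")
      case False
      then have "cis (- (\<beta> j + \<beta> i)) = cis (- \<beta> (j + i - N))"
        using \<open>\<beta> j + \<beta> i = \<beta> (j + i)\<close> \<open>j + i \<ge> N \<Longrightarrow> \<beta> (j + i) = \<beta> (j + i - N) + 2 * pi\<close>
        by (simp only: cis_minus_periodic not_less)
      then show ?thesis
        using that False by (intro exI[of _ "j + i - N"]) auto
    next
      case True
      then show ?thesis
        using \<open>\<beta> j + \<beta> i = \<beta> (j + i)\<close> by auto
    qed
  qed
  have X: "?X j = {z. Re (z * cis (- \<beta> j)) \<le> r \<and> (\<forall>i<N. Re (z * cis (- \<beta> i)) \<le> Re (z * cis (- \<beta> j)))}"
    if j: "j < N" for j
  proof -
    have "?X j = {z. cis (- \<beta> j) * z \<in> wedge r u}"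
      by (rule image_eq_preimage) (simp_all add: isom_def cis_mult flip: mult.assoc)
    also have "\<dots> = {z. Re (z * cis (- \<beta> j)) \<le> r \<and> (\<forall>i<N. Re (z * cis (- (\<beta> j + \<beta> i))) \<le> Re (z * cis (- \<beta> j)))}"
    proof -
      have "cis (- \<beta> j) * z = z * cis (- \<beta> j)" "z * cis (- \<beta> j) * cis (- \<beta> i) = z * cis (- (\<beta> j + \<beta> i))" for z i
        by (simp_all add: mult.assoc cis_mult)
      then show ?thesis
        unfolding W mem_Collect_eq by (simp only:)
    qed
    also have "\<dots> = {z. Re (z * cis (- \<beta> j)) \<le> r \<and> (\<forall>i<N. Re (z * cis (- \<beta> i)) \<le> Re (z * cis (- \<beta> j)))}"
    proof -
      have "(\<forall>i<N. Re (z * cis (- (\<beta> j + \<beta> i))) \<le> s) \<longleftrightarrow> (\<forall>i<N. Re (z * cis (- \<beta> i)) \<le> s)" for z s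
      proof
        assume "\<forall>i<N. Re (z * cis (- \<beta> i)) \<le> s"
        then show "\<forall>i<N. Re (z * cis (- (\<beta> j + \<beta> i))) \<le> s"
          using shift[OF _ j] by metis
      next
        assume R: "\<forall>i<N. Re (z * cis (- (\<beta> j + \<beta> i))) \<le> s"
        show "\<forall>i<N. Re (z * cis (- \<beta> i)) \<le> s"
        proof (intro allI impI)
          fix i assume i: "i < N"
          let ?k = "if i \<ge> j then i - j else i + N - j"
          have k: "?k < N"
            using i j by auto
          have "cis (- (\<beta> j + \<beta> ?k)) = cis (- \<beta> i)"
          proof (cases "i \<ge> j")
            case True
            then have "\<beta> j + \<beta> ?k = \<beta> i"
              unfolding \<beta>_add by simp
            then show ?thesis
              by simp
          next
            case False
            then have "\<beta> j + \<beta> ?k = \<beta> i + 2 * pi"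
              using j unfolding \<beta>_add \<beta>_N[symmetric] by simp
            then show ?thesis
              by (simp only: cis_minus_periodic)
          qed
          then show "Re (z * cis (- \<beta> i)) \<le> s"
            using R k by metis
        qed
      qed
      then show ?thesis
        by simp
    qed
    finally show ?thesis .
  qed
  have "fits (\<Union>j\<in>{..<N}. move (isom (\<lambda>z. cis (\<beta> j) * z) 0) ` {mark (wedge r u)}) (\<Union>j\<in>{..<N}. ?X j)"
  proof (rule fits_UN)
    fix i j assume ij: "i \<in> {..<N}" "j \<in> {..<N}" "i \<noteq> j"
    \<comment> \<open>The difference of two edge normals is the normal of the line through 0 that
      separates the two wedges.\<close>
    let ?a = "cos (\<beta> i) - cos (\<beta> j)" and ?b = "sin (\<beta> i) - sin (\<beta> j)"
    have diff: "?a * Re z + ?b * Im z = Re (z * cis (- \<beta> i)) - Re (z * cis (- \<beta> j))" for z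
      by (simp add: algebra_simps)
    have "interior (?X j) \<inter> interior (?X i) = {}"
    proof (rule separated_interiors[where a = ?a and b = ?b and c = 0])
      fix z assume "z \<in> ?X j"
      then show "?a * Re z + ?b * Im z \<le> 0"
        unfolding diff using X[of j] ij by auto
    next
      fix z assume "z \<in> ?X i"
      then show "?a * Re z + ?b * Im z \<ge> 0"
        unfolding diff using X[of i] ij by auto
    next
      show "?a \<noteq> 0 \<or> ?b \<noteq> 0"
      proof (rule ccontr)
        assume "\<not> (?a \<noteq> 0 \<or> ?b \<noteq> 0)"
        then have "cis (\<beta> i) = cis (\<beta> j)"
          by (simp add: complex_eq_iff)
        moreover have "\<beta> k \<in> {0..<2 * pi}" if "k < N" for k
          using that by (auto simp: \<beta>_def field_simps)
        then have "Arg2pi (cis (\<beta> k)) = \<beta> k" if "k < N" for k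
          using that by (intro Arg2pi_unique[of 1]) (auto simp: cis_conv_exp)
        ultimately have "\<beta> i = \<beta> j"
          using ij by (metis lessThan_iff)
        then show False
          using ij N by (simp add: \<beta>_def)
      qed
    qed
    then show "interior (?X i) \<inter> interior (?X j) = {}"
      by blast
  next
    show "fits (move (isom (\<lambda>z. cis (\<beta> j) * z) 0) ` {mark (wedge r u)}) (?X j)" for j
      by (intro fits_move orth_mult fits_shape shapes_wedge) simp
  qed simp
  moreover have ngon: "(\<Union>j\<in>{..<N}. ?X j) = ngon N r"
  proof (intro equalityI subsetI)
    fix z assume "z \<in> (\<Union>j\<in>{..<N}. ?X j)"
    then obtain j where "j < N" "z \<in> ?X j"
      by blast
    then show "z \<in> ngon N r"
      unfolding X[OF \<open>j < N\<close>] ngon_def \<beta>_def[symmetric] by fastforce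
  next
    fix z assume z: "z \<in> ngon N r"
    let ?f = "\<lambda>j. Re (z * cis (- \<beta> j))"
    have "?f 0 \<in> ?f ` {..<N}"
      using N by (intro imageI) simp
    then have "?f ` {..<N} \<noteq> {}" "finite (?f ` {..<N})"
      by blast+
    then obtain j where j: "j < N" "Max (?f ` {..<N}) = ?f j"
      using Max_in[of "?f ` {..<N}"] by blast
    have "?f i \<le> ?f j" if "i < N" for i
      unfolding j(2)[symmetric] using that by (intro Max_ge) auto
    then have "z \<in> ?X j"
      unfolding X[OF j(1)] using z j(1) by (simp add: ngon_def \<beta>_def)
    then show "z \<in> (\<Union>j\<in>{..<N}. ?X j)"
      using j(1) by blast
  qed
  moreover have "(\<Union>j\<in>{..<N}. move (isom (\<lambda>z. cis (\<beta> j) * z) 0) ` {mark (wedge r u)}) = star N (mark (wedge r u))"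
    by (auto simp: star_def \<beta>_def)
  ultimately show "fits (star N (mark (wedge r u))) (ngon N r)"
    by simp
  show "(\<Union>t\<in>star N (mark (wedge r u)). supp t) = ngon N r"
    unfolding ngon[symmetric] by (simp add: star_def \<beta>_def)
qed

lemma fits_star: "fits (move (isom (\<lambda>z. z) c) ` star N (mark (wedge r u))) (rect w h)"
proof (rule fits_frame)
  show "fits (move (isom (\<lambda>z. z) c) ` star N (mark (wedge r u))) (framed w h p1 q1 p2 q2 p2 q2 p1 q1)"
  proof -
    have "isom (\<lambda>z. z) c ` ngon N r = framed w h p1 q1 p2 q2 p2 q2 p1 q1"
      unfolding isom_translate_image using frame by blast
    then show ?thesis
      using fits_move[OF orthogonal_transformation_id fits_ngon, of c] by simp
  qed
qed (use room combos combos_pos in \<open>auto intro!: fits_tri_1 simp: dims_def\<close>)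

text \<open>A square of side 7 inscribes a square of side 5, leaving four right triangles with sides
  3, 4, 5.\<close>

lemma fits_rotated:
  "fits {move (isom (\<lambda>z. Complex (4/5) (3/5) * z) 3) (mark square)} (rect 7 7)"
proof (rule fits_frame)
  let ?A = "\<lambda>z. Complex (4/5) (3/5) * z"
  have orth: "orthogonal_transformation ?A"
    by (rule orth_mult) (simp add: cmod_def power_divide)
  \<comment> \<open>The tilted square has side 5: the rotated unit square occupies its corner at 3,
    and rectangles fill the rest.\<close>
  have "5 \<in> one_more L"
    unfolding one_more_def using numeral_combos[of "num.Bit0 (num.Bit0 num.One)"] by (auto intro!: image_eqI[of _ _ 4])
  then have "fits (move (isom ?A 3) ` {mark square}) (isom ?A 3 ` rect 5 5)"
    by (intro fits_move[OF orth] fits_square[OF fits_shape[OF square_in_shapes]])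
  moreover have "isom ?A 3 ` rect 5 5 = framed 7 7 3 4 4 3 3 4 4 3"
  proof -
    have inv: "Complex (4/5) (3/5) * Complex (4/5) (-3/5) = 1" "Complex (4/5) (-3/5) * Complex (4/5) (3/5) = 1"
      by (simp_all add: complex_eq_iff)
    have "isom ?A 3 ` rect 5 5 = {z. Complex (4/5) (-3/5) * (z - 3) \<in> rect 5 5}"
      unfolding isom_def
      by (rule image_eq_preimage)
        (simp_all only: mult.assoc[symmetric] inv mult_1 diff_add_cancel add_diff_cancel_right')
    also have "\<dots> = framed 7 7 3 4 4 3 3 4 4 3"
    proof (rule set_eqI)
      fix z
      \<comment> \<open>The tilted square lies in the box, so the four slanted constraints imply the
        axis-parallel ones.\<close>
      have "0 \<le> s \<and> s \<le> 7 \<and> 0 \<le> t \<and> t \<le> 7"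
        if "12 \<le> 4 * s + 3 * t" "12 \<le> 3 * (7 - s) + 4 * t" "12 \<le> 4 * (7 - s) + 3 * (7 - t)"
          "12 \<le> 3 * s + 4 * (7 - t)" for s t :: real
        using that by argo
      moreover have "0 \<le> 4/5 * (s - 3) + 3/5 * t \<longleftrightarrow> 12 \<le> 4 * s + 3 * t"
        "4/5 * (s - 3) + 3/5 * t \<le> 5 \<longleftrightarrow> 12 \<le> 4 * (7 - s) + 3 * (7 - t)"
        "0 \<le> 4/5 * t - 3/5 * (s - 3) \<longleftrightarrow> 12 \<le> 3 * (7 - s) + 4 * t"
        "4/5 * t - 3/5 * (s - 3) \<le> 5 \<longleftrightarrow> 12 \<le> 3 * s + 4 * (7 - t)" for s t :: real
        by (simp_all add: field_simps)
      moreover have "z \<in> framed 7 7 3 4 4 3 3 4 4 3 \<longleftrightarrow> (0 \<le> Re z \<and> Re z \<le> 7 \<and> 0 \<le> Im z \<and> Im z \<le> 7) \<and>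
          12 \<le> 4 * Re z + 3 * Im z \<and> 12 \<le> 3 * (7 - Re z) + 4 * Im z \<and>
          12 \<le> 4 * (7 - Re z) + 3 * (7 - Im z) \<and> 12 \<le> 3 * Re z + 4 * (7 - Im z)"
        unfolding framed_def rect_def by simp
      moreover have "Complex (4/5) (-3/5) * (z - 3) \<in> rect 5 5 \<longleftrightarrow>
          0 \<le> 4/5 * (Re z - 3) + 3/5 * Im z \<and> 4/5 * (Re z - 3) + 3/5 * Im z \<le> 5 \<and>
          0 \<le> 4/5 * Im z - 3/5 * (Re z - 3) \<and> 4/5 * Im z - 3/5 * (Re z - 3) \<le> 5"
        unfolding rect_def by simp
      ultimately show "z \<in> {z. Complex (4/5) (-3/5) * (z - 3) \<in> rect 5 5} \<longleftrightarrow> z \<in> framed 7 7 3 4 4 3 3 4 4 3"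
        unfolding mem_Collect_eq by blast
    qed
    finally show ?thesis .
  qed
  ultimately show "fits {move (isom ?A 3) (mark square)} (framed 7 7 3 4 4 3 3 4 4 3)"
    by simp
qed (auto intro!: fits_tri_1 simp: dims_def)

text \<open>As a set the square is its own mirror image; only its marking is reversed.\<close>

lemma fits_reflected: "fits {move (isom (\<lambda>z. 1 * cnj z) \<i>) (mark square)} square"
proof -
  have "isom (\<lambda>z. 1 * cnj z) \<i> ` square = square"
    unfolding isom_cnj_image by (auto simp: rect_def)
  then show ?thesis
    using fits_move[OF orth_mult_cnj[of 1] fits_shape[OF square_in_shapes], of \<i>] by simp
qed

section \<open>Collecting finitely many patches in one rectangle\<close>

definition embeddable :: "tile set \<Rightarrow> bool" where
  "embeddable F \<longleftrightarrow> (\<exists>x\<in>combos L. \<exists>y\<in>combos L. fits F (rect x y))"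

text \<open>A triangle and its half turn make up a rectangle, and the wedge is found in the framed
  polygon. There it is displaced, whence the copy \<open>t\<close>.\<close>

lemma embeddable_shape:
  assumes "X \<in> shapes"
  shows "\<exists>t. tile_equiv (mark X) t \<and> embeddable {t}"
proof -
  consider l m where "l \<in> L" "m \<in> L" "X = rect l m"
    | l a b where "l \<in> L" "(a, b) \<in> dims" "X = tri (l * a) (l * b)" | "X = wedge r u"
    using assms unfolding shapes_def by auto
  then show ?thesis
  proof cases
    case 1
    then have "embeddable {mark X}"
      using fits_shape[OF assms] unfolding embeddable_def by (blast intro: combos.base)
    then show ?thesis
      using tile_equiv_refl by blast
  next
    case 2
    let ?a = "l * a" and ?b = "l * b"
    have ab: "?a \<in> combos L" "?b \<in> combos L"
      using dims[OF 2(2)] 2(1) by (auto intro: combos_mult combos.base)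
    have pos: "?a > 0" "?b > 0"
      using ab combos_pos by auto
    have "fits ({mark X} \<union> {}) (rect ?a ?b)"
    proof (rule fits_cut[where a = ?b and b = ?a and c = "?a * ?b"])
      show "fits {mark X} (tri ?a ?b)"
        using fits_shape[OF assms] 2 by simp
      then show "fits {} {z. Re z \<le> ?a \<and> Im z \<le> ?b \<and> ?b * (?a - Re z) + ?a * (?b - Im z) \<le> ?a * ?b}"
        by (intro fits_tri_corners(2) fits_weaken)
      show "rect ?a ?b = tri ?a ?b \<union> {z. Re z \<le> ?a \<and> Im z \<le> ?b \<and> ?b * (?a - Re z) + ?a * (?b - Im z) \<le> ?a * ?b}"
      proof (intro equalityI subsetI)
        fix z assume "z \<in> rect ?a ?b"
        then show "z \<in> tri ?a ?b \<union> {z. Re z \<le> ?a \<and> Im z \<le> ?b \<and> ?b * (?a - Re z) + ?a * (?b - Im z) \<le> ?a * ?b}"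
          unfolding rect_def tri_def by (auto simp: algebra_simps)
      next
        fix z assume "z \<in> tri ?a ?b \<union> {z. Re z \<le> ?a \<and> Im z \<le> ?b \<and> ?b * (?a - Re z) + ?a * (?b - Im z) \<le> ?a * ?b}"
        then show "z \<in> rect ?a ?b"
          unfolding rect_def tri_def
          using tri_bounds[OF pos, of "Re z" "Im z"] tri_bounds[OF pos, of "?a - Re z" "?b - Im z"] by auto
      qed
    qed (use pos in \<open>auto simp: tri_def algebra_simps\<close>)
    then have "embeddable {mark X}"
      unfolding embeddable_def using ab by auto
    then show ?thesis
      using tile_equiv_refl by blast
  next
    case 3
    let ?t = "move (isom (\<lambda>z. z) c) (move (isom (\<lambda>z. cis (2 * pi * real 0 / real N) * z) 0) (mark (wedge r u)))"
    have "?t \<in> move (isom (\<lambda>z. z) c) ` star N (mark (wedge r u))"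
      unfolding star_def using N by (intro imageI) simp
    then have "embeddable {?t}"
      unfolding embeddable_def using combos fits_mono[OF fits_star, of "{?t}"] by blast
    moreover have "tile_equiv (mark X) ?t"
      unfolding 3 by (intro tile_equiv_move tile_equiv_refl orthogonal_transformation_id orth_mult) simp
    ultimately show ?thesis
      by blast
  qed
qed

text \<open>Two rectangles are padded to the common height y + y' and placed side by side; padding
  needs only sums of lengths.\<close>

lemma embed_family:
  assumes "finite \<F>" "\<And>F. F \<in> \<F> \<Longrightarrow> embeddable F"
  shows "\<exists>x\<in>combos L. \<exists>y\<in>combos L. \<exists>P. fits P (rect x y) \<and> (\<forall>F\<in>\<F>. \<exists>b. move (isom (\<lambda>z. z) b) ` F \<subseteq> P)"
  using assms
proof (induction rule: finite_induct)
  case empty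
  show ?case
    using fits_rect[OF one_combos one_combos] one_combos by blast
next
  case (insert F \<F>)
  obtain x y P where P: "x \<in> combos L" "y \<in> combos L" "fits P (rect x y)"
    "\<forall>F\<in>\<F>. \<exists>b. move (isom (\<lambda>z. z) b) ` F \<subseteq> P"
    using insert by blast
  obtain x' y' where F: "x' \<in> combos L" "y' \<in> combos L" "fits F (rect x' y')"
    using insert.prems[of F] unfolding embeddable_def by blast
  have pos: "x > 0" "y > 0" "x' > 0" "y' > 0"
    using P F combos_pos by auto
  have "fits P (rect x (y + y'))"
    using fits_rect_vertical[OF P(3) fits_rect[OF P(1) F(2)]] pos by simp
  moreover have "fits F (rect x' (y' + y))"
    using fits_rect_vertical[OF F(3) fits_rect[OF F(1) P(2)]] pos by simp
  then have "fits F (rect x' (y + y'))"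
    by (simp add: add.commute)
  ultimately have "fits (P \<union> move (isom (\<lambda>z. z) (of_real x)) ` F) (rect (x + x') (y + y'))"
    using pos by (intro fits_rect_horizontal) auto
  moreover have "x + x' \<in> combos L" "y + y' \<in> combos L"
    using P F by (auto intro: combos.add)
  moreover have "\<forall>F'\<in>insert F \<F>. \<exists>b. move (isom (\<lambda>z. z) b) ` F' \<subseteq> P \<union> move (isom (\<lambda>z. z) (of_real x)) ` F"
    using P(4) by blast
  ultimately show ?case
    by blast
qed

end

text \<open>Modulo 5, the powers of \<open>4 + 3 i\<close> stay multiples of it, whence no power is real.\<close>

lemma pythagorean_power:
  assumes "n > 0"
  shows "Complex (4/5) (3/5) ^ n \<noteq> 1"
proof -
  have "\<exists>a b :: int. Complex 4 3 ^ Suc n = Complex (of_int a) (of_int b) \<and> (3 * a - 4 * b) mod 5 = 0 \<and> b mod 5 \<noteq> 0" for n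
  proof (induction n)
    case 0
    have "Complex 4 3 ^ Suc 0 = Complex (of_int 4) (of_int 3)"
      by simp
    then show ?case
      by (intro exI[of _ 4] exI[of _ 3]) simp
  next
    case (Suc n)
    then obtain a b :: int where ab: "Complex 4 3 ^ Suc n = Complex (of_int a) (of_int b)"
      "(3 * a - 4 * b) mod 5 = 0" "b mod 5 \<noteq> 0"
      by (elim exE conjE) (rule that; assumption)
    have "Complex 4 3 ^ Suc (Suc n) = Complex 4 3 * Complex (of_int a) (of_int b)"
      by (simp only: power_Suc[of _ "Suc n"] ab(1))
    also have "\<dots> = Complex (of_int (4 * a - 3 * b)) (of_int (3 * a + 4 * b))"
      by (simp add: complex_eq_iff)
    finally have "Complex 4 3 ^ Suc (Suc n) = Complex (of_int (4 * a - 3 * b)) (of_int (3 * a + 4 * b))" .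
    \<comment> \<open>The expression equals -25 b.\<close>
    moreover have "(3 * (4 * a - 3 * b) - 4 * (3 * a + 4 * b)) mod 5 = 0"
      by presburger
    \<comment> \<open>By the invariant, 3 a is congruent to 4 b modulo 5, so this is congruent to 8
      b, and 8 is a unit modulo 5.\<close>
    moreover have "(3 * a + 4 * b) mod 5 \<noteq> 0"
      using ab(2,3) by presburger
    ultimately show ?case
      by (intro exI conjI)
  qed
  from this[of "n - 1"] obtain a b :: int
    where "Complex 4 3 ^ Suc (n - 1) = Complex (of_int a) (of_int b)" and b: "b mod 5 \<noteq> 0"
    by (elim exE conjE) (rule that; assumption)
  then have ab: "Complex 4 3 ^ n = Complex (of_int a) (of_int b)"
    using assms by simp
  have "Complex (4/5) (3/5) = Complex 4 3 / 5"
    by (simp add: complex_eq_iff)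
  then have "Complex (4/5) (3/5) ^ n = Complex (of_int a) (of_int b) / 5 ^ n"
    by (simp only: power_divide ab)
  moreover have "b \<noteq> 0"
    using b by auto
  moreover have "Im (z / 5 ^ n) = Im z / 5 ^ n" for z
    using Im_divide_of_real[of z "5 ^ n"] by simp
  ultimately have "Im (Complex (4/5) (3/5) ^ n) \<noteq> 0"
    by simp
  then show ?thesis
    by auto
qed

section \<open>Choosing the inflation factor and assembling the substitution\<close>

context star_gadget
begin

lemma symmetric_tiling_exists:
  assumes n: "n dvd N"
  shows "has_symmetric_DTO_tiling n"
proof -
  let ?Q = "mark square" and ?W = "mark (wedge r u)"
  obtain t where t: "\<And>X. X \<in> shapes \<Longrightarrow> tile_equiv (mark X) (t X) \<and> embeddable {t X}"
    using embeddable_shape by metis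
  let ?rot = "move (isom (\<lambda>z. Complex (4/5) (3/5) * z) 3) ?Q"
  let ?refl = "move (isom (\<lambda>z. 1 * cnj z) \<i>) ?Q"
  \<comment> \<open>All that the inflated square has to contain: itself, its rotated and reflected
    copies, the star, and a copy of every prototile.\<close>
  define \<F> where "\<F> = {{?Q}, {?rot}, {?refl}, move (isom (\<lambda>z. z) c) ` star N ?W} \<union> (\<lambda>X. {t X}) ` shapes"
  have \<F>: "{?Q} \<in> \<F>" "{?rot} \<in> \<F>" "{?refl} \<in> \<F>" "move (isom (\<lambda>z. z) c) ` star N ?W \<in> \<F>"
    "\<And>X. X \<in> shapes \<Longrightarrow> {t X} \<in> \<F>"
    unfolding \<F>_def by simp_all
  have "finite \<F>"
    using finite_shapes by (simp add: \<F>_def)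
  moreover have "embeddable F" if "F \<in> \<F>" for F
  proof -
    have "embeddable {?Q}"
      unfolding embeddable_def using fits_shape[OF square_in_shapes] one_combos by blast
    moreover have "embeddable {?rot}"
      unfolding embeddable_def using fits_rotated numeral_combos by blast
    moreover have "embeddable {?refl}"
      unfolding embeddable_def using fits_reflected one_combos by blast
    moreover have "embeddable (move (isom (\<lambda>z. z) c) ` star N ?W)"
      unfolding embeddable_def using fits_star combos by blast
    ultimately show ?thesis
      using that t unfolding \<F>_def by blast
  qed
  ultimately have "\<exists>x\<in>combos L. \<exists>y\<in>combos L. \<exists>P. fits P (rect x y) \<and> (\<forall>F\<in>\<F>. \<exists>b. move (isom (\<lambda>z. z) b) ` F \<subseteq> P)"
    by (rule embed_family)
  then obtain x y P where xy: "x \<in> combos L" "y \<in> combos L" and P: "fits P (rect x y)"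
    "\<forall>F\<in>\<F>. \<exists>b. move (isom (\<lambda>z. z) b) ` F \<subseteq> P"
    by (elim bexE exE conjE)
  note in_P = bspec[OF P(2)]
  \<comment> \<open>Large enough that removing \<open>x\<close>, \<open>y\<close>, \<mu> or 2 \<mu>
    from 1 + \<nu> leaves a length.\<close>
  define \<nu> where "\<nu> = 2 * \<mu> + (x + y)"
  let ?\<Lambda> = "1 + \<nu>"
  have \<nu>: "\<nu> \<in> combos L"
    unfolding \<nu>_def by (rule combos.add[OF combos_mult[OF numeral_combos mu(1)] combos.add[OF xy]])
  have \<nu>0: "\<nu> > 0"
    using \<nu> combos_pos by blast
  have \<Lambda>0: "?\<Lambda> > 0" "?\<Lambda> > 1"
    using \<nu>0 by auto
  \<comment> \<open>In this order, the decompositions serve to give every inflated rectangle a unit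
    to spare, to widen and to heighten the rectangle of \<open>P\<close> to the inflated square, and
    to find a unit square in the inflated triangles.\<close>
  have \<Lambda>_eq: "?\<Lambda> = \<mu> + (1 + \<mu> + (x + y))" "?\<Lambda> = x + (1 + 2 * \<mu> + y)" "?\<Lambda> = y + (1 + 2 * \<mu> + x)"
    "?\<Lambda> = 2 * \<mu> + (1 + (x + y))"
    by (simp_all add: \<nu>_def)
  have mu2: "2 * \<mu> \<in> combos L"
    using combos_mult[OF numeral_combos mu(1)] .
  have rest: "1 + \<mu> + (x + y) \<in> combos L" "1 + 2 * \<mu> + y \<in> combos L" "1 + 2 * \<mu> + x \<in> combos L"
    "1 + (x + y) \<in> combos L" "?\<Lambda> \<in> combos L"
    using combos.add[OF combos.add[OF one_combos mu(1)] combos.add[OF xy]]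
      combos.add[OF combos.add[OF one_combos mu2] xy(2)] combos.add[OF combos.add[OF one_combos mu2] xy(1)]
      combos.add[OF one_combos combos.add[OF xy]] combos.add[OF one_combos \<nu>] by simp_all
  have "fits P (rect x ?\<Lambda>)"
    unfolding \<Lambda>_eq(3) using fits_mono[OF fits_rect_vertical[OF P(1) fits_rect[OF xy(1) rest(3)]]]
      combos_pos[OF xy(2)] combos_pos[OF rest(3)] by simp
  then have "fits P (rect (x + (1 + 2 * \<mu> + y)) ?\<Lambda>)"
    using fits_mono[OF fits_rect_horizontal[OF _ fits_rect[OF rest(2,5)]]]
      combos_pos[OF xy(1)] combos_pos[OF rest(2)] by simp
  then have fP: "fits P (rect ?\<Lambda> ?\<Lambda>)"
    unfolding \<Lambda>_eq(2)[symmetric] .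
  have \<Lambda>_mult: "?\<Lambda> * l \<in> one_more L" if "l \<in> L" for l
  proof -
    have "\<mu> * l + (1 + \<mu> + (x + y)) * l \<in> one_more L"
      using that by (intro one_more_add mu(2) combos_mult rest(1) combos.base)
    then show ?thesis
      unfolding \<Lambda>_eq(1) by (simp only: distrib_right)
  qed
  \<comment> \<open>The wedge meets the imaginary axis only in 0, which distinguishes it from every
    rectangle and right triangle, so the special demands on wedge and square never concern the same
    shape.\<close>
  have WQ: "wedge r u \<noteq> square"
  proof
    assume "wedge r u = square"
    moreover have "\<i> \<in> square"
      by (simp add: rect_def)
    ultimately have "\<i> \<in> wedge r u"
      by simp
    then show False
      using combos_pos[OF combos(1)] by (simp add: wedge_def)
  qed
  have fits_big: "\<exists>F. fits F ((\<lambda>z. ?\<Lambda> *\<^sub>R z) ` X) \<and> (\<exists>s\<in>F. tile_equiv ?Q s)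
      \<and> (X = wedge r u \<longrightarrow> ?W \<in> F) \<and> (X = square \<longrightarrow> P \<subseteq> F)" if X: "X \<in> shapes" for X
  proof (cases "X = square")
    case True
    obtain b where "move (isom (\<lambda>z. z) b) ?Q \<in> P"
      using in_P[OF \<F>(1)] by auto
    then have "\<exists>s\<in>P. tile_equiv ?Q s"
      using tile_equiv_move[OF tile_equiv_refl orthogonal_transformation_id] by blast
    then show ?thesis
      using True fP WQ by (intro exI[of _ P]) (simp add: scale_rect[OF \<Lambda>0(1)])
  next
    case False
    consider l m where "l \<in> L" "m \<in> L" "X = rect l m"
      | l a b where "l \<in> L" "(a, b) \<in> dims" "X = tri (l * a) (l * b)" | "X = wedge r u"
      using X unfolding shapes_def by auto
    then show ?thesis
    proof cases
      case 1
      have "fits {?Q} ((\<lambda>z. ?\<Lambda> *\<^sub>R z) ` X)"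
        unfolding 1(3) scale_rect[OF \<Lambda>0(1)]
        by (intro fits_square[OF fits_shape[OF square_in_shapes]] \<Lambda>_mult 1)
      moreover have "X \<noteq> wedge r u"
      proof
        assume "X = wedge r u"
        moreover have "Complex 0 m \<in> X"
          using L_pos[OF 1(1)] L_pos[OF 1(2)] by (simp add: 1 rect_def)
        ultimately show False
          using combos_pos[OF combos(1)] L_pos[OF 1(2)] by (simp add: wedge_def mult_le_0_iff)
      qed
      ultimately show ?thesis
        using False tile_equiv_refl by blast
    next
      case 2
      have "fits {?Q} ((\<lambda>z. ?\<Lambda> *\<^sub>R z) ` X)"
        using fits_tri_square[OF 2(2) combos.base[OF 2(1)] rest(4)]
        unfolding 2(3) scale_tri[OF \<Lambda>0(1)] unfolding \<Lambda>_eq(4) mult.assoc .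
      moreover have "X \<noteq> wedge r u"
      proof
        assume "X = wedge r u"
        have pos: "l * a > 0" "l * b > 0"
          using dims[OF 2(2)] combos_pos L_pos[OF 2(1)] by simp_all
        moreover have "Complex 0 (l * b) \<in> X"
          using pos by (simp add: 2 tri_def)
        then have "r * \<bar>l * b\<bar> \<le> 0"
          unfolding \<open>X = wedge r u\<close> by (simp add: wedge_def)
        moreover have "0 < r * \<bar>l * b\<bar>"
          using pos combos_pos[OF combos(1)] by (intro mult_pos_pos) linarith+
        ultimately show False
          by linarith
      qed
      ultimately show ?thesis
        using False tile_equiv_refl by blast
    next
      case 3
      have "(r, u) \<in> dims"
        by (simp add: dims_def)
      from fits_tri_square[OF this one_combos, of "x + y"]
      have "fits {?Q} (tri (\<nu> * r) (\<nu> * u))"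
        using xy by (simp add: \<nu>_def combos.add)
      from wedge_dissection[OF \<nu> this]
      have "fits ({?W} \<union> move (isom (\<lambda>z. -1 * cnj z) (Complex (?\<Lambda> * r) u)) ` {?Q}) ((\<lambda>z. ?\<Lambda> *\<^sub>R z) ` X)"
        unfolding 3 scale_wedge[OF \<Lambda>0(1)] .
      moreover have "tile_equiv ?Q (move (isom (\<lambda>z. -1 * cnj z) (Complex (?\<Lambda> * r) u)) ?Q)"
        by (intro tile_equiv_move tile_equiv_refl orth_mult_cnj) simp
      ultimately show ?thesis
        using False 3 by blast
    qed
  qed
  have "\<forall>X\<in>shapes. \<exists>R. dissects (mark ` shapes) ((\<lambda>z. ?\<Lambda> *\<^sub>R z) ` X) R \<and> (\<exists>s\<in>R. tile_equiv ?Q s)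
      \<and> (X = wedge r u \<longrightarrow> ?W \<in> R) \<and> (X = square \<longrightarrow> P \<subseteq> R)"
  proof
    fix X assume "X \<in> shapes"
    from fits_big[OF this] obtain F where F: "fits F ((\<lambda>z. ?\<Lambda> *\<^sub>R z) ` X)"
      "\<exists>s\<in>F. tile_equiv ?Q s" "X = wedge r u \<longrightarrow> ?W \<in> F" "X = square \<longrightarrow> P \<subseteq> F"
      by (elim exE conjE)
    obtain R where R: "dissects (mark ` shapes) ((\<lambda>z. ?\<Lambda> *\<^sub>R z) ` X) R" "F \<subseteq> R"
      using F(1) unfolding fits_def by (elim exE conjE)
    show "\<exists>R. dissects (mark ` shapes) ((\<lambda>z. ?\<Lambda> *\<^sub>R z) ` X) R \<and> (\<exists>s\<in>R. tile_equiv ?Q s)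
      \<and> (X = wedge r u \<longrightarrow> ?W \<in> R) \<and> (X = square \<longrightarrow> P \<subseteq> R)"
    proof (intro exI conjI impI)
      show "dissects (mark ` shapes) ((\<lambda>z. ?\<Lambda> *\<^sub>R z) ` X) R"
        by (rule R(1))
      show "\<exists>s\<in>R. tile_equiv ?Q s"
        using F(2) R(2) by (elim bexE) (rule bexI, assumption, erule subsetD)
      show "?W \<in> R" if "X = wedge r u"
        using F(3) R(2) that by (intro subsetD[OF R(2)]) (rule mp)
      show "P \<subseteq> R" if "X = square"
        using F(4) that by (intro order_trans[OF _ R(2)]) (rule mp)
    qed
  qed
  from bchoice[OF this] obtain f where f':
    "\<forall>X\<in>shapes. dissects (mark ` shapes) ((\<lambda>z. ?\<Lambda> *\<^sub>R z) ` X) (f X) \<and> (\<exists>s\<in>f X. tile_equiv ?Q s)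
      \<and> (X = wedge r u \<longrightarrow> ?W \<in> f X) \<and> (X = square \<longrightarrow> P \<subseteq> f X)" ..
  have f: "\<And>X. X \<in> shapes \<Longrightarrow> dissects (mark ` shapes) ((\<lambda>z. ?\<Lambda> *\<^sub>R z) ` X) (f X)"
    "\<And>X. X \<in> shapes \<Longrightarrow> \<exists>s\<in>f X. tile_equiv ?Q s" "?W \<in> f (wedge r u)" "P \<subseteq> f square"
    using bspec[OF f'] bspec[OF f' square_in_shapes] bspec[OF f' shapes_wedge] by simp_all
  let ?\<sigma> = "subst_of ?\<Lambda> f"
  have protos: "protos ?\<sigma> = mark ` shapes" and dissect: "\<And>X. dissect ?\<sigma> (mark X) = f X"
    by (simp_all add: subst_of_def)
  have in_Q: "\<exists>b. move (isom A (A' + b)) ?Q \<in> dissect ?\<sigma> ?Q"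
    if A: "{move (isom A A') ?Q} \<in> \<F>" for A A'
  proof -
    obtain b where "move (isom (\<lambda>z. z) b) (move (isom A A') ?Q) \<in> P"
      using in_P[OF A] by auto
    then have "move (isom A (A' + b)) ?Q \<in> P"
      by (simp add: move_move isom_def add.assoc)
    then show ?thesis
      using f(4) unfolding dissect by blast
  qed
  \<comment> \<open>The factor 1 stands for \<open>v\<close>, as the square is reflected by plain
    conjugation and a translation; the final \<open>r\<close> is the radius of the covered disc, the
    inradius of the polygon.\<close>
  interpret star_subst ?\<sigma> ?Q "Complex (4/5) (3/5)" 1 N ?W r
  proof unfold_locales
    show "is_substitution ?\<sigma>"
      using is_substitution_subst_of f(1) \<Lambda>0(2) by blast
    show "?Q \<in> protos ?\<sigma>" "?W \<in> protos ?\<sigma>"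
      unfolding protos using square_in_shapes shapes_wedge by auto
    show "\<exists>s\<in>dissect ?\<sigma> p. tile_equiv ?Q s" if "p \<in> protos ?\<sigma>" for p
      using that f(2) unfolding protos by (auto simp: dissect)
    show "\<exists>s\<in>dissect ?\<sigma> ?Q. tile_equiv p s" if p: "p \<in> protos ?\<sigma>" for p
    proof -
      obtain X where X: "X \<in> shapes" "p = mark X"
        using p unfolding protos by blast
      obtain b where "move (isom (\<lambda>z. z) b) (t X) \<in> P"
        using in_P[OF \<F>(5)[OF X(1)]] by auto
      then have "move (isom (\<lambda>z. z) b) (t X) \<in> dissect ?\<sigma> ?Q"
        using f(4) unfolding dissect by blast
      moreover have "tile_equiv p (move (isom (\<lambda>z. z) b) (t X))"
        using t[OF X(1)] X(2) tile_equiv_move orthogonal_transformation_id by blast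
      ultimately show ?thesis
        by blast
    qed
    show "\<exists>b. move (isom (\<lambda>z. z) b) ?Q \<in> dissect ?\<sigma> ?Q"
      using in_Q[of "\<lambda>z. z" 0] \<F>(1) by auto
    show "\<exists>b. move (isom (\<lambda>z. Complex (4/5) (3/5) * z) b) ?Q \<in> dissect ?\<sigma> ?Q"
      using in_Q[of "\<lambda>z. Complex (4/5) (3/5) * z" 3] \<F>(2) by blast
    show "\<exists>b. move (isom (\<lambda>z. 1 * cnj z) b) ?Q \<in> dissect ?\<sigma> ?Q"
      using in_Q[of "\<lambda>z. 1 * cnj z" \<i>] \<F>(3) by blast
    show "cmod (Complex (4/5) (3/5)) = 1"
      by (simp add: cmod_def power_divide)
    show "Complex (4/5) (3/5) ^ n \<noteq> 1" if "n > 0" for n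
      by (rule pythagorean_power[OF that])
    show "cmod 1 = 1" "N \<ge> 3"
      using N by simp_all
    show "?W \<in> dissect ?\<sigma> ?W"
      using f(3) unfolding dissect .
    show "\<exists>B b. orthogonal_transformation B \<and> move (isom B b) ` star N ?W \<subseteq> dissect ?\<sigma> ?Q"
    proof -
      obtain b where "move (isom (\<lambda>z. z) b) ` move (isom (\<lambda>z. z) c) ` star N ?W \<subseteq> P"
        using in_P[OF \<F>(4)] by blast
      moreover have "move (isom (\<lambda>z. z) b) ` move (isom (\<lambda>z. z) c) ` star N ?W = move (isom (\<lambda>z. z) (c + b)) ` star N ?W"
        by (simp add: image_image move_move isom_def add.assoc)
      ultimately have "move (isom (\<lambda>z. z) (c + b)) ` star N ?W \<subseteq> dissect ?\<sigma> ?Q"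
        using f(4) unfolding dissect by simp
      then show ?thesis
        using orthogonal_transformation_id by blast
    qed
    show "r > 0"
      using combos combos_pos by blast
    show "ball 0 r \<subseteq> (\<Union>t\<in>star N ?W. supp t)"
      unfolding supp_star
    proof
      fix z :: complex assume "z \<in> ball 0 r"
      then have "cmod (z * cis a) \<le> r" for a
        by (simp add: norm_mult)
      then show "z \<in> ngon N r"
        unfolding ngon_def using complex_Re_le_cmod order_trans by blast
    qed
    show "0 \<in> supp ?W"
      using combos combos_pos[of r] by (simp add: wedge_def)
    show "A = (\<lambda>z. z)" if "p \<in> protos ?\<sigma>" "orthogonal_transformation A" "move (isom A b) p = p" for p A b
      using that mark_rigid unfolding protos by blast
  qed
  show ?thesis
    by (rule symmetric_tiling[OF n])
qed

end

subsection \<open>Hexagons, octagons and pentagons\<close>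

lemma combos_numeral_mult:
  assumes "x \<in> combos L"
  shows "numeral k * x \<in> combos L"
proof -
  have "real (Suc n) * x \<in> combos L" for n
  proof (induction n)
    case (Suc n)
    have "real (Suc (Suc n)) * x = x + real (Suc n) * x"
      by (simp add: algebra_simps)
    then show ?case
      using combos.add[OF assms Suc] by simp
  qed (simp add: assms)
  from this[of "pred_numeral k"] show ?thesis
    by (simp only: numeral_eq_Suc[symmetric] of_nat_numeral)
qed

lemma one_moreI: "x = 1 + y \<Longrightarrow> y \<in> combos L \<Longrightarrow> x \<in> one_more L"
  by (simp add: one_more_def)

lemma All_less_numeral: "(\<forall>i<numeral k. Q i) \<longleftrightarrow> (\<forall>i<pred_numeral k. Q i) \<and> Q (pred_numeral k)"
  by (auto simp: numeral_eq_Suc All_less_Suc)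

lemma in_ngon:
  "z \<in> ngon N r \<longleftrightarrow> (\<forall>i<N. Re z * cos (2 * pi * real i / real N) + Im z * sin (2 * pi * real i / real N) \<le> r)"
  by (simp add: ngon_def)

text \<open>The hexagon of side 2 with two vertical edges: width \<open>2 * t\<close>, height 4
  between opposite vertices.\<close>

lemma hexagon_gadget:
  defines "t \<equiv> sqrt 3"
  shows "star_gadget {1, t} (1 + t) 6 t 1 (2 * t) 4 t 1 t 1 (Complex t 2)"
proof
  have tt: "t * t = 3" and t: "t > 0"
    by (simp_all add: t_def)
  have base: "1 \<in> combos {1, t}" "t \<in> combos {1, t}"
    by (auto intro: combos.base)
  have num: "numeral k \<in> combos {1, t}" for k
    using combos_numeral_mult[OF base(1)] by simp
  note intros = combos.add base num combos_numeral_mult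
  show "l * m \<in> combos {1, t}" if "l \<in> {1, t}" "m \<in> {1, t}" for l m
    using that tt by (auto intro: base num)
  show "(1 + t) * l \<in> one_more {1, t}" if "l \<in> {1, t}" for l
    using that
  proof (elim insertE emptyE)
    assume "l = t"
    then have "(1 + t) * l = 1 + (2 + t)"
      using tt by (simp add: algebra_simps)
    then show ?thesis
      by (rule one_moreI) (intro combos.add base num)
  qed (auto intro: one_moreI base)
  show "1 + t \<in> combos {1, t}" "t \<in> combos {1, t}" "1 \<in> combos {1, t}" "2 * t \<in> combos {1, t}" "4 \<in> combos {1, t}"
    by (intro combos.add base num combos_numeral_mult)+
  show "1 = t * tan (pi / real 6)"
    using t by (simp add: t_def tan_30)
  show "z \<in> framed (2 * t) 4 t 1 t 1 t 1 t 1 \<longleftrightarrow> z - Complex t 2 \<in> ngon 6 t" for z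
  proof -
    define x where "x = Re z - t"
    define y where "y = Im z - 2"
    have z: "Re z = x + t" "Im z = y + 2"
      by (simp_all add: x_def y_def)
    have eqs: "2 * pi * real 1 / real 6 = pi / 3" "2 * pi * real 2 / real 6 = pi - pi / 3" "2 * pi * real 4 / real 6 = pi + pi / 3"
      "2 * pi * real 5 / real 6 = 2 * pi - pi / 3" "2 * pi * real 3 / real 6 = pi"
      by simp_all
    have trig: "cos (2 * pi * real 0 / real 6) = 1" "sin (2 * pi * real 0 / real 6) = 0"
      "cos (2 * pi * real 1 / real 6) = 1 / 2" "sin (2 * pi * real 1 / real 6) = t / 2"
      "cos (2 * pi * real 2 / real 6) = - 1 / 2" "sin (2 * pi * real 2 / real 6) = t / 2"
      "cos (2 * pi * real 3 / real 6) = - 1" "sin (2 * pi * real 3 / real 6) = 0"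
      "cos (2 * pi * real 4 / real 6) = - 1 / 2" "sin (2 * pi * real 4 / real 6) = - t / 2"
      "cos (2 * pi * real 5 / real 6) = 1 / 2" "sin (2 * pi * real 5 / real 6) = - t / 2"
      unfolding eqs cos_diff sin_diff cos_add sin_add cos_60 sin_60 cos_pi sin_pi cos_two_pi sin_two_pi
      by (simp_all add: t_def)
    have all: "(\<forall>i<6. Q i) \<longleftrightarrow> Q 0 \<and> Q 1 \<and> Q 2 \<and> Q 3 \<and> Q 4 \<and> Q 5" for Q :: "nat \<Rightarrow> bool"
      by (simp add: All_less_numeral)
    have re: "Re (z - Complex t 2) = x" "Im (z - Complex t 2) = y"
      by (simp_all add: x_def y_def)
    have prods: "x * (1 / 2) = x / 2" "x * (- 1 / 2) = - x / 2" "y * (t / 2) = t * y / 2"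
      "y * (- t / 2) = - (t * y / 2)" "x * 1 = x" "y * 0 = 0" "x * - 1 = - x"
      by simp_all
    have ngon: "z - Complex t 2 \<in> ngon 6 t \<longleftrightarrow> x + 0 \<le> t \<and> x / 2 + t * y / 2 \<le> t \<and> - x / 2 + t * y / 2 \<le> t
        \<and> - x + 0 \<le> t \<and> - x / 2 + - (t * y / 2) \<le> t \<and> x / 2 + - (t * y / 2) \<le> t"
      unfolding in_ngon all trig re prods by (rule refl)
    have prods': "t * (y + 2) = t * y + 2 * t" "t * (4 - (y + 2)) = 2 * t - t * y" "2 * t - (x + t) = t - x"
      by (simp_all add: algebra_simps)
    have frame: "z \<in> framed (2 * t) 4 t 1 t 1 t 1 t 1 \<longleftrightarrow> (0 \<le> x + t \<and> x + t \<le> 2 * t \<and> 0 \<le> y + 2 \<and> y + 2 \<le> 4)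
        \<and> t \<le> x + t + (t * y + 2 * t) \<and> t \<le> t - x + (t * y + 2 * t)
        \<and> t \<le> t - x + (2 * t - t * y) \<and> t \<le> x + t + (2 * t - t * y)"
      unfolding framed_def rect_def mem_Collect_eq z prods' mult_1 mult_1_right by (rule refl)
    show ?thesis
    proof
      assume "z \<in> framed (2 * t) 4 t 1 t 1 t 1 t 1"
      then show "z - Complex t 2 \<in> ngon 6 t"
        unfolding frame ngon by (elim conjE) (intro conjI; linarith)
    next
      assume n: "z - Complex t 2 \<in> ngon 6 t"
      \<comment> \<open>Adding the constraints of the two upper edges, and those of the two lower
        ones, eliminates \<open>x\<close> and bounds the height.\<close>
      then have "t * y \<le> t * 2" "t * (- 2) \<le> t * y"
        unfolding ngon by (elim conjE, linarith)+
      then have "y \<le> 2" "- 2 \<le> y"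
        using t by (simp_all only: mult_le_cancel_left_pos)
      then show "z \<in> framed (2 * t) 4 t 1 t 1 t 1 t 1"
        using n unfolding frame ngon by (elim conjE) (intro conjI; linarith)
    qed
  qed
qed (auto simp: t_def)

text \<open>The octagon of side 2, obtained from a square of side \<open>2 + 2 * t\<close> by
  cutting off isosceles right triangles with hypotenuse 2.\<close>

lemma octagon_gadget:
  defines "t \<equiv> sqrt 2"
  shows "star_gadget {1, t} (1 + t) 8 (1 + t) 1 (2 + 2 * t) (2 + 2 * t) t t t t (Complex (1 + t) (1 + t))"
proof
  have tt: "t * t = 2" and t: "t > 0"
    by (simp_all add: t_def)
  have base: "1 \<in> combos {1, t}" "t \<in> combos {1, t}"
    by (auto intro: combos.base)
  have num: "numeral k \<in> combos {1, t}" for k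
    using combos_numeral_mult[OF base(1)] by simp
  show "l * m \<in> combos {1, t}" if "l \<in> {1, t}" "m \<in> {1, t}" for l m
    using that tt by (auto intro: base num)
  show "(1 + t) * l \<in> one_more {1, t}" if "l \<in> {1, t}" for l
    using that
  proof (elim insertE emptyE)
    assume "l = t"
    then have "(1 + t) * l = 1 + (1 + t)"
      using tt by (simp add: algebra_simps)
    then show ?thesis
      by (rule one_moreI) (intro combos.add base)
  qed (auto intro: one_moreI base)
  show "1 + t \<in> combos {1, t}" "t \<in> combos {1, t}" "1 \<in> combos {1, t}"
    "2 + 2 * t \<in> combos {1, t}"
    by (intro combos.add base num combos_numeral_mult)+
  show "1 = (1 + t) * tan (pi / real 8)"
  proof -
    have "tan (pi / 8) = sin (pi / 4) / (cos (pi / 4) + 1)"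
      using tan_half[of "pi / 8"] by simp
    also have "\<dots> = t / (t + 2)"
      by (simp add: sin_45 cos_45 t_def field_simps)
    finally have "(1 + t) * tan (pi / 8) = (t + t * t) / (t + 2)"
      by (simp add: algebra_simps)
    then show ?thesis
      using t tt by simp
  qed
  show "z \<in> framed (2 + 2 * t) (2 + 2 * t) t t t t t t t t \<longleftrightarrow> z - Complex (1 + t) (1 + t) \<in> ngon 8 (1 + t)" for z
  proof -
    define x where "x = Re z - (1 + t)"
    define y where "y = Im z - (1 + t)"
    have z: "Re z = x + (1 + t)" "Im z = y + (1 + t)"
      by (simp_all add: x_def y_def)
    have eqs: "2 * pi * real 1 / real 8 = pi / 4" "2 * pi * real 2 / real 8 = pi / 2"
      "2 * pi * real 3 / real 8 = pi - pi / 4" "2 * pi * real 4 / real 8 = pi"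
      "2 * pi * real 5 / real 8 = pi + pi / 4" "2 * pi * real 6 / real 8 = pi + pi / 2"
      "2 * pi * real 7 / real 8 = 2 * pi - pi / 4"
      by simp_all
    have trig: "cos (2 * pi * real 0 / real 8) = 1" "sin (2 * pi * real 0 / real 8) = 0"
      "cos (2 * pi * real 1 / real 8) = t / 2" "sin (2 * pi * real 1 / real 8) = t / 2"
      "cos (2 * pi * real 2 / real 8) = 0" "sin (2 * pi * real 2 / real 8) = 1"
      "cos (2 * pi * real 3 / real 8) = - t / 2" "sin (2 * pi * real 3 / real 8) = t / 2"
      "cos (2 * pi * real 4 / real 8) = - 1" "sin (2 * pi * real 4 / real 8) = 0"
      "cos (2 * pi * real 5 / real 8) = - t / 2" "sin (2 * pi * real 5 / real 8) = - t / 2"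
      "cos (2 * pi * real 6 / real 8) = 0" "sin (2 * pi * real 6 / real 8) = - 1"
      "cos (2 * pi * real 7 / real 8) = t / 2" "sin (2 * pi * real 7 / real 8) = - t / 2"
      unfolding eqs cos_diff sin_diff cos_add sin_add cos_45 sin_45 cos_pi sin_pi cos_two_pi sin_two_pi
        cos_pi_half sin_pi_half
      by (simp_all add: t_def)
    have all: "(\<forall>i<8. Q i) \<longleftrightarrow> Q 0 \<and> Q 1 \<and> Q 2 \<and> Q 3 \<and> Q 4 \<and> Q 5 \<and> Q 6 \<and> Q 7" for Q :: "nat \<Rightarrow> bool"
      by (simp add: All_less_numeral)
    have re: "Re (z - Complex (1 + t) (1 + t)) = x" "Im (z - Complex (1 + t) (1 + t)) = y"
      by (simp_all add: x_def y_def)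
    have prods: "x * (t / 2) = t * x / 2" "x * (- t / 2) = - (t * x / 2)" "y * (t / 2) = t * y / 2"
      "y * (- t / 2) = - (t * y / 2)" "x * 1 = x" "y * 0 = 0" "x * - 1 = - x" "x * 0 = 0" "y * 1 = y" "y * - 1 = - y"
      by simp_all
    have ngon: "z - Complex (1 + t) (1 + t) \<in> ngon 8 (1 + t) \<longleftrightarrow> x + 0 \<le> 1 + t \<and> t * x / 2 + t * y / 2 \<le> 1 + t
        \<and> 0 + y \<le> 1 + t \<and> - (t * x / 2) + t * y / 2 \<le> 1 + t \<and> - x + 0 \<le> 1 + t
        \<and> - (t * x / 2) + - (t * y / 2) \<le> 1 + t \<and> 0 + - y \<le> 1 + t \<and> t * x / 2 + - (t * y / 2) \<le> 1 + t"
      unfolding in_ngon all trig re prods by (rule refl)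
    have prods': "t * (x + (1 + t)) = t * x + t + 2" "t * (2 + 2 * t - (x + (1 + t))) = t + 2 - t * x"
      "t * (y + (1 + t)) = t * y + t + 2" "t * (2 + 2 * t - (y + (1 + t))) = t + 2 - t * y"
      using tt by (simp_all add: algebra_simps)
    have frame: "z \<in> framed (2 + 2 * t) (2 + 2 * t) t t t t t t t t \<longleftrightarrow>
        (0 \<le> x + (1 + t) \<and> x + (1 + t) \<le> 2 + 2 * t \<and> 0 \<le> y + (1 + t) \<and> y + (1 + t) \<le> 2 + 2 * t)
        \<and> 2 \<le> t * x + t + 2 + (t * y + t + 2) \<and> 2 \<le> t + 2 - t * x + (t * y + t + 2)
        \<and> 2 \<le> t + 2 - t * x + (t + 2 - t * y) \<and> 2 \<le> t * x + t + 2 + (t + 2 - t * y)"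
      unfolding framed_def rect_def mem_Collect_eq z prods' tt by (rule refl)
    show ?thesis
      unfolding ngon frame by (intro iffI; elim conjE; intro conjI; linarith)
  qed
qed (auto simp: t_def)

text \<open>Here \<open>g\<close> is the golden ratio and \<open>s\<close> satisfies
  \<open>s * s = 2 + g\<close>. The pentagon has a vertex on the left and a vertical edge on the
  right: the width is circumradius \<open>2 + 2 * g\<close> plus inradius \<open>1 + 2 * g\<close>,
  and the height is a diagonal, \<open>g\<close> times the side \<open>2 * (g * s)\<close>.\<close>

lemma pentagon_gadget:
  defines "g \<equiv> 1 + 2 * cos (2 * pi / 5)" and "s \<equiv> 2 * sin (2 * pi / 5)"
  shows "star_gadget {1, g, s, g * s} (1 + g + s) 5 (1 + 2 * g) (g * s) (3 + 4 * g) (2 * s + 2 * (g * s))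
    (2 + g) (s + g * s) (1 + 3 * g) s (Complex (2 + 2 * g) (s + g * s))"
proof
  have c: "cos (2 * pi / 5) > 0" "cos (2 * pi / 5) \<noteq> 1" and s: "s > 0"
  proof -
    show "cos (2 * pi / 5) > 0"
      by (rule cos_gt_zero) auto
    have "sin (2 * pi / 5) > 0"
      by (rule sin_gt_zero) auto
    then show "s > 0"
      by (simp add: s_def)
    show "cos (2 * pi / 5) \<noteq> 1"
    proof
      assume "cos (2 * pi / 5) = 1"
      then have "(sin (2 * pi / 5))\<^sup>2 = 0"
        using sin_cos_squared_add[of "2 * pi / 5"] by simp
      then show False
        using \<open>sin (2 * pi / 5) > 0\<close> by simp
    qed
  qed
  have double: "cos (4 * pi / 5) = 2 * (cos (2 * pi / 5))\<^sup>2 - 1" "sin (4 * pi / 5) = 2 * sin (2 * pi / 5) * cos (2 * pi / 5)"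
    using cos_double_cos[of "2 * pi / 5"] sin_double[of "2 * pi / 5"] by simp_all
  have gg: "g * g = 1 + g"
  proof -
    let ?x = "cos (2 * pi / 5)"
    \<comment> \<open>The triple and the double of 72 degrees have the same cosine. Equating the two
      polynomials in that cosine and removing the root 1 gives the golden ratio equation.\<close>
    have "6 * pi / 5 = 2 * pi - 4 * pi / 5"
      by simp
    then have "cos (6 * pi / 5) = cos (4 * pi / 5)"
      by (simp only: cos_diff cos_two_pi sin_two_pi)
    moreover have "cos (6 * pi / 5) = 4 * ?x ^ 3 - 3 * ?x"
      using cos_treble_cos[of "2 * pi / 5"] by simp
    ultimately have "4 * ?x ^ 3 - 3 * ?x = 2 * ?x\<^sup>2 - 1"
      using double by simp
    then have "(?x - 1) * (4 * ?x\<^sup>2 + 2 * ?x - 1) = 0"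
      by (simp add: algebra_simps power2_eq_square power3_eq_cube)
    then have "4 * ?x\<^sup>2 + 2 * ?x - 1 = 0"
      using c(2) by simp
    then show ?thesis
      by (simp add: g_def algebra_simps power2_eq_square)
  qed
  have g: "g > 1"
    using c by (simp add: g_def)
  have cos72: "cos (2 * pi / 5) = (g - 1) / 2" and sin72: "sin (2 * pi / 5) = s / 2"
    by (simp_all add: g_def s_def)
  have ss: "s * s = 2 + g"
  proof -
    have "(s / 2)\<^sup>2 + ((g - 1) / 2)\<^sup>2 = 1"
      unfolding cos72[symmetric] sin72[symmetric] by simp
    then show ?thesis
      using gg by (simp add: power2_eq_square field_simps)
  qed
  have ggx: "g * (g * x) = x + g * x" for x
    using gg by (metis distrib_right mult.assoc mult_1)
  have ssx: "s * (s * x) = 2 * x + g * x" for x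
    using ss by (metis distrib_right mult.assoc)
  \<comment> \<open>As rewrite rules these reduce polynomials in \<open>g\<close> and
    \<open>s\<close> to combinations of 1, \<open>g\<close>, \<open>s\<close> and
    \<open>g * s\<close>.\<close>
  note alg = gg ss ggx ssx
  have cos144: "cos (4 * pi / 5) = - g / 2" and sin144: "sin (4 * pi / 5) = (g * s - s) / 2"
    unfolding double cos72 sin72 by (simp_all add: power2_eq_square field_simps gg)
  let ?L = "{1, g, s, g * s}"
  have base: "1 \<in> combos ?L" "g \<in> combos ?L" "s \<in> combos ?L" "g * s \<in> combos ?L"
    by (auto intro: combos.base)
  have num: "numeral k \<in> combos ?L" for k
    using combos_numeral_mult[OF base(1)] by simp
  note mem = combos.add base num combos_numeral_mult
  show "l * m \<in> combos ?L" if "l \<in> ?L" "m \<in> ?L" for l m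
  proof -
    have sg: "s * g = g * s" "s * (g * s) = 1 + 3 * g" "g * s * g = s + g * s" "g * s * s = 1 + 3 * g"
      "g * s * (g * s) = 3 + 4 * g" "g * (g * s) = s + g * s"
      by (simp_all add: algebra_simps alg)
    have "1 + g \<in> combos ?L" "2 + g \<in> combos ?L" "1 + 3 * g \<in> combos ?L" "s + g * s \<in> combos ?L"
      "3 + 4 * g \<in> combos ?L"
      by (intro mem)+
    then show ?thesis
      using that base by (elim insertE emptyE) (simp_all only: mult_1 mult_1_right sg gg ss)
  qed
  \<comment> \<open>The summand \<open>s\<close> of the multiplier is there for the lengths
    \<open>s\<close> and \<open>g * s\<close>: their products with 1 and \<open>g\<close> contain no
    unit, but those with \<open>s\<close> do.\<close>
  show "(1 + g + s) * l \<in> one_more ?L" if "l \<in> ?L" for l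
    using that
  proof (elim insertE emptyE)
    assume "l = 1"
    then show ?thesis
      by (intro one_moreI[of _ "g + s"] mem) simp
  next
    assume "l = g"
    then show ?thesis
      by (intro one_moreI[of _ "2 * g + g * s"] mem) (simp add: algebra_simps alg)
  next
    assume "l = s"
    then show ?thesis
      by (intro one_moreI[of _ "1 + g + s + g * s"] mem) (simp add: algebra_simps alg)
  next
    assume "l = g * s"
    then show ?thesis
      by (intro one_moreI[of _ "2 * (g * s) + s + 3 * g"] mem) (simp add: algebra_simps alg)
  qed
  show "1 + g + s \<in> combos ?L" "1 + 2 * g \<in> combos ?L" "g * s \<in> combos ?L" "3 + 4 * g \<in> combos ?L"
    "2 * s + 2 * (g * s) \<in> combos ?L" "2 + g \<in> combos ?L" "s + g * s \<in> combos ?L" "1 + 3 * g \<in> combos ?L"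
    "s \<in> combos ?L"
    by (intro mem)+
  show "l > 0" if "l \<in> ?L" for l
    using that g s by auto
  show "g * s = (1 + 2 * g) * tan (pi / real 5)"
  proof -
    have "tan (pi / 5) = sin (2 * pi / 5) / (cos (2 * pi / 5) + 1)"
      using tan_half[of "pi / 5"] by simp
    also have "\<dots> = s / (1 + g)"
      unfolding cos72 sin72 using g by (simp add: field_simps)
    finally have "(1 + 2 * g) * tan (pi / 5) = ((1 + 2 * g) * s) / (1 + g)"
      by simp
    also have "(1 + 2 * g) * s = (g * s) * (1 + g)"
      by (simp add: algebra_simps alg)
    also have "\<dots> / (1 + g) = g * s"
      using g by simp
    finally show ?thesis
      by simp
  qed
  show "2 + g + (1 + 3 * g) \<le> 3 + 4 * g" "2 * (s + g * s) \<le> 2 * s + 2 * (g * s)"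
    by simp_all
  have gs: "g * s > 0"
    using g s by simp
  show "2 * s \<le> 2 * s + 2 * (g * s)" "s + g * s + s \<le> 2 * s + 2 * (g * s)"
    using gs by simp_all
  let ?c = "Complex (2 + 2 * g) (s + g * s)"
  show "z \<in> framed (3 + 4 * g) (2 * s + 2 * (g * s)) (2 + g) (s + g * s) (1 + 3 * g) s (1 + 3 * g) s (2 + g) (s + g * s)
      \<longleftrightarrow> z - ?c \<in> ngon 5 (1 + 2 * g)" (is "z \<in> ?F \<longleftrightarrow> _") for z
  proof -
    define x where "x = Re z - (2 + 2 * g)"
    define y where "y = Im z - (s + g * s)"
    have z: "Re z = x + (2 + 2 * g)" "Im z = y + (s + g * s)" and re: "Re (z - ?c) = x" "Im (z - ?c) = y"
      by (simp_all add: x_def y_def)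
    \<comment> \<open>The slacks of the four slanted edges.\<close>
    define n1 where "n1 = 1 + 2 * g - (x * ((g - 1) / 2) + y * (s / 2))"
    define n2 where "n2 = 1 + 2 * g - (x * (- g / 2) + y * ((g * s - s) / 2))"
    define n3 where "n3 = 1 + 2 * g - (x * (- g / 2) + y * (- ((g * s - s) / 2)))"
    define n4 where "n4 = 1 + 2 * g - (x * ((g - 1) / 2) + y * (- (s / 2)))"
    note n = n1_def n2_def n3_def n4_def
    have eqs: "2 * pi * real 1 / real 5 = 2 * pi / 5" "2 * pi * real 2 / real 5 = 4 * pi / 5"
      "2 * pi * real 3 / real 5 = 2 * pi - 4 * pi / 5" "2 * pi * real 4 / real 5 = 2 * pi - 2 * pi / 5"
      by simp_all
    have trig: "cos (2 * pi * real 0 / real 5) = 1" "sin (2 * pi * real 0 / real 5) = 0"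
      "cos (2 * pi * real 1 / real 5) = (g - 1) / 2" "sin (2 * pi * real 1 / real 5) = s / 2"
      "cos (2 * pi * real 2 / real 5) = - g / 2" "sin (2 * pi * real 2 / real 5) = (g * s - s) / 2"
      "cos (2 * pi * real 3 / real 5) = - g / 2" "sin (2 * pi * real 3 / real 5) = - ((g * s - s) / 2)"
      "cos (2 * pi * real 4 / real 5) = (g - 1) / 2" "sin (2 * pi * real 4 / real 5) = - (s / 2)"
      unfolding eqs cos_diff sin_diff cos_two_pi sin_two_pi cos72 sin72 cos144 sin144 by simp_all
    have all: "(\<forall>i<5. Q i) \<longleftrightarrow> Q 0 \<and> Q 1 \<and> Q 2 \<and> Q 3 \<and> Q 4" for Q :: "nat \<Rightarrow> bool"
      by (simp add: All_less_numeral)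
    have ngon: "z - ?c \<in> ngon 5 (1 + 2 * g) \<longleftrightarrow> x \<le> 1 + 2 * g \<and> 0 \<le> n1 \<and> 0 \<le> n2 \<and> 0 \<le> n3 \<and> 0 \<le> n4"
      unfolding in_ngon all trig re n by simp
    have K: "2 * (g * s) > 0"
      using gs by simp
    \<comment> \<open>Each corner line of the frame is an edge line of the pentagon, its equation
      being scaled by \<open>2 * (g * s)\<close>.\<close>
    have lines: "(s + g * s) * Re z + (2 + g) * Im z - (2 + g) * (s + g * s) = 2 * (g * s) * n3"
      "s * (3 + 4 * g - Re z) + (1 + 3 * g) * Im z - (1 + 3 * g) * s = 2 * (g * s) * n4"
      "s * (3 + 4 * g - Re z) + (1 + 3 * g) * (2 * s + 2 * (g * s) - Im z) - (1 + 3 * g) * s = 2 * (g * s) * n1"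
      "(s + g * s) * Re z + (2 + g) * (2 * s + 2 * (g * s) - Im z) - (2 + g) * (s + g * s) = 2 * (g * s) * n2"
      unfolding z n by (simp_all add: field_simps alg)
    have line: "a \<le> b \<longleftrightarrow> 0 \<le> m" if "b - a = 2 * (g * s) * m" for a b m
    proof -
      have "a \<le> b \<longleftrightarrow> 0 \<le> 2 * (g * s) * m"
        unfolding that[symmetric] by simp
      then show ?thesis
        using K by (metis mult_zero_right mult_le_cancel_left_pos)
    qed
    have frame: "z \<in> ?F \<longleftrightarrow> (0 \<le> Re z \<and> Re z \<le> 3 + 4 * g \<and> 0 \<le> Im z \<and> Im z \<le> 2 * s + 2 * (g * s))
        \<and> 0 \<le> n3 \<and> 0 \<le> n4 \<and> 0 \<le> n1 \<and> 0 \<le> n2"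
      unfolding framed_def rect_def mem_Collect_eq
      by (simp only: line[OF lines(1)] line[OF lines(2)] line[OF lines(3)] line[OF lines(4)]
          diff_diff_eq add.assoc conj_assoc)
    \<comment> \<open>Three sides of the box follow from the slanted edges, being nonnegative
      combinations of the slacks; the right side is the vertical edge itself.\<close>
    have "0 \<le> Re z \<and> 0 \<le> Im z \<and> Im z \<le> 2 * s + 2 * (g * s)" if "0 \<le> n1" "0 \<le> n2" "0 \<le> n3" "0 \<le> n4"
    proof (intro conjI)
      have "g * Re z = n2 + n3"
        unfolding z n by (simp add: field_simps alg)
      then show "0 \<le> Re z"
        using that g by (metis add_nonneg_nonneg less_trans zero_le_mult_iff zero_less_one not_less)
      have "s * Im z = g * n4 + (g - 1) * n3"
        unfolding z n by (simp add: field_simps alg)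
      moreover have "0 \<le> g * n4 + (g - 1) * n3"
        using that g by (intro add_nonneg_nonneg mult_nonneg_nonneg) auto
      ultimately show "0 \<le> Im z"
        using s by (metis zero_le_mult_iff not_less)
      have "s * (2 * s + 2 * (g * s) - Im z) = g * n1 + (g - 1) * n2"
        unfolding z n by (simp add: field_simps alg)
      moreover have "0 \<le> g * n1 + (g - 1) * n2"
        using that g by (intro add_nonneg_nonneg mult_nonneg_nonneg) auto
      ultimately have "0 \<le> 2 * s + 2 * (g * s) - Im z"
        using s by (metis zero_le_mult_iff not_less)
      then show "Im z \<le> 2 * s + 2 * (g * s)"
        by simp
    qed
    moreover have "Re z \<le> 3 + 4 * g \<longleftrightarrow> x \<le> 1 + 2 * g"
      unfolding z by linarith
    ultimately show ?thesis
      unfolding frame ngon by blast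
  qed
qed auto

theorem theorem1:
  fixes n :: nat
  assumes "n \<in> {2, 3, 4, 5, 6, 8}"
  shows "\<exists>\<sigma> H. primitive \<sigma> \<and> is_hull_of H \<sigma> \<and>
    (\<exists>T\<in>H. \<exists>c.
       DTO \<sigma> T \<and>
       invariant_under (rotation c (2 * pi / real n)) T \<and>
       (\<forall>a \<alpha>. \<not> invariant_under (reflection a \<alpha>) T) \<and>
       (\<forall>\<alpha>. is_tiling (move (reflection c \<alpha>) ` T) \<and>
            move (reflection c \<alpha>) ` T \<noteq> T \<and>
            move (reflection c \<alpha>) ` T \<in> H \<and>
            invariant_under (rotation c (2 * pi / real n)) (move (reflection c \<alpha>) ` T)))"
proof -
  \<comment> \<open>The octagon covers 2, 4 and 8, the hexagon 3 and 6, the pentagon 5.\<close>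
  consider "n dvd 8" | "n dvd 6" | "n dvd 5"
    using assms by fastforce
  then have "has_symmetric_DTO_tiling n"
  proof cases
    case 1
    then show ?thesis
      by (rule star_gadget.symmetric_tiling_exists[OF octagon_gadget])
  next
    case 2
    then show ?thesis
      by (rule star_gadget.symmetric_tiling_exists[OF hexagon_gadget])
  next
    case 3
    then show ?thesis
      by (rule star_gadget.symmetric_tiling_exists[OF pentagon_gadget])
  qed
  then show ?thesis
    by (simp only: has_symmetric_DTO_tiling_def)
qed

end
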